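(* A Laguerre plane $\mathbb{L}=(\mathcal{P},\mathcal{C},\parallel)$ satisfies axioms (C) and (S) if and only if it is a miquelian Laguerre plane of characteristic different from $2$.
   Context: A Laguerre plane is a triple $(\mathcal{P},\mathcal{C},\parallel)$ where $\mathcal{P}$ is a set of points, $\mathcal{C}\subset 2^{\mathcal{P}}$ a set of circles and $\parallel$ an equivalence relation on $\mathcal{P}$ (parallelism; its classes are called generators) such that: (1) any three pairwise non-parallel points lie on a unique circle; (2) for every circle $K$ and non-parallel points $p\in K$, $q\notin K$ there is exactly one circle $L$ with $q\in L$ and $K\cap L=\{p\}$; (3) for every point $p$ and circle $K$ there is exactly one point $q\in K$ with $q\parallel p$; (4) some circle contains at least three but not all points. Circles $K,L$ are tangent at $p$ if $K\cap L=\{p\}$ or $K=L$ (with $p\in K$). For $p\in K$, $\langle p,K\rangle$ denotes the set of circles tangent to $K$ at $p$. Axiom (C): for any circles $K,L$ and any point $p\in K\setminus L$ there exists exactly one circle $M\in\langle p,K\rangle$ with $|M\cap L|=1$. Axiom (S): if $K,L,M,N$ are circles and $a,b,c,d$ points with $K\cap L=\{a\}$, $L\cap M=\{b\}$, $M\cap N=\{c\}$, $N\cap K=\{d\}$ and $a\nparallel c$, then there is a circle containing $a,b,c,d$. A quadruple $(a,b,c,d)$ of points is concyclic, written $(a,b,c,d)_{\triangle}$, if $a,b,c,d$ lie on a common circle, or $a\parallel b$, $c\parallel d$ and $a\nparallel c$. The plane is miquelian if for any eight distinct points $a,b,c,d,e,f,g,h$, the relations $(a,c,b,d)_{\triangle}$,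 $(a,e,b,h)_{\triangle}$, $(a,g,d,h)_{\triangle}$, $(b,f,c,e)_{\triangle}$, $(c,g,d,f)_{\triangle}$ imply $(e,g,f,h)_{\triangle}$. Miquelian Laguerre planes are exactly the classical ones over commutative fields $F$ (plane sections of a quadratic cone in the projective space over $F$); the characteristic of the plane is the characteristic of $F$. *)

theory Defs
  imports "HOL-Algebra.Ring"
begin

definition laguerre_plane :: "'p set \<Rightarrow> 'p set set \<Rightarrow> ('p \<Rightarrow> 'p \<Rightarrow> bool) \<Rightarrow> bool" where
  "laguerre_plane P C par \<longleftrightarrow>
     (\<forall>K\<in>C. K \<subseteq> P) \<and>
     (\<forall>p\<in>P. par p p) \<and>
     (\<forall>p\<in>P. \<forall>q\<in>P. par p q \<longrightarrow> par q p) \<and>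
     (\<forall>p\<in>P. \<forall>q\<in>P. \<forall>r\<in>P. par p q \<longrightarrow> par q r \<longrightarrow> par p r) \<and>
     (\<forall>p\<in>P. \<forall>q\<in>P. \<forall>r\<in>P. \<not> par p q \<longrightarrow> \<not> par q r \<longrightarrow> \<not> par p r \<longrightarrow>
        (\<exists>!K. K \<in> C \<and> p \<in> K \<and> q \<in> K \<and> r \<in> K)) \<and>
     (\<forall>K\<in>C. \<forall>p\<in>K. \<forall>q\<in>P. q \<notin> K \<longrightarrow> \<not> par p q \<longrightarrow>
        (\<exists>!L. L \<in> C \<and> q \<in> L \<and> K \<inter> L = {p})) \<and>
     (\<forall>p\<in>P. \<forall>K\<in>C. \<exists>!q. q \<in> K \<and> par q p) \<and>
     (\<exists>K\<in>C. (\<exists>a b c. a \<in> K \<and> b \<in> K \<and> c \<in> K \<and> a \<noteq> b \<and> a \<noteq> c \<and> b \<noteq> c) \<and> K \<noteq> P)"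

definition tangent_at :: "'p set \<Rightarrow> 'p set \<Rightarrow> 'p \<Rightarrow> bool" where
  "tangent_at K L p \<longleftrightarrow> K \<inter> L = {p} \<or> (K = L \<and> p \<in> K)"

definition tangent_pencil :: "'p set set \<Rightarrow> 'p \<Rightarrow> 'p set \<Rightarrow> 'p set set" where
  "tangent_pencil C p K = {L \<in> C. tangent_at K L p}"

definition axiom_C :: "'p set \<Rightarrow> 'p set set \<Rightarrow> ('p \<Rightarrow> 'p \<Rightarrow> bool) \<Rightarrow> bool" where
  "axiom_C P C par \<longleftrightarrow>
     (\<forall>K\<in>C. \<forall>L\<in>C. \<forall>p \<in> K - L.
        \<exists>!M. M \<in> tangent_pencil C p K \<and> (\<exists>x. M \<inter> L = {x}))"

definition axiom_S :: "'p set \<Rightarrow> 'p set set \<Rightarrow> ('p \<Rightarrow> 'p \<Rightarrow> bool) \<Rightarrow> bool" where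
  "axiom_S P C par \<longleftrightarrow>
     (\<forall>K\<in>C. \<forall>L\<in>C. \<forall>M\<in>C. \<forall>N\<in>C. \<forall>a\<in>P. \<forall>b\<in>P. \<forall>c\<in>P. \<forall>d\<in>P.
        K \<inter> L = {a} \<longrightarrow> L \<inter> M = {b} \<longrightarrow> M \<inter> N = {c} \<longrightarrow> N \<inter> K = {d} \<longrightarrow>
        \<not> par a c \<longrightarrow> (\<exists>Z\<in>C. a \<in> Z \<and> b \<in> Z \<and> c \<in> Z \<and> d \<in> Z))"

definition concyclic :: "'p set set \<Rightarrow> ('p \<Rightarrow> 'p \<Rightarrow> bool) \<Rightarrow> 'p \<Rightarrow> 'p \<Rightarrow> 'p \<Rightarrow> 'p \<Rightarrow> bool" where
  "concyclic C par a b c d \<longleftrightarrow>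
     (\<exists>K\<in>C. a \<in> K \<and> b \<in> K \<and> c \<in> K \<and> d \<in> K) \<or> (par a b \<and> par c d \<and> \<not> par a c)"

definition miquelian :: "'p set \<Rightarrow> 'p set set \<Rightarrow> ('p \<Rightarrow> 'p \<Rightarrow> bool) \<Rightarrow> bool" where
  "miquelian P C par \<longleftrightarrow>
     (\<forall>a\<in>P. \<forall>b\<in>P. \<forall>c\<in>P. \<forall>d\<in>P. \<forall>e\<in>P. \<forall>f\<in>P. \<forall>g\<in>P. \<forall>h\<in>P.
        distinct [a, b, c, d, e, f, g, h] \<longrightarrow>
        concyclic C par a c b d \<longrightarrow> concyclic C par a e b h \<longrightarrow> concyclic C par a g d h \<longrightarrow>
        concyclic C par b f c e \<longrightarrow> concyclic C par c g d f \<longrightarrow>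
        concyclic C par e g f h)"

text \<open>The classical Laguerre plane over a commutative field F: points (x,y) with
  x \<in> F \<union> {\<infinity>} (None = \<infinity>), y \<in> F; circles are the sets
  {(x, a x^2 + b x + c) | x \<in> F} \<union> {(\<infinity>, a)}; parallel = same first coordinate.\<close>

definition classical_points :: "('f, 'm) ring_scheme \<Rightarrow> ('f option \<times> 'f) set" where
  "classical_points F = {(x, y). (x = None \<or> (\<exists>x'. x = Some x' \<and> x' \<in> carrier F)) \<and> y \<in> carrier F}"

definition classical_circle :: "('f, 'm) ring_scheme \<Rightarrow> 'f \<Rightarrow> 'f \<Rightarrow> 'f \<Rightarrow> ('f option \<times> 'f) set" where
  "classical_circle F a b c =
     {(Some x, a \<otimes>\<^bsub>F\<^esub> x \<otimes>\<^bsub>F\<^esub> x \<oplus>\<^bsub>F\<^esub> b \<otimes>\<^bsub>F\<^esub> x \<oplus>\<^bsub>F\<^esub> c) | x. x \<in> carrier F} \<union> {(None, a)}"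

definition classical_circles :: "('f, 'm) ring_scheme \<Rightarrow> ('f option \<times> 'f) set set" where
  "classical_circles F = {classical_circle F a b c | a b c. a \<in> carrier F \<and> b \<in> carrier F \<and> c \<in> carrier F}"

definition classical_par :: "('f option \<times> 'f) \<Rightarrow> ('f option \<times> 'f) \<Rightarrow> bool" where
  "classical_par u v \<longleftrightarrow> fst u = fst v"

definition iso_to_classical ::
  "'p set \<Rightarrow> 'p set set \<Rightarrow> ('p \<Rightarrow> 'p \<Rightarrow> bool) \<Rightarrow> ('f, 'm) ring_scheme \<Rightarrow> ('p \<Rightarrow> 'f option \<times> 'f) \<Rightarrow> bool" where
  "iso_to_classical P C par F \<phi> \<longleftrightarrow>
     bij_betw \<phi> P (classical_points F) \<and>
     (\<lambda>K. \<phi> ` K) ` C = classical_circles F \<and>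
     (\<forall>p\<in>P. \<forall>q\<in>P. par p q \<longleftrightarrow> classical_par (\<phi> p) (\<phi> q))"

text \<open>Characteristic different from 2: the plane is (isomorphic to) the classical plane over a
  commutative field F with 1 + 1 \<noteq> 0. Since |F| \<le> |P|, the field may be taken with carrier
  inside the point type.\<close>
definition laguerre_char_ne_2 :: "'p set \<Rightarrow> 'p set set \<Rightarrow> ('p \<Rightarrow> 'p \<Rightarrow> bool) \<Rightarrow> bool" where
  "laguerre_char_ne_2 P C par \<longleftrightarrow>
     (\<exists>(F :: 'p ring) \<phi>. field F \<and> iso_to_classical P C par F \<phi> \<and>
        \<one>\<^bsub>F\<^esub> \<oplus>\<^bsub>F\<^esub> \<one>\<^bsub>F\<^esub> \<noteq> \<zero>\<^bsub>F\<^esub>)"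

end

theory Submission
  imports Defs
begin

text \<open>
  Touching circles span a geometry in which (C) excludes triangles, and (S) gives parallelograms:
  if \<open>K\<close> touches \<open>L\<close> on the generator \<open>g\<close> and \<open>L\<close> touches \<open>M\<close> on \<open>h\<close>, then some \<open>N\<close> touches \<open>K\<close> on \<open>h\<close>
  and \<open>M\<close> on \<open>g\<close>. Together with (C), axiom (S) also says that a chain of four circles with contact
  points on a common circle closes up. From this one gets that steps along tangent pencils on a
  generator \<open>l\<close> are consistently transported to all points off \<open>l\<close>, so that they are automorphisms.
  These automorphisms generate an abelian group that is regular on the set of circles, which makes
  circles the elements of a group of functions. Reading off coefficients, the closing property says
  that the slopes of a function at two zeros are opposite; comparing the coefficients of
  \<open>a (x - k) (x - l)\<close>, \<open>a x (x - k)\<close> and \<open>a x (x - l)\<close> then forces the multiplications by \<open>k\<close> and \<open>l\<close>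
  to commute, and this yields a field.

  Conversely, in a classical plane put \<open>\<lambda>(p, q) = (y - y') / (x - x')\<close> for nonparallel points. Four points
  \<open>p, q, r, s\<close> are concyclic iff \<open>\<lambda>(p, r) + \<lambda>(q, s) = \<lambda>(p, s) + \<lambda>(q, r)\<close>, so that the theorem of Miquel is a
  cancellation. On a circle \<open>2 \<lambda>(p, q)\<close> is the sum of the derivatives at \<open>p\<close> and \<open>q\<close>, so that (S) is a
  cancellation too, and (C) holds because the discriminant of \<open>f + t (x - l)\<^sup>2\<close> is affine in \<open>t\<close>.
\<close>

subsection \<open>Touching circles\<close>

text \<open>With one extra point added, circles and points together are the points of a generalised
  quadrangle. Its lines are the tangent pencils, each completed by its carrier, and the generators,
  each completed by the extra point; (C) is the incidence axiom for a circle and a pencil. The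
  shifts turn it into a translation quadrangle with respect to the extra point. The obstacle is that
  (C) and (S) speak of single configurations of touching circles, while an elation has to act on all
  points: a step on one generator must be carried to the others independently of the circles used
  for it, which is \<open>touch_shift\<close>. Room is scarce throughout: the plane over the field
  with three elements has just four generators, so no argument may choose a fifth. Miquel's theorem
  is not derived from contacts. The synthetic half ends with coordinates, and (C), (S) and Miquel
  are all computed in the classical model. The field has to live on the type of points, which is why
  its elements are the points of one generator.\<close>

locale laguerre =
  fixes P :: "'p set" and C :: "'p set set" and par :: "'p \<Rightarrow> 'p \<Rightarrow> bool"
  assumes plane: "laguerre_plane P C par"
begin

lemmas axioms = plane[unfolded laguerre_plane_def]

lemma circle_sub: "K \<in> C \<Longrightarrow> p \<in> K \<Longrightarrow> p \<in> P"
  using axioms[THEN conjunct1] by blast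

lemma par_refl: "p \<in> P \<Longrightarrow> par p p"
  using axioms[THEN conjunct2, THEN conjunct1] by blast

lemma par_sym: "p \<in> P \<Longrightarrow> q \<in> P \<Longrightarrow> par p q \<Longrightarrow> par q p"
  using axioms[THEN conjunct2, THEN conjunct2, THEN conjunct1] by blast

lemma par_commute: "p \<in> P \<Longrightarrow> q \<in> P \<Longrightarrow> par p q \<longleftrightarrow> par q p"
  using par_sym by blast

lemma par_trans: "p \<in> P \<Longrightarrow> q \<in> P \<Longrightarrow> r \<in> P \<Longrightarrow> par p q \<Longrightarrow> par q r \<Longrightarrow> par p r"
  using axioms[THEN conjunct2, THEN conjunct2, THEN conjunct2, THEN conjunct1] by blast

lemma circle_ex1:
  assumes "p \<in> P" "q \<in> P" "r \<in> P" "\<not> par p q" "\<not> par q r" "\<not> par p r"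
  shows "\<exists>!K. K \<in> C \<and> p \<in> K \<and> q \<in> K \<and> r \<in> K"
  by (rule axioms[THEN conjunct2, THEN conjunct2, THEN conjunct2, THEN conjunct2,
      THEN conjunct1, rule_format]) (rule assms)+

lemma tangent_ex1:
  assumes "K \<in> C" "p \<in> K" "q \<in> P" "q \<notin> K" "\<not> par p q"
  shows "\<exists>!L. L \<in> C \<and> q \<in> L \<and> K \<inter> L = {p}"
  by (rule axioms[THEN conjunct2, THEN conjunct2, THEN conjunct2, THEN conjunct2,
      THEN conjunct2, THEN conjunct1, rule_format]) (rule assms)+

lemma proj_ex1: "K \<in> C \<Longrightarrow> p \<in> P \<Longrightarrow> \<exists>!q. q \<in> K \<and> par q p"
  using axioms[THEN conjunct2, THEN conjunct2, THEN conjunct2, THEN conjunct2,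
      THEN conjunct2, THEN conjunct2, THEN conjunct1] by blast

lemma nontrivial_circle:
  "\<exists>K\<in>C. (\<exists>a b c. a \<in> K \<and> b \<in> K \<and> c \<in> K \<and> a \<noteq> b \<and> a \<noteq> c \<and> b \<noteq> c) \<and> K \<noteq> P"
  using axioms[THEN conjunct2, THEN conjunct2, THEN conjunct2, THEN conjunct2,
      THEN conjunct2, THEN conjunct2, THEN conjunct2] .

text \<open>Circles are treated as sections of the generators. \<open>proj K\<close> depends only on
  the generator of its argument (\<open>proj_cong\<close>), so arbitrary points serve as names of
  generators, and circles are compared like functions.\<close>

definition proj :: "'p set \<Rightarrow> 'p \<Rightarrow> 'p" where
  "proj K p = (THE q. q \<in> K \<and> par q p)"

lemma proj_in: "K \<in> C \<Longrightarrow> p \<in> P \<Longrightarrow> proj K p \<in> K"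
  unfolding proj_def using theI'[OF proj_ex1] by blast

lemma proj_par: "K \<in> C \<Longrightarrow> p \<in> P \<Longrightarrow> par (proj K p) p"
  unfolding proj_def using theI'[OF proj_ex1] by blast

lemma proj_eqI: "K \<in> C \<Longrightarrow> q \<in> K \<Longrightarrow> par q p \<Longrightarrow> p \<in> P \<Longrightarrow> proj K p = q"
  using proj_ex1 proj_in proj_par by blast

lemma proj_P: "K \<in> C \<Longrightarrow> p \<in> P \<Longrightarrow> proj K p \<in> P"
  using circle_sub proj_in by blast

lemma proj_id: "K \<in> C \<Longrightarrow> p \<in> K \<Longrightarrow> proj K p = p"
  by (meson circle_sub par_refl proj_eqI)

lemma proj_cong: "K \<in> C \<Longrightarrow> p \<in> P \<Longrightarrow> q \<in> P \<Longrightarrow> par p q \<Longrightarrow> proj K p = proj K q"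
  by (metis par_trans proj_P proj_eqI proj_in proj_par)

lemma circle_par_eq: "K \<in> C \<Longrightarrow> p \<in> K \<Longrightarrow> q \<in> K \<Longrightarrow> par p q \<Longrightarrow> p = q"
  by (metis circle_sub proj_eqI proj_id)

lemma proj_proj: "K \<in> C \<Longrightarrow> L \<in> C \<Longrightarrow> p \<in> P \<Longrightarrow> proj K (proj L p) = proj K p"
  using proj_P proj_cong proj_par by blast

lemma circle_eqI:
  assumes "K \<in> C" "L \<in> C" "\<And>p. p \<in> P \<Longrightarrow> proj K p = proj L p"
  shows "K = L"
  by (metis assms circle_sub proj_id proj_in subsetI subset_antisym)

lemma circle_eqI3:
  assumes "K \<in> C" "L \<in> C" "p \<in> P" "q \<in> P" "r \<in> P" "\<not> par p q" "\<not> par q r" "\<not> par p r"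
    "proj K p = proj L p" "proj K q = proj L q" "proj K r = proj L r"
  shows "K = L"
proof -
  have *: "\<not> par (proj K x) (proj K y)" if "x \<in> P" "y \<in> P" "\<not> par x y" for x y
    using that assms(1) by (meson par_sym par_trans proj_P proj_par)
  show ?thesis
    using circle_ex1[of "proj K p" "proj K q" "proj K r"] * assms proj_in proj_P by metis
qed

lemma circle_ex:
  assumes "p \<in> P" "q \<in> P" "r \<in> P" "\<not> par p q" "\<not> par q r" "\<not> par p r"
  obtains K where "K \<in> C" "p \<in> K" "q \<in> K" "r \<in> K"
  using circle_ex1[OF assms] by blast

text \<open>Two circles touch on the generator of \<open>l\<close>; the contact point is not recorded.\<close>

definition touch :: "'p \<Rightarrow> 'p set \<Rightarrow> 'p set \<Rightarrow> bool" where
  "touch l K L \<longleftrightarrow> K = L \<or> (\<forall>p\<in>P. proj K p = proj L p \<longleftrightarrow> par p l)"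

lemma Int_singleton_iff:
  assumes "K \<in> C" "L \<in> C" "r \<in> P"
  shows "K \<inter> L = {r} \<longleftrightarrow> r \<in> K \<and> (\<forall>p\<in>P. proj K p = proj L p \<longleftrightarrow> par p r)"
proof
  assume *: "K \<inter> L = {r}"
  have "par p r" if "p \<in> P" "proj K p = proj L p" for p
  proof -
    have "proj K p \<in> K \<inter> L" using that assms proj_in by (metis IntI)
    thus ?thesis using * that assms proj_par par_sym by (metis proj_P singletonD)
  qed
  moreover have "proj K p = proj L p" if "p \<in> P" "par p r" for p
  proof -
    have "r \<in> K" "r \<in> L" using * by auto
    thus ?thesis using that assms proj_cong proj_id by metis
  qed
  ultimately show "r \<in> K \<and> (\<forall>p\<in>P. proj K p = proj L p \<longleftrightarrow> par p r)" using * by blast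
next
  assume *: "r \<in> K \<and> (\<forall>p\<in>P. proj K p = proj L p \<longleftrightarrow> par p r)"
  have "r \<in> L" using * assms par_refl proj_id proj_in by metis
  moreover have "x = r" if "x \<in> K" "x \<in> L" for x
    using that * assms circle_par_eq circle_sub proj_id by metis
  ultimately show "K \<inter> L = {r}" using * by blast
qed

lemma touch_iff_Int:
  assumes "K \<in> C" "L \<in> C" "l \<in> P"
  shows "touch l K L \<longleftrightarrow> K = L \<or> K \<inter> L = {proj K l}"
proof -
  have "par p (proj K l) \<longleftrightarrow> par p l" if "p \<in> P" for p
    using that assms by (meson par_sym par_trans proj_P proj_par)
  thus ?thesis unfolding touch_def
    using Int_singleton_iff[OF assms(1,2) proj_P[OF assms(1,3)]] proj_in[OF assms(1,3)] by auto
qed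

lemma touch_refl: "touch l K K"
  by (simp add: touch_def)

lemma touch_sym: "touch l K L \<Longrightarrow> touch l L K"
  unfolding touch_def by metis

lemma touch_cong: "touch l K L \<Longrightarrow> l \<in> P \<Longrightarrow> m \<in> P \<Longrightarrow> par l m \<Longrightarrow> touch m K L"
  unfolding touch_def by (meson par_sym par_trans)

lemma touch_proj: "touch l K L \<Longrightarrow> l \<in> P \<Longrightarrow> proj K l = proj L l"
  unfolding touch_def using par_refl by blast

lemma touch_eqI:
  "touch l K L \<Longrightarrow> p \<in> P \<Longrightarrow> \<not> par p l \<Longrightarrow> proj K p = proj L p \<Longrightarrow> K = L"
  unfolding touch_def by blast

text \<open>If \<open>K\<close> and \<open>M\<close> met again off the generator of
  \<open>l\<close>, both would be the circle through that point touching \<open>L\<close> at its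
  point on \<open>l\<close>, and the tangency axiom would identify them.\<close>

lemma touch_trans:
  assumes "K \<in> C" "L \<in> C" "M \<in> C" "l \<in> P" "touch l K L" "touch l L M"
  shows "touch l K M"
proof (cases "K = L \<or> L = M \<or> K = M")
  case True thus ?thesis using assms touch_def by blast
next
  case False
  have "par p l" if p: "p \<in> P" and eq: "proj K p = proj M p" for p
  proof (rule ccontr)
    assume np: "\<not> par p l"
    let ?q = "proj K p" and ?r = "proj L l"
    have KL: "K \<inter> L = {?r}" and LM: "L \<inter> M = {?r}"
      using assms False touch_iff_Int touch_proj by metis+
    have q: "?q \<in> P" "?q \<in> K" "?q \<in> M" using assms p eq proj_P proj_in by metis+
    have "\<not> par ?r ?q"
      using np p assms q by (meson par_sym par_trans proj_P proj_par)
    moreover have "?q \<notin> L"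
      using KL q calculation par_refl by (metis IntI singletonD)
    ultimately have "K = M"
      using tangent_ex1[of L ?r ?q] KL LM q assms proj_in by (metis inf_commute)
    thus False using False by simp
  qed
  moreover have "proj K p = proj M p" if "p \<in> P" "par p l" for p
    using that assms touch_proj proj_cong by metis
  ultimately show ?thesis unfolding touch_def by blast
qed

lemma touch_ex:
  assumes "K \<in> C" "l \<in> P" "q \<in> P" "\<not> par q l"
  obtains L where "L \<in> C" "touch l K L" "q \<in> L"
proof (cases "q \<in> K")
  case True thus ?thesis using that assms touch_refl by blast
next
  case False
  have "\<not> par (proj K l) q"
    using assms by (meson par_sym par_trans proj_P proj_par)
  then obtain L where "L \<in> C" "q \<in> L" "K \<inter> L = {proj K l}"
    using tangent_ex1[of K "proj K l" q] assms False proj_in by blast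
  thus ?thesis using that assms touch_iff_Int by blast
qed

lemma touch_two:
  assumes "touch g K L" "touch h K L" "g \<in> P" "h \<in> P" "\<not> par g h"
  shows "K = L"
  using assms touch_def par_refl by meson

lemma third_generator:
  assumes "p \<in> P" "q \<in> P"
  obtains r where "r \<in> P" "\<not> par r p" "\<not> par r q"
proof -
  obtain K a b c where K: "K \<in> C" "a \<in> K" "b \<in> K" "c \<in> K" "a \<noteq> b" "a \<noteq> c" "b \<noteq> c"
    using nontrivial_circle by blast
  obtain r where r: "r \<in> K" "r \<noteq> proj K p" "r \<noteq> proj K q" using K by metis
  show ?thesis using that[of r] r K assms circle_sub proj_eqI by blast
qed

text \<open>Some point \<open>q\<close> is missed by a circle \<open>K\<close>. If \<open>q\<close>
  is not parallel to \<open>p\<close>, a circle through \<open>q\<close> that touches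
  \<open>K\<close> on a third generator crosses the generator of \<open>p\<close> elsewhere than
  \<open>K\<close> does.\<close>

lemma generator_nontrivial:
  assumes "p \<in> P"
  obtains q where "q \<in> P" "par q p" "q \<noteq> p"
proof -
  obtain K where K: "K \<in> C" "K \<noteq> P"
    using nontrivial_circle by blast
  obtain q where q: "q \<in> P" "q \<notin> K" using K circle_sub by blast
  show ?thesis
  proof (cases "par q p")
    case True
    have "q \<noteq> proj K p" using q K assms proj_in by metis
    thus ?thesis
      by (cases "q = p") (use K True q assms proj_P proj_par that in metis)+
  next
    case False
    obtain r where r: "r \<in> P" "\<not> par r p" "\<not> par r q" using third_generator assms q by blast
    obtain L where L: "L \<in> C" "touch r K L" "q \<in> L"
      using touch_ex[of K r q] K q r par_sym by blast
    have "K \<noteq> L" using q L by blast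
    hence "proj K p \<noteq> proj L p" using touch_eqI L r assms par_sym by blast
    thus ?thesis using K L assms that proj_P proj_par by metis
  qed
qed

end

section \<open>Contact configurations under (C) and (S)\<close>

locale laguerre_CS = laguerre P C par
  for P :: "'p set" and C :: "'p set set" and par :: "'p \<Rightarrow> 'p \<Rightarrow> bool" +
  assumes C: "axiom_C P C par" and S: "axiom_S P C par"
begin

lemma C_ex1:
  assumes "K \<in> C" "L \<in> C" "l \<in> P" "proj K l \<noteq> proj L l"
  shows "\<exists>!M. M \<in> tangent_pencil C (proj K l) K \<and> (\<exists>x. M \<inter> L = {x})"
proof -
  have p: "proj K l \<in> K - L" using assms proj_in proj_id proj_proj by (metis DiffI)
  show ?thesis by (rule C[unfolded axiom_C_def, rule_format]) (rule assms p)+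
qed

text \<open>The contact with \<open>L\<close> is off the generator \<open>l\<close>, because
  \<open>M\<close> shares its point there with \<open>K\<close>, and that point is not on
  \<open>L\<close>.\<close>

lemma C_ex:
  assumes "K \<in> C" "L \<in> C" "l \<in> P" "proj K l \<noteq> proj L l"
  obtains M m where "M \<in> C" "touch l K M" "m \<in> P" "touch m M L" "M \<noteq> L" "\<not> par m l"
proof -
  obtain M x where M: "M \<in> C" "tangent_at K M (proj K l)" "M \<inter> L = {x}"
    using C_ex1[OF assms] unfolding tangent_pencil_def by blast
  have t: "touch l K M" using M assms touch_iff_Int unfolding tangent_at_def by blast
  have pr: "proj M l \<noteq> proj L l" using t assms touch_proj by metis
  have x: "x \<in> P" "x \<in> M" "x \<in> L" using M circle_sub by blast+
  have "touch x M L" using touch_iff_Int[of M L x] M x assms proj_id by simp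
  moreover have "\<not> par x l" using pr x M assms proj_eqI by metis
  ultimately show ?thesis using that t M x pr by metis
qed

text \<open>That \<open>K\<close> and \<open>L\<close> differ on \<open>l\<close> keeps
  \<open>L\<close> itself out of the pencil, so the contacts with \<open>L\<close> are proper
  although \<open>touch\<close> also allows equality.\<close>

lemma C_uniq:
  assumes "K \<in> C" "L \<in> C" "M \<in> C" "N \<in> C" "l \<in> P" "m \<in> P" "n \<in> P" "proj K l \<noteq> proj L l"
    "touch l K M" "touch l K N" "touch m M L" "touch n N L"
  shows "M = N"
proof -
  note ex1 = C_ex1[OF assms(1,2,5,8)]
  have "M \<in> tangent_pencil C (proj K l) K" "N \<in> tangent_pencil C (proj K l) K"
    using assms touch_iff_Int proj_in unfolding tangent_pencil_def tangent_at_def by auto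
  moreover have "M \<noteq> L" "N \<noteq> L" using assms touch_proj by metis+
  hence "\<exists>x. M \<inter> L = {x}" "\<exists>x. N \<inter> L = {x}" using assms touch_iff_Int by metis+
  ultimately show ?thesis using ex1 by blast
qed

text \<open>\<open>L\<close> and \<open>M\<close> both lie in the pencil of \<open>L\<close> on
  \<open>h\<close> and both touch \<open>K\<close>, so uniqueness in (C) identifies them; then
  \<open>K\<close> and \<open>L\<close> touch on two generators.\<close>

lemma no_triangle:
  assumes "K \<in> C" "L \<in> C" "M \<in> C" "g \<in> P" "h \<in> P" "k \<in> P"
    "\<not> par g h" "\<not> par h k" "\<not> par g k"
    "touch g K L" "touch h L M" "touch k M K"
  shows "K = L" "L = M"
proof -
  have "K = L"
  proof (rule ccontr)
    assume n: "K \<noteq> L"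
    have "proj L h \<noteq> proj K h"
      using n touch_eqI[of g K L h] assms par_sym by metis
    hence "L = M"
      using C_uniq[of L K L M h g k] assms touch_sym touch_refl by blast
    hence "K = L" using touch_two[of g K L k] assms touch_sym by blast
    thus False using n by simp
  qed
  thus "K = L" "L = M" using touch_two[of h L M k] assms touch_sym by blast+
qed

text \<open>If there were only three generators, uniqueness in (C) would fail: for touching \<open>K\<close> and \<open>L\<close>, both
  \<open>K\<close> and the circle \<open>M\<close> below would touch \<open>L\<close>.\<close>

lemma fourth_generator:
  assumes "p \<in> P" "q \<in> P" "r \<in> P"
  obtains s where "s \<in> P" "\<not> par s p" "\<not> par s q" "\<not> par s r"
proof -
  have main: "\<exists>s\<in>P. \<not> par s p \<and> \<not> par s q \<and> \<not> par s r"
    if *: "\<not> par p q" "\<not> par q r" "\<not> par p r"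
  proof (rule ccontr)
    assume "\<not> ?thesis"
    hence all: "par s p \<or> par s q \<or> par s r" if "s \<in> P" for s using that by blast
    obtain K where K: "K \<in> C" using nontrivial_circle by blast
    obtain y where y: "y \<in> P" "par y (proj K q)" "y \<noteq> proj K q"
      using generator_nontrivial proj_P K assms by metis
    have yq: "par y q" using y K assms par_trans proj_P proj_par by blast
    hence "\<not> par y p" using * y assms par_sym par_trans by blast
    then obtain L where L: "L \<in> C" "touch p K L" "y \<in> L"
      using touch_ex K assms y by blast
    have KLq: "proj K q \<noteq> proj L q" using proj_eqI L y yq assms by metis
    hence KL: "K \<noteq> L" by blast
    have KLr: "proj K r \<noteq> proj L r" using touch_eqI[of p K L r] KL L * assms par_sym by blast
    have "\<not> par (proj L r) q"
      using * L(1) assms proj_P proj_par par_sym par_trans by meson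
    then obtain M where M: "M \<in> C" "touch q K M" "proj L r \<in> M"
      using touch_ex K assms proj_P L(1) by metis
    have Mr: "proj M r = proj L r"
      using M L(1) assms proj_par proj_eqI by blast
    have MK: "M \<noteq> K" using Mr KLr by metis
    have Mq: "proj M q \<noteq> proj L q" using M KLq touch_proj assms by metis
    have Mp: "proj M p \<noteq> proj L p"
    proof
      assume "proj M p = proj L p"
      hence "proj K p = proj M p" using touch_proj L assms by metis
      thus False using touch_eqI[of q K M p] M MK * assms by blast
    qed
    \<comment> \<open>If there are only three generators, circles that agree on \<open>r\<close> and
      differ on \<open>p\<close> and \<open>q\<close> already touch.\<close>
    have "proj M s = proj L s \<longleftrightarrow> par s r" if s: "s \<in> P" for s
    proof
      assume eq: "proj M s = proj L s"
      have "\<not> par s p" using eq Mp proj_cong M(1) L(1) s assms by metis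
      moreover have "\<not> par s q" using eq Mq proj_cong M(1) L(1) s assms by metis
      ultimately show "par s r" using all s by blast
    next
      assume "par s r"
      thus "proj M s = proj L s" using Mr proj_cong M(1) L(1) s assms by metis
    qed
    hence "touch r M L" unfolding touch_def by blast
    thus False
      using C_uniq[of K L K M q p r] K L(1,2) M(1,2) assms KLq touch_refl MK by blast
  qed
  show ?thesis
  proof (cases "par p q \<or> par q r \<or> par p r")
    case True
    then consider "par p q" | "par q r" | "par p r" by blast
    thus ?thesis
    proof cases
      case 1
      obtain s where "s \<in> P" "\<not> par s p" "\<not> par s r" using third_generator assms by metis
      thus ?thesis using that[of s] 1 assms par_sym par_trans by blast
    next
      case 2
      obtain s where "s \<in> P" "\<not> par s p" "\<not> par s r" using third_generator assms by metis
      thus ?thesis using that[of s] 2 assms par_sym par_trans by blast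
    next
      case 3
      obtain s where "s \<in> P" "\<not> par s p" "\<not> par s q" using third_generator assms by metis
      thus ?thesis using that[of s] 3 assms par_sym par_trans by blast
    qed
  next
    case False
    thus ?thesis using main that by blast
  qed
qed

text \<open>The generators \<open>h\<close> and \<open>j\<close> may coincide;
  \<open>parallelogram\<close> uses exactly this case.\<close>

lemma S_touch:
  assumes "K \<in> C" "L \<in> C" "M \<in> C" "N \<in> C" "g \<in> P" "h \<in> P" "k \<in> P" "j \<in> P"
    "touch g K L" "touch h L M" "touch k M N" "touch j N K"
    "K \<noteq> L" "L \<noteq> M" "M \<noteq> N" "N \<noteq> K" "\<not> par g k"
  obtains Z where "Z \<in> C" "proj Z g = proj K g" "proj Z h = proj L h"
    "proj Z k = proj M k" "proj Z j = proj N j"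
proof -
  let ?a = "proj K g" and ?b = "proj L h" and ?c = "proj M k" and ?d = "proj N j"
  have i: "K \<inter> L = {?a}" "L \<inter> M = {?b}" "M \<inter> N = {?c}" "N \<inter> K = {?d}"
    using touch_iff_Int assms by metis+
  have p: "?a \<in> P" "?b \<in> P" "?c \<in> P" "?d \<in> P" using proj_P assms by metis+
  have n: "\<not> par ?a ?c"
    using assms(1,3,5,7,17) p proj_par par_sym par_trans by meson
  have "\<exists>Z\<in>C. ?a \<in> Z \<and> ?b \<in> Z \<and> ?c \<in> Z \<and> ?d \<in> Z"
    by (rule S[unfolded axiom_S_def, rule_format, of K L M N])
      (rule assms(1-4) i p n)+
  then obtain Z where "Z \<in> C" "?a \<in> Z" "?b \<in> Z" "?c \<in> Z" "?d \<in> Z" by blast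
  thus ?thesis using that[of Z] assms(1-8) proj_par proj_eqI by simp
qed

text \<open>If the circle \<open>N\<close> supplied by (C) touched \<open>M\<close> off the generator \<open>g\<close>, then (S) would put the two
  contact points on \<open>h\<close> on a common circle.\<close>

lemma parallelogram:
  assumes "K \<in> C" "L \<in> C" "M \<in> C" "g \<in> P" "h \<in> P" "\<not> par g h" "touch g K L" "touch h L M"
  obtains N where "N \<in> C" "touch h K N" "touch g N M"
proof (cases "K = L \<or> L = M")
  case True thus ?thesis using that assms touch_refl by metis
next
  case False
  have hg: "\<not> par h g" using assms par_sym by blast
  have Kh: "proj K h \<noteq> proj M h"
    using touch_eqI[of g K L h] touch_proj[of h L M] assms False hg by metis
  then obtain N k where N: "N \<in> C" "touch h K N" "k \<in> P" "touch k N M" "N \<noteq> M" "\<not> par k h"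
    using C_ex assms by metis
  have gk: "par g k"
  proof (rule ccontr)
    assume gk: "\<not> par g k"
    have NK: "N \<noteq> K"
    proof
      assume "N = K"
      thus False using no_triangle[of K L M g h k] assms N touch_sym gk par_sym False by metis
    qed
    obtain Z where Z: "Z \<in> C" "proj Z g = proj K g" "proj Z h = proj L h"
      "proj Z k = proj M k" "proj Z h = proj N h"
      using S_touch[of K L M N g h k h] assms N NK False touch_sym gk by metis
    have "proj K h = proj M h" using Z N(2) assms(8) touch_proj assms(5) by metis
    thus False using Kh by simp
  qed
  hence "touch g N M" using touch_cong N assms par_sym by blast
  thus ?thesis using that N by blast
qed


text \<open>(C) supplies a contact on a generator that is not under control, hence this version of
  \<open>no_triangle\<close>. If \<open>k\<close> is parallel to \<open>g\<close> or
  \<open>h\<close>, transitivity yields a second contact between two of the circles.\<close>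

lemma triangle_degenerate:
  assumes "K \<in> C" "L \<in> C" "M \<in> C" "g \<in> P" "h \<in> P" "k \<in> P" "\<not> par g h"
    "touch g K L" "touch h L M" "touch k M K"
  shows "K = L \<or> L = M"
proof -
  consider "par k g" | "par k h" | "\<not> par g k" "\<not> par h k" using assms par_sym by blast
  thus ?thesis
  proof cases
    case 1
    hence "touch g M L" using assms touch_cong touch_trans by metis
    thus ?thesis using touch_two[of g L M h] assms touch_sym by blast
  next
    case 2
    hence "touch h L K" using assms touch_cong touch_trans by metis
    thus ?thesis using touch_two[of g K L h] assms touch_sym by blast
  next
    case 3
    thus ?thesis using no_triangle[of K L M g h k] assms by blast
  qed
qed

text \<open>By (C) some \<open>Q\<close> touches \<open>V\<close> on \<open>e\<close> and \<open>N\<close> somewhere; by (S) that contact point is on \<open>Z\<close>, so \<open>Q = R\<close>.\<close>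

lemma S_closing:
  assumes "Z \<in> C" "V \<in> C" "X \<in> C" "N \<in> C" "R \<in> C"
    and P: "d \<in> P" "b \<in> P" "c \<in> P" "e \<in> P"
    and np: "\<not> par d b" "\<not> par d c" "\<not> par d e" "\<not> par b c" "\<not> par b e" "\<not> par c e"
    and V: "proj V d = proj Z d" "proj V e = proj Z e"
    and X: "proj X d = proj Z d" "proj X b = proj Z b"
    and N: "proj N b = proj Z b" "proj N c = proj Z c"
    and R: "proj R c = proj Z c" "proj R e = proj Z e"
    and t: "touch d V X" "touch b X N" "touch c N R"
    and NZ: "N \<noteq> Z"
  shows "touch e R V"
proof -
  have np': "\<not> par b d" "\<not> par c d" "\<not> par e d" "\<not> par c b" "\<not> par e b" "\<not> par e c"
    using np P par_sym by blast+
  have XZ: "X \<noteq> Z" using touch_eqI[of b X N c] t P np' N NZ by metis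
  have VZ: "V \<noteq> Z" using touch_eqI[of d V X b] t P np' X XZ by metis
  have RZ: "R \<noteq> Z" using touch_eqI[of c N R b] t P np N NZ by metis
  have VX: "V \<noteq> X"
    using circle_eqI3[of X Z d b e] assms(1,3) P np X V XZ by metis
  have XN: "X \<noteq> N"
    using circle_eqI3[of X Z d b c] assms(1,3) P np X N XZ by metis
  have Ne: "proj V e \<noteq> proj N e"
    using circle_eqI3[of N Z b c e] assms(1,4) P np V N NZ by metis
  obtain Q y where Q: "Q \<in> C" "touch e V Q" "y \<in> P" "touch y Q N" "Q \<noteq> N" "\<not> par y e"
    using C_ex[of V N e] assms(2,4) P Ne by metis
  have QV: "Q \<noteq> V"
  proof
    assume "Q = V"
    hence "touch y N V" using Q touch_sym by blast
    thus False using triangle_degenerate[of V X N d b y] Q assms(2-4) P np t VX XN by blast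
  qed
  obtain W where W: "W \<in> C" "proj W b = proj X b" "proj W y = proj N y"
    "proj W e = proj Q e" "proj W d = proj V d"
    using S_touch[of X N Q V b y e d] assms(2-4) P np t Q QV VX XN touch_sym by metis
  have Qe: "proj Q e = proj Z e" using Q P V touch_proj by metis
  have "W = Z"
    using circle_eqI3[of W Z b d e] W assms(1) P np np' X V Qe by metis
  hence "proj N y = proj Z y" using W by simp
  \<comment> \<open>\<open>N\<close> and \<open>Z\<close> agree on \<open>b\<close>,
    \<open>c\<close> and \<open>y\<close> but differ, so these are not three different
    generators.\<close>
  hence "par y b \<or> par y c"
    using circle_eqI3[of N Z b c y] assms(1,4) Q P np N NZ par_sym by metis
  thus ?thesis
  proof
    assume "par y c"
    hence "touch c Q N" using Q P touch_cong by blast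
    hence "touch c Q R" using Q assms(4,5) P t touch_trans by blast
    hence "Q = R" using touch_eqI[of c Q R e] P np' Qe R by metis
    thus ?thesis using Q touch_sym by blast
  next
    assume "par y b"
    hence "touch b Q N" using Q P touch_cong by blast
    hence "touch b X Q" using Q assms(3,4) P t touch_trans touch_sym by metis
    hence "V = X \<or> X = Q"
      using triangle_degenerate[of V X Q d b e] Q assms(2,3) P np t touch_sym by blast
    hence "proj X e = proj Z e" using VX Qe by blast
    hence "X = Z" using circle_eqI3[of X Z d b e] assms(1,3) P np X by metis
    thus ?thesis using XZ by blast
  qed
qed

text \<open>In the affine plane at the point of \<open>K\<close> on \<open>l\<close>, the chords \<open>K\<close> of \<open>N\<close> and \<open>Z\<close> of \<open>N'\<close> are parallel:
  otherwise \<open>S_closing\<close> gives through their common point on \<open>e\<close> two circles \<open>R\<close> and \<open>R'\<close> with the same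
  tangent there and the same slope on \<open>c\<close>. They would be equal, but meet \<open>c\<close> in different points.\<close>

lemma touch_shift:
  assumes cir: "K \<in> C" "K' \<in> C" "N \<in> C" "N' \<in> C"
    and P: "l \<in> P" "b \<in> P" "c \<in> P"
    and np: "\<not> par l b" "\<not> par l c" "\<not> par b c"
    and t: "touch l K K'" "touch l N N'"
    and eq: "proj K b = proj N b" "proj K c = proj N c" "proj K' b = proj N' b"
  shows "proj K' c = proj N' c"
proof -
  have np': "\<not> par b l" "\<not> par c l" "\<not> par c b" using np P par_sym by blast+
  consider "K = N" | "K = K'" | "N = N'" | "K \<noteq> N" "K \<noteq> K'" "N \<noteq> N'" by blast
  thus ?thesis
  proof cases
    case 1
    hence "touch l K' N'" using t cir P touch_sym touch_trans by metis
    thus ?thesis using touch_eqI eq np' P by metis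
  next
    case 2 thus ?thesis using touch_eqI[of l N N' b] eq np' P t by metis
  next
    case 3 thus ?thesis using touch_eqI[of l K K' b] eq np' P t by metis
  next
    case 4
    let ?d = "proj K l"
    have dP: "?d \<in> P" "par ?d l" using cir P proj_P proj_par by blast+
    have npd: "\<not> par ?d b" "\<not> par ?d c"
      using dP P np par_sym par_trans by meson+
    have Nl: "proj K l \<noteq> proj N l"
      using circle_eqI3[of K N l b c] cir P np eq 4 by metis
    obtain X where X: "X \<in> C" "touch b N X" "?d \<in> X"
      using touch_ex[of N b ?d] cir P dP npd by metis
    obtain Y where Y: "Y \<in> C" "touch c N Y" "?d \<in> Y"
      using touch_ex[of N c ?d] cir P dP npd by metis
    have Xl: "proj X l = ?d" using X dP P proj_eqI by metis
    \<comment> \<open>\<open>X'\<close> and \<open>Y'\<close> play for \<open>N'\<close> the role of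
      \<open>X\<close> and \<open>Y\<close> for \<open>N\<close>. Touching \<open>X\<close> and
      \<open>Y\<close> on \<open>l\<close>, they still pass through \<open>?d\<close>.\<close>
    obtain X' where X': "X' \<in> C" "touch l X X'" "touch b X' N'"
      using parallelogram[of X N N' b l] X cir P np' t touch_sym by metis
    obtain Y' where Y': "Y' \<in> C" "touch l Y Y'" "touch c Y' N'"
      using parallelogram[of Y N N' c l] Y cir P np' t touch_sym by metis
    have q: "proj N' b \<in> P" "par (proj N' b) b" "proj N' c \<in> P" "par (proj N' c) c"
      using cir P proj_P proj_par by blast+
    \<comment> \<open>It suffices that \<open>Z\<close> touches \<open>K\<close> on
      \<open>l\<close>: then \<open>K'\<close> and \<open>Z\<close> lie in one pencil on
      \<open>l\<close> and have the same point on \<open>b\<close>, so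
      \<open>K' = Z\<close>.\<close>
    obtain Z where Z: "Z \<in> C" "?d \<in> Z" "proj N' b \<in> Z" "proj N' c \<in> Z"
      using circle_ex[of ?d "proj N' b" "proj N' c"] dP q npd np P par_sym par_trans by metis
    have Zp: "proj Z l = ?d" "proj Z b = proj N' b" "proj Z c = proj N' c"
      using Z dP q P proj_eqI by metis+
    have NN: "proj N b \<noteq> proj N' b" "proj N c \<noteq> proj N' c"
      using touch_eqI[of l N N'] t P np' 4 by metis+
    have "touch l K Z"
    proof (rule ccontr)
      assume nt: "\<not> touch l K Z"
      then obtain e where e: "e \<in> P" "proj K e = proj Z e" "\<not> par e l"
        unfolding touch_def using Zp proj_cong[of _ _ l] cir Z P by metis
      have eb: "\<not> par e b" using NN e Zp eq cir Z P proj_cong by metis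
      have ec: "\<not> par e c" using NN e Zp eq cir Z P proj_cong by metis
      have npe: "\<not> par l e" "\<not> par b e" "\<not> par c e" using e eb ec P par_sym by blast+
      let ?e = "proj K e"
      have eP: "?e \<in> P" "par ?e e" using cir e proj_P proj_par by blast+
      have npe': "\<not> par ?e l" "\<not> par ?e c"
        using eP e ec P par_sym par_trans by meson+
      \<comment> \<open>\<open>X1\<close> is common to two contact chains:
        \<open>X1, X, N, R\<close> with contact points on \<open>K\<close>, and
        \<open>X1, X', N', R'\<close> with contact points on \<open>Z\<close>.\<close>
      obtain X1 where X1: "X1 \<in> C" "touch l X X1" "?e \<in> X1"
        using touch_ex[of X l ?e] X P eP npe' by metis
      obtain R where R: "R \<in> C" "touch c N R" "?e \<in> R"
        using touch_ex[of N c ?e] cir P eP npe' by metis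
      obtain R' where R': "R' \<in> C" "touch c N' R'" "?e \<in> R'"
        using touch_ex[of N' c ?e] cir P eP npe' by metis
      have pe: "proj X1 e = ?e" "proj R e = ?e" "proj R' e = ?e"
        using X1 R R' eP e proj_eqI by metis+
      have "touch e R X1"
      proof (rule S_closing[of K X1 X N R l b c e])
        show "proj X1 l = proj K l" using touch_proj[OF X1(2) P(1)] Xl by simp
        show "proj X b = proj K b" using touch_proj[OF X(2) P(2)] eq by simp
        show "proj R c = proj K c" using touch_proj[OF R(2) P(3)] eq by simp
        show "touch l X1 X" "touch b X N" using X1 X touch_sym by blast+
      qed (use cir X X1 R P e np npe pe Xl eq 4 in auto)
      moreover have "touch e R' X1"
      proof (rule S_closing[of Z X1 X' N' R' l b c e])
        show "proj X1 l = proj Z l" using touch_proj[OF X1(2) P(1)] Xl Zp by simp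
        show "proj X' l = proj Z l" using touch_proj[OF X'(2) P(1)] Xl Zp by simp
        show "proj X' b = proj Z b" using touch_proj[OF X'(3) P(2)] Zp by simp
        show "proj R' c = proj Z c" using touch_proj[OF R'(2) P(3)] Zp by simp
        show "touch l X1 X'" using X1 X' X P touch_sym touch_trans by metis
        show "N' \<noteq> Z" using Nl Zp touch_proj[OF t(2) P(1)] by metis
      qed (use cir X' X1 R' Z P e np npe pe Zp in auto)
      ultimately have RR: "touch e R' R" using touch_trans touch_sym R R' X1 e by metis
      \<comment> \<open>\<open>Y\<close> and \<open>Y'\<close> carry the pencil of \<open>N\<close>
        on \<open>c\<close> to that of \<open>N'\<close>: some \<open>R2\<close> touches
        \<open>R\<close> on \<open>l\<close> and \<open>R'\<close> on \<open>c\<close>. With the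
        contact of \<open>R\<close> and \<open>R'\<close> on \<open>e\<close> this is a
        triangle.\<close>
      have "touch c R Y" using R Y cir P touch_sym touch_trans by metis
      then obtain R2 where R2: "R2 \<in> C" "touch l R R2" "touch c R2 Y'"
        using parallelogram[of R Y Y' c l] R Y Y' P np' by metis
      have "touch c R2 R'" using R2 Y' R' cir P touch_trans by metis
      hence "R = R2" "R2 = R'"
        using no_triangle[of R R2 R' l c e] R R' R2 P e np npe RR by blast+
      hence "proj N c = proj N' c" using touch_proj R R' P by metis
      thus False using NN by simp
    qed
    hence "touch l K' Z" using t touch_sym touch_trans cir Z P by metis
    hence "K' = Z" using touch_eqI[of l K' Z b] P np' Zp eq by metis
    thus ?thesis using Zp by simp
  qed
qed

text \<open>Generator-preserving automorphisms moving every circle along its tangent pencil on the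
  generator of \<open>l\<close>; in the classical model, adding \<open>t (x - l)\<^sup>2\<close>.\<close>

definition elations :: "'p \<Rightarrow> ('p \<Rightarrow> 'p) set" where
  "elations l = {f. (\<forall>p. p \<notin> P \<longrightarrow> f p = p) \<and> (\<forall>p\<in>P. f p \<in> P \<and> par (f p) p) \<and>
     (\<forall>K\<in>C. f ` K \<in> C \<and> touch l K (f ` K))}"

lemma elationD:
  assumes "f \<in> elations l"
  shows "p \<notin> P \<Longrightarrow> f p = p" "p \<in> P \<Longrightarrow> f p \<in> P" "p \<in> P \<Longrightarrow> par (f p) p"
    "K \<in> C \<Longrightarrow> f ` K \<in> C" "K \<in> C \<Longrightarrow> touch l K (f ` K)"
  using assms unfolding elations_def by blast+

lemma elation_cong: "l \<in> P \<Longrightarrow> m \<in> P \<Longrightarrow> par l m \<Longrightarrow> elations l = elations m"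
  unfolding elations_def using touch_cong par_sym by blast

text \<open>Transport of a step on the generator of \<open>p\<close> to the generator of \<open>q\<close>.\<close>

definition moves :: "'p \<Rightarrow> 'p \<Rightarrow> 'p \<Rightarrow> 'p \<Rightarrow> 'p \<Rightarrow> bool" where
  "moves l p p' q q' \<longleftrightarrow> (\<exists>K\<in>C. \<exists>K'\<in>C. touch l K K' \<and> p \<in> K \<and> q \<in> K \<and> p' \<in> K' \<and> q' \<in> K'
      \<and> par p' p \<and> par q' q)"

lemma moves_sym: "moves l p p' q q' \<Longrightarrow> moves l q q' p p'"
  unfolding moves_def by blast

lemma moves_ex:
  assumes "p \<in> P" "q \<in> P" "p' \<in> P" "l \<in> P" "par p' p" "\<not> par l p" "\<not> par l q" "\<not> par p q"
  obtains q' where "q' \<in> P" "par q' q" "moves l p p' q q'"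
proof -
  obtain K where K: "K \<in> C" "l \<in> K" "p \<in> K" "q \<in> K" using circle_ex assms by metis
  have "\<not> par p' l" using assms par_sym par_trans by meson
  then obtain K' where K': "K' \<in> C" "touch l K K'" "p' \<in> K'"
    using touch_ex K assms by metis
  have q': "proj K' q \<in> P" "par (proj K' q) q" "proj K' q \<in> K'"
    using K' assms proj_P proj_par proj_in by blast+
  hence "moves l p p' q (proj K' q)" unfolding moves_def using K K' assms by blast
  thus ?thesis using that q' by blast
qed

text \<open>This is \<open>touch_shift\<close> read as independence of the transport from the circle
  chosen through \<open>p\<close> and \<open>q\<close>.\<close>

lemma moves_on:
  assumes m: "moves l p p' q q'" and P: "p \<in> P" "q \<in> P" "l \<in> P"
    and np: "\<not> par l p" "\<not> par l q" "\<not> par p q"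
    and K: "K \<in> C" "p \<in> K" "q \<in> K" "K' \<in> C" "touch l K K'" "p' \<in> K'"
  shows "q' \<in> K'"
proof -
  obtain N N' where N: "N \<in> C" "N' \<in> C" "touch l N N'" "p \<in> N" "q \<in> N" "p' \<in> N'" "q' \<in> N'"
      "par p' p" "par q' q"
    using m unfolding moves_def by blast
  have "proj N' q = proj K' q"
  proof (rule touch_shift[of N N' K K' l p q])
    show "proj N p = proj K p" "proj N q = proj K q" using N K proj_id by metis+
    show "proj N' p = proj K' p" using N K P proj_eqI by metis
  qed (use N K P np in auto)
  moreover have "proj N' q = q'" using N P proj_eqI by metis
  ultimately show ?thesis using K P proj_in by metis
qed

text \<open>One circle through \<open>p\<close>, \<open>q\<close>, \<open>r\<close> and one circle
  of its pencil on \<open>l\<close> realise all the steps simultaneously.\<close>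

lemma moves_trans:
  assumes m: "moves l p p' q q'" "moves l p p' r r'" and P: "p \<in> P" "q \<in> P" "r \<in> P" "l \<in> P"
    and np: "\<not> par l p" "\<not> par l q" "\<not> par l r" "\<not> par p q" "\<not> par p r" "\<not> par q r"
  shows "moves l q q' r r'"
proof -
  obtain K where K: "K \<in> C" "p \<in> K" "q \<in> K" "r \<in> K" using circle_ex P np by metis
  obtain N N' where N: "N \<in> C" "N' \<in> C" "p' \<in> N'" "par p' p" "par q' q"
    using m unfolding moves_def by blast
  have "par r' r" using m unfolding moves_def by blast
  have "p' \<in> P" using N circle_sub by blast
  have "\<not> par p' l" using N P \<open>p' \<in> P\<close> np par_sym par_trans by meson
  then obtain K' where K': "K' \<in> C" "touch l K K'" "p' \<in> K'"
    using touch_ex K P \<open>p' \<in> P\<close> by metis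
  have "q' \<in> K'" "r' \<in> K'" using moves_on m K K' P np by metis+
  thus ?thesis unfolding moves_def using K K' N \<open>par r' r\<close> by blast
qed

subsection \<open>Elations and the shift group\<close>


lemma moves_unique:
  assumes m: "moves l p p' q q'" "moves l p p' q q''" and P: "p \<in> P" "q \<in> P" "l \<in> P"
    and np: "\<not> par l p" "\<not> par l q" "\<not> par p q"
  shows "q' = q''"
proof -
  obtain N N' where N: "N \<in> C" "N' \<in> C" "touch l N N'" "p \<in> N" "q \<in> N" "p' \<in> N'" "q' \<in> N'"
      "par q' q"
    using m(1) unfolding moves_def by blast
  have "q'' \<in> N'" using moves_on[OF m(2)] N P np by blast
  moreover have "par q'' q" using m(2) unfolding moves_def by blast
  ultimately show ?thesis using N P proj_eqI by metis
qed

text \<open>The image of \<open>K\<close> can only be the circle of its pencil through the image of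
  one chosen point; \<open>moves_on\<close> puts the other images on it, and since it meets each
  generator once, nothing is left over.\<close>

lemma elationI:
  assumes l: "l \<in> P"
    and out: "\<And>p. p \<notin> P \<Longrightarrow> f p = p"
    and gen: "\<And>p. p \<in> P \<Longrightarrow> f p \<in> P" "\<And>p. p \<in> P \<Longrightarrow> par (f p) p"
    and fixl: "\<And>p. p \<in> P \<Longrightarrow> par p l \<Longrightarrow> f p = p"
    and mv: "\<And>p q. p \<in> P \<Longrightarrow> q \<in> P \<Longrightarrow> \<not> par p l \<Longrightarrow> \<not> par q l \<Longrightarrow> \<not> par p q \<Longrightarrow>
      moves l p (f p) q (f q)"
  shows "f \<in> elations l"
proof -
  have "f ` K \<in> C \<and> touch l K (f ` K)" if K: "K \<in> C" for K
  proof -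
    obtain x where x: "x \<in> P" "\<not> par x l" using third_generator l by metis
    let ?p = "proj K x"
    have p: "?p \<in> P" "?p \<in> K" using K x proj_P proj_in by blast+
    have pl: "\<not> par ?p l" using p x K l proj_par par_sym par_trans by meson
    have "\<not> par (f ?p) l" using p pl gen l par_sym par_trans by meson
    then obtain K' where K': "K' \<in> C" "touch l K K'" "f ?p \<in> K'"
      using touch_ex[of K l "f ?p"] K l gen p by metis
    have in': "f q \<in> K'" if q: "q \<in> K" for q
    proof -
      have qP: "q \<in> P" using K q circle_sub by blast
      consider "par q l" | "q = ?p" | "\<not> par q l" "q \<noteq> ?p" by blast
      thus ?thesis
      proof cases
        case 1
        have "proj K l = q" using K q 1 l proj_eqI by blast
        thus ?thesis using 1 fixl qP K' l touch_proj proj_in by metis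
      next
        case 2 thus ?thesis using K' by simp
      next
        case 3
        have npq: "\<not> par ?p q" using 3 K p q circle_par_eq by metis
        show ?thesis
          using moves_on[OF mv[OF p(1) qP pl 3(1) npq] p(1) qP l _ _ npq K p(2) q K']
            3 pl l p qP par_sym by blast
      qed
    qed
    have "K' \<subseteq> f ` K"
    proof
      fix y assume y: "y \<in> K'"
      hence yP: "y \<in> P" using K' circle_sub by blast
      let ?q = "proj K y"
      have q: "?q \<in> K" "?q \<in> P" "par ?q y" using K yP proj_in proj_P proj_par by blast+
      have "par (f ?q) y" using q gen yP par_trans by meson
      hence "y = f ?q" using K' y in' q circle_par_eq by metis
      thus "y \<in> f ` K" using q by blast
    qed
    hence "f ` K = K'" using in' by blast
    thus ?thesis using K' by simp
  qed
  thus ?thesis unfolding elations_def using out gen by blast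
qed

lemma elation_ex:
  assumes P: "l \<in> P" "b \<in> P" "b' \<in> P" and bl: "\<not> par b l" and bb: "par b' b"
  obtains f where "f \<in> elations l" "f b = b'"
proof -
  obtain e where e: "e \<in> P" "\<not> par e l" "\<not> par e b" using third_generator P by metis
  have np: "\<not> par l b" "\<not> par l e" "\<not> par b e" using P bl e par_sym by blast+
  obtain e' where e': "e' \<in> P" "par e' e" "moves l b b' e e'"
    using moves_ex[of b e b' l] P e np bb by metis
  \<comment> \<open>\<open>moves\<close> relates different generators only. Points on the generator
    of \<open>b\<close> itself are therefore moved with the step from \<open>e\<close> to
    \<open>e'\<close>, the copy of the given step on an auxiliary generator.\<close>
  define f where "f c = (if c \<notin> P \<or> par c l then c
    else if par c b then (SOME c'. c' \<in> P \<and> par c' c \<and> moves l e e' c c')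
    else (SOME c'. c' \<in> P \<and> par c' c \<and> moves l b b' c c'))" for c
  have fe: "f c \<in> P \<and> par (f c) c \<and> moves l e e' c (f c)"
    if "c \<in> P" "\<not> par c l" "par c b" for c
  proof -
    have "\<not> par e c" using that e P par_trans by meson
    hence "\<exists>c'. c' \<in> P \<and> par c' c \<and> moves l e e' c c'"
      using moves_ex[of e c e' l] that e e' P np par_sym by metis
    from someI_ex[OF this] show ?thesis using that unfolding f_def by simp
  qed
  have fb: "f c \<in> P \<and> par (f c) c \<and> moves l b b' c (f c)"
    if "c \<in> P" "\<not> par c l" "\<not> par c b" for c
  proof -
    have "\<exists>c'. c' \<in> P \<and> par c' c \<and> moves l b b' c c'"
      using moves_ex[of b c b' l] that bb P np par_sym by metis
    from someI_ex[OF this] show ?thesis using that unfolding f_def by simp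
  qed
  have fe': "moves l e e' c (f c)" if c: "c \<in> P" "\<not> par c l" "\<not> par c e" for c
  proof (cases "par c b")
    case True thus ?thesis using fe c by blast
  next
    case False
    thus ?thesis
      using moves_trans[of l b b' e e' c "f c"] e' fb c P e np par_sym by blast
  qed
  have asym: "moves l p (f p) q (f q)"
    if p: "p \<in> P" "\<not> par p l" and q: "q \<in> P" "\<not> par q l" and pq: "\<not> par p q" and pb: "par p b"
    for p q
  proof -
    have qb: "\<not> par q b" using p q P pq pb par_sym par_trans by meson
    have pe: "\<not> par p e" using p e P pb par_sym par_trans by meson
    show ?thesis
    proof (cases "par q e")
      case False
      show ?thesis
        by (rule moves_trans[of l e e'])
          (use fe'[of p] fe'[of q] p q pq pe False e P in \<open>auto simp: par_commute\<close>)
    next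
      case True
      \<comment> \<open>Here \<open>p\<close> is on the generator of \<open>b\<close> and
        \<open>q\<close> on that of \<open>e\<close>, so neither reference step reaches both. A
        fourth generator reaches \<open>q\<close> by way of \<open>b\<close> and \<open>p\<close> by
        way of \<open>e\<close>.\<close>
      obtain w where w: "w \<in> P" "\<not> par w l" "\<not> par w b" "\<not> par w e"
        using fourth_generator P e by metis
      have wq: "\<not> par w q" using w q e True par_trans by meson
      have wp: "\<not> par w p" using w p P pb par_trans by meson
      have 1: "moves l w (f w) q (f q)"
        by (rule moves_trans[of l b b'])
          (use fb[of w] fb[of q] w q qb wq P bl in \<open>auto simp: par_commute\<close>)
      have 2: "moves l w (f w) p (f p)"
        by (rule moves_trans[of l e e'])
          (use fe'[of w] fe'[of p] w p pe wp P e in \<open>auto simp: par_commute\<close>)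
      show ?thesis
        by (rule moves_trans[of l w "f w"])
          (use 1 2 w p q pq wp wq P in \<open>auto simp: par_commute\<close>)
    qed
  qed
  have mv: "moves l p (f p) q (f q)"
    if p: "p \<in> P" "\<not> par p l" and q: "q \<in> P" "\<not> par q l" and pq: "\<not> par p q" for p q
  proof -
    consider "par p b" | "par q b" | "\<not> par p b" "\<not> par q b" by blast
    thus ?thesis
    proof cases
      case 1 thus ?thesis using asym p q pq by blast
    next
      case 2 thus ?thesis using asym[of q p] p q pq par_sym moves_sym by blast
    next
      case 3
      show ?thesis
        by (rule moves_trans[of l b b'])
          (use fb[of p] fb[of q] p q pq 3 P bl in \<open>auto simp: par_commute\<close>)
    qed
  qed
  have "f \<in> elations l"
  proof (rule elationI)
    fix p assume p: "p \<in> P"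
    show "f p \<in> P" using fe[of p] fb[of p] p by (cases "par p l") (auto simp: f_def)
    show "par (f p) p" using fe[of p] fb[of p] p par_refl by (cases "par p l") (auto simp: f_def)
    show "par p l \<Longrightarrow> f p = p" by (simp add: f_def)
  qed (use P mv in \<open>auto simp: f_def\<close>)
  moreover have "f b = b'"
    using moves_unique[of l e e' b "f b" b'] fe'[of b] moves_sym[OF e'(3)] P e bl np by blast
  ultimately show ?thesis using that by blast
qed

lemma circle_through:
  assumes "p \<in> P" "q \<in> P" "\<not> par p q"
  obtains K where "K \<in> C" "p \<in> K" "q \<in> K"
  using assms third_generator circle_ex par_sym by metis

lemma generator_map_proj:
  assumes "\<And>p. p \<in> P \<Longrightarrow> par (f p) p" "\<And>p. p \<in> P \<Longrightarrow> f p \<in> P" "f ` K \<in> C" "K \<in> C" "p \<in> P"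
  shows "proj (f ` K) p = f (proj K p)"
proof (rule proj_eqI)
  have q: "proj K p \<in> P" "par (proj K p) p" "proj K p \<in> K"
    using assms proj_P proj_par proj_in by blast+
  show "f (proj K p) \<in> f ` K" using q by blast
  show "par (f (proj K p)) p" using q assms(1,2,5) par_trans by blast
qed (use assms in auto)

lemma elation_proj:
  assumes "f \<in> elations l" "K \<in> C" "p \<in> P"
  shows "proj (f ` K) p = f (proj K p)"
  by (rule generator_map_proj) (use elationD[OF assms(1)] assms in auto)

lemma elation_fixes:
  assumes "f \<in> elations l" "p \<in> P" "l \<in> P" "par p l"
  shows "f p = p"
proof -
  obtain K where K: "K \<in> C" "p \<in> K"
    using circle_through third_generator assms(2) by metis
  have "proj (f ` K) l = f (proj K l)" using elation_proj[OF assms(1)] assms K by blast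
  moreover have "proj K l = p" using K assms proj_eqI by blast
  ultimately show ?thesis using touch_proj[OF elationD(5)[OF assms(1) K(1)]] assms by metis
qed

lemma elation_eq_step:
  assumes f: "f \<in> elations l" "g \<in> elations l" and P: "l \<in> P" "p \<in> P" "q \<in> P"
    and np: "\<not> par p l" "\<not> par q l" "\<not> par p q" and eq: "f p = g p"
  shows "f q = g q"
proof -
  obtain K where K: "K \<in> C" "p \<in> K" "q \<in> K" using circle_through P np by metis
  have "touch l (f ` K) K" "touch l K (g ` K)" "f ` K \<in> C" "g ` K \<in> C"
    using elationD f K touch_sym by blast+
  hence "touch l (f ` K) (g ` K)" using K P touch_trans by blast
  moreover have "proj (f ` K) p = proj (g ` K) p"
    using elation_proj f K P eq proj_id by metis
  ultimately have "f ` K = g ` K" using touch_eqI P np by blast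
  thus ?thesis using elation_proj f K P proj_id by metis
qed

lemma elation_eqI:
  assumes f: "f \<in> elations l" "g \<in> elations l" and P: "l \<in> P" "p \<in> P"
    and np: "\<not> par p l" and eq: "f p = g p"
  shows "f = g"
proof
  fix q
  obtain e where e: "e \<in> P" "\<not> par e l" "\<not> par e p" using third_generator P by metis
  have "f e = g e" using elation_eq_step[OF f P(1,2) e(1) np e(2) _ eq] P e par_sym by blast
  consider "q \<notin> P" | "q \<in> P" "par q l" | "q \<in> P" "\<not> par q l" "\<not> par p q" | "q \<in> P" "\<not> par q l" "par p q"
    by blast
  thus "f q = g q"
  proof cases
    case 1 thus ?thesis using elationD(1)[OF f(1)] elationD(1)[OF f(2)] by simp
  next
    case 2 thus ?thesis using elation_fixes[OF f(1)] elation_fixes[OF f(2)] P by simp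
  next
    case 3 thus ?thesis using elation_eq_step[OF f P(1,2) _ np _ _ eq] by blast
  next
    case 4
    hence "\<not> par e q" using e P par_sym par_trans by meson
    thus ?thesis using 4 elation_eq_step[OF f P(1) e(1) _ e(2) _ _ \<open>f e = g e\<close>] by blast
  qed
qed

lemma elation_id: "id \<in> elations l"
  unfolding elations_def using par_refl touch_refl by auto

lemma elation_comp:
  assumes "f \<in> elations l" "g \<in> elations l" "l \<in> P"
  shows "f \<circ> g \<in> elations l"
proof -
  have "(f \<circ> g) ` K \<in> C \<and> touch l K ((f \<circ> g) ` K)" if "K \<in> C" for K
  proof -
    have g: "g ` K \<in> C" "touch l K (g ` K)" using elationD assms(2) that by blast+
    have f: "f ` g ` K \<in> C" "touch l (g ` K) (f ` g ` K)"
      using elationD[OF assms(1)] g(1) by blast+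
    have "touch l K (f ` g ` K)" using touch_trans[OF that g(1) f(1) assms(3) g(2) f(2)] .
    thus ?thesis using f by (simp add: image_comp)
  qed
  moreover have "f (g p) \<in> P \<and> par (f (g p)) p" if "p \<in> P" for p
  proof -
    have g: "g p \<in> P" "par (g p) p" using elationD assms(2) that by blast+
    have "f (g p) \<in> P" "par (f (g p)) (g p)" using elationD[OF assms(1)] g by blast+
    thus ?thesis using par_trans g that by blast
  qed
  moreover have "(f \<circ> g) p = p" if "p \<notin> P" for p
    using elationD(1)[OF assms(1) that] elationD(1)[OF assms(2) that] by simp
  ultimately show ?thesis unfolding elations_def by simp
qed

text \<open>The inverse is the elation that takes \<open>f b\<close> back to \<open>b\<close>; a
  single point off \<open>l\<close> decides the equality with \<open>id\<close>.\<close>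

lemma elation_inv:
  assumes f: "f \<in> elations l" and l: "l \<in> P"
  obtains g where "g \<in> elations l" "g \<circ> f = id" "f \<circ> g = id"
proof -
  obtain b where b: "b \<in> P" "\<not> par b l" using third_generator l by metis
  have fb: "f b \<in> P" "par b (f b)" "\<not> par (f b) l"
    using elationD(2,3)[OF f] b l par_sym par_trans by meson+
  obtain g where g: "g \<in> elations l" "g (f b) = b"
    using elation_ex[of l "f b" b] l b fb by metis
  have "g \<circ> f = id"
    by (rule elation_eqI[of _ l _ b]) (use f g b l elation_comp elation_id in auto)
  moreover have "f \<circ> g = id"
    by (rule elation_eqI[of _ l _ "f b"]) (use f g fb l elation_comp elation_id in auto)
  ultimately show ?thesis using that g by blast
qed

lemma elation_inj: "f \<in> elations l \<Longrightarrow> l \<in> P \<Longrightarrow> inj f"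
  by (metis inj_on_id inj_on_imageI2 elation_inv)

lemma elation_touch:
  assumes f: "f \<in> elations l" "l \<in> P" and K: "K \<in> C" "L \<in> C" "touch m K L"
  shows "touch m (f ` K) (f ` L)"
  using K(3) unfolding touch_def
  using elation_proj f K(1,2) inj_eq[OF elation_inj[OF f]] by metis

lemma circle_map_eqI:
  assumes "\<And>p. p \<in> P \<Longrightarrow> par (f p) p" "\<And>p. p \<in> P \<Longrightarrow> f p \<in> P" "\<And>p. p \<notin> P \<Longrightarrow> f p = p"
    and "\<And>p. p \<in> P \<Longrightarrow> par (g p) p" "\<And>p. p \<in> P \<Longrightarrow> g p \<in> P" "\<And>p. p \<notin> P \<Longrightarrow> g p = p"
    and "\<And>K. K \<in> C \<Longrightarrow> f ` K \<in> C" "\<And>K. K \<in> C \<Longrightarrow> f ` K = g ` K"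
  shows "f = g"
proof
  fix p
  show "f p = g p"
  proof (cases "p \<in> P")
    case True
    obtain K where K: "K \<in> C" "p \<in> K" using circle_through third_generator True by metis
    have "proj (f ` K) p = f (proj K p)" "proj (g ` K) p = g (proj K p)"
      using generator_map_proj[of f K p] generator_map_proj[of g K p] assms K True by metis+
    thus ?thesis using assms(8) K proj_id by metis
  qed (use assms in metis)
qed

text \<open>The images of \<open>K\<close> under the two products touch on \<open>m\<close>, as both
  touch the image under \<open>f\<close> there, and on \<open>l\<close>, as both touch the image
  under \<open>g\<close>. Two contacts on different generators force equality.\<close>

lemma elation_commute:
  assumes f: "f \<in> elations l" "g \<in> elations m" and P: "l \<in> P" "m \<in> P" and np: "\<not> par l m"
  shows "f \<circ> g = g \<circ> f"
proof (rule circle_map_eqI)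
  fix K assume K: "K \<in> C"
  have c: "f ` K \<in> C" "g ` K \<in> C" "f ` g ` K \<in> C" "g ` f ` K \<in> C"
    using elationD(4)[OF f(1)] elationD(4)[OF f(2)] K by blast+
  have "touch m (f ` K) (f ` g ` K)" "touch m (f ` K) (g ` f ` K)"
    using elation_touch[OF f(1) P(1) K c(2)] elationD(5)[OF f(2)] K c by blast+
  hence m: "touch m (f ` g ` K) (g ` f ` K)" using touch_sym touch_trans c P by metis
  have "touch l (g ` K) (g ` f ` K)" "touch l (g ` K) (f ` g ` K)"
    using elation_touch[OF f(2) P(2) K c(1)] elationD(5)[OF f(1)] K c by blast+
  hence "touch l (f ` g ` K) (g ` f ` K)" using touch_sym touch_trans c P by metis
  hence "f ` g ` K = g ` f ` K" using m touch_two P np by blast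
  thus "(f \<circ> g) ` K = (g \<circ> f) ` K" by (simp add: image_comp)
  show "(f \<circ> g) ` K \<in> C" using c by (simp add: image_comp)
next
  fix p assume p: "p \<in> P"
  have 1: "f p \<in> P" "par (f p) p" "g p \<in> P" "par (g p) p"
    using elationD(2,3)[OF f(1)] elationD(2,3)[OF f(2)] p by blast+
  have 2: "f (g p) \<in> P" "par (f (g p)) (g p)" "g (f p) \<in> P" "par (g (f p)) (f p)"
    using elationD(2,3)[OF f(1)] elationD(2,3)[OF f(2)] 1 by blast+
  show "(f \<circ> g) p \<in> P" "(g \<circ> f) p \<in> P" using 2 by simp_all
  show "par ((f \<circ> g) p) p" using par_trans[OF 2(1) 1(3) p 2(2) 1(4)] by simp
  show "par ((g \<circ> f) p) p" using par_trans[OF 2(3) 1(1) p 2(4) 1(2)] by simp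
qed (use elationD(1)[OF f(1)] elationD(1)[OF f(2)] in auto)

text \<open>Two elations on the same generator are compared on another generator, where each of them
  agrees with an elation for a third or a fourth one, and those commute with everything.\<close>

lemma elation_commute_same:
  assumes f: "f \<in> elations l" "g \<in> elations l" and l: "l \<in> P"
  shows "f \<circ> g = g \<circ> f"
proof -
  obtain c where c: "c \<in> P" "\<not> par c l" using third_generator l by metis
  obtain m where m: "m \<in> P" "\<not> par m l" "\<not> par m c" using third_generator l c by metis
  obtain n where n: "n \<in> P" "\<not> par n l" "\<not> par n c" "\<not> par n m" using fourth_generator l c m by metis
  obtain g' where g': "g' \<in> elations m" "g' c = g c"
    using elation_ex[of m c "g c"] m c elationD(2,3)[OF f(2)] par_sym by metis
  obtain h where h: "h \<in> elations n" "h c = f c"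
    using elation_ex[of n c "f c"] n c elationD(2,3)[OF f(1)] par_sym by metis
  have fg': "f (g' x) = g' (f x)" for x
    using elation_commute[OF f(1) g'(1)] l m par_sym by (metis comp_apply)
  have hg': "h (g' x) = g' (h x)" for x
    using elation_commute[OF h(1) g'(1)] n m par_sym by (metis comp_apply)
  have gh: "g (h x) = h (g x)" for x
    using elation_commute[OF f(2) h(1)] l n par_sym by (metis comp_apply)
  \<comment> \<open>The chain is \<open>f (g c) = f (g' c) = g' (f c) = g' (h c) = h (g' c) = h (g
    c) = g (h c) = g (f c)\<close>.\<close>
  have "f (g c) = g (f c)" using fg' hg' gh g' h by metis
  thus ?thesis
    using elation_eqI[of "f \<circ> g" l "g \<circ> f" c] elation_comp f l c by simp
qed

lemma elation_commute':
  assumes "f \<in> elations l" "g \<in> elations m" "l \<in> P" "m \<in> P"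
  shows "f \<circ> g = g \<circ> f"
  using assms elation_commute elation_commute_same elation_cong by metis

text \<open>The group generated by the elations, encoded as their centraliser so that closure under
  composition is immediate. That nothing more is obtained follows from
  \<open>shift_transitive\<close> and \<open>shift_eqI\<close>: each member is a product of two
  elations.\<close>

definition shifts :: "('p \<Rightarrow> 'p) set" where
  "shifts = {h. (\<forall>p. p \<notin> P \<longrightarrow> h p = p) \<and> (\<forall>p\<in>P. h p \<in> P \<and> par (h p) p) \<and> (\<forall>K\<in>C. h ` K \<in> C) \<and>
     (\<forall>l\<in>P. \<forall>f\<in>elations l. h \<circ> f = f \<circ> h)}"

lemma shiftD:
  assumes "h \<in> shifts"
  shows "p \<notin> P \<Longrightarrow> h p = p" "p \<in> P \<Longrightarrow> h p \<in> P" "p \<in> P \<Longrightarrow> par (h p) p" "K \<in> C \<Longrightarrow> h ` K \<in> C"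
    "l \<in> P \<Longrightarrow> f \<in> elations l \<Longrightarrow> h \<circ> f = f \<circ> h"
  using assms unfolding shifts_def by blast+

lemma elation_shift: "f \<in> elations l \<Longrightarrow> l \<in> P \<Longrightarrow> f \<in> shifts"
  unfolding shifts_def using elationD elation_commute' by blast

lemma shift_comp:
  assumes "h \<in> shifts" "k \<in> shifts"
  shows "h \<circ> k \<in> shifts"
proof -
  have "h \<circ> k \<circ> f = f \<circ> (h \<circ> k)" if "l \<in> P" "f \<in> elations l" for l f
    using shiftD(5)[OF assms(1) that] shiftD(5)[OF assms(2) that] by (metis comp_assoc)
  moreover have "h (k p) \<in> P \<and> par (h (k p)) p" if "p \<in> P" for p
  proof -
    have k: "k p \<in> P" "par (k p) p" using shiftD assms(2) that by blast+
    have "h (k p) \<in> P" "par (h (k p)) (k p)" using shiftD[OF assms(1)] k by blast+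
    thus ?thesis using par_trans k that by blast
  qed
  moreover have "(h \<circ> k) ` K \<in> C" if "K \<in> C" for K
    unfolding image_comp[symmetric] using that assms shiftD(4) by blast
  moreover have "(h \<circ> k) p = p" if "p \<notin> P" for p
    using shiftD(1)[OF assms(1) that] shiftD(1)[OF assms(2) that] by simp
  ultimately show ?thesis unfolding shifts_def by simp
qed

lemma shift_id: "id \<in> shifts"
  unfolding shifts_def using par_refl by auto

lemma shift_proj:
  assumes "h \<in> shifts" "K \<in> C" "p \<in> P"
  shows "proj (h ` K) p = h (proj K p)"
  by (rule generator_map_proj) (use shiftD[OF assms(1)] assms in auto)

lemma touch_elation:
  assumes "K \<in> C" "L \<in> C" "l \<in> P" "touch l K L"
  obtains f where "f \<in> elations l" "f ` K = L"
proof -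
  obtain b where b: "b \<in> P" "\<not> par b l" using third_generator assms by metis
  let ?p = "proj K b" and ?q = "proj L b"
  have p: "?p \<in> P" "?q \<in> P" "par ?q ?p" "\<not> par ?p l"
    using assms b proj_P proj_par par_sym par_trans by meson+
  obtain f where f: "f \<in> elations l" "f ?p = ?q" using elation_ex assms(3) p by metis
  have "proj (f ` K) b = proj L b" using elation_proj[OF f(1)] f assms b by metis
  moreover have "touch l (f ` K) L"
    using elationD(4,5)[OF f(1) assms(1)] assms touch_sym touch_trans by metis
  ultimately have "f ` K = L" using touch_eqI b by blast
  thus ?thesis using that f by blast
qed

text \<open>(C) joins two circles by a chain of at most two contacts, and each contact is effected
  by an elation.\<close>

lemma shift_transitive:
  assumes "K \<in> C" "L \<in> C"
  obtains f g l m where "l \<in> P" "m \<in> P" "f \<in> elations l" "g \<in> elations m" "(f \<circ> g) ` K = L"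
proof (cases "K = L")
  case True
  obtain l where "l \<in> P" using assms proj_P nontrivial_circle circle_sub by blast
  thus ?thesis using that[of l l id id] elation_id True by auto
next
  case False
  then obtain l where l: "l \<in> P" "proj K l \<noteq> proj L l" using circle_eqI assms by blast
  obtain M m where M: "M \<in> C" "touch l K M" "m \<in> P" "touch m M L"
    using C_ex assms l by metis
  obtain g where g: "g \<in> elations l" "g ` K = M" using touch_elation assms l M by metis
  obtain f where f: "f \<in> elations m" "f ` M = L" using touch_elation assms M by metis
  show ?thesis using that f g l M by (metis image_comp)
qed

lemma shift_ex:
  assumes "K \<in> C" "L \<in> C"
  obtains h where "h \<in> shifts" "h ` K = L"
proof -
  obtain f g l m where fg: "l \<in> P" "m \<in> P" "f \<in> elations l" "g \<in> elations m" "(f \<circ> g) ` K = L"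
    using shift_transitive[OF assms] by metis
  show ?thesis
    using that[OF shift_comp[OF elation_shift[OF fg(3,1)] elation_shift[OF fg(4,2)]] fg(5)] .
qed

text \<open>A shift commutes with the elations, and these carry \<open>K\<close> to any circle
  \<open>L\<close>; hence its action on \<open>L\<close> is determined by its action on
  \<open>K\<close>.\<close>

lemma shift_eqI:
  assumes "h \<in> shifts" "k \<in> shifts" "K \<in> C" "h ` K = k ` K"
  shows "h = k"
proof (rule circle_map_eqI)
  fix L assume L: "L \<in> C"
  obtain f g l m where fg: "l \<in> P" "m \<in> P" "f \<in> elations l" "g \<in> elations m" "(f \<circ> g) ` K = L"
    using shift_transitive[OF assms(3) L] by metis
  have *: "s ` L = (f \<circ> g) ` s ` K" if s: "s \<in> shifts" for s
  proof -
    have "s \<circ> (f \<circ> g) = (f \<circ> g) \<circ> s"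
      using shiftD(5)[OF s fg(1,3)] shiftD(5)[OF s fg(2,4)] by (metis comp_assoc)
    thus ?thesis using fg(5) by (metis image_comp)
  qed
  show "h ` L = k ` L" using *[OF assms(1)] *[OF assms(2)] assms(4) by simp
qed (fact shiftD(1-4)[OF assms(1)] shiftD(1-4)[OF assms(2)])+

text \<open>By regularity \<open>k\<close> equals a product of two elations, with which
  \<open>h\<close> commutes by definition.\<close>

lemma shift_commute:
  assumes "h \<in> shifts" "k \<in> shifts"
  shows "h \<circ> k = k \<circ> h"
proof -
  obtain K where K: "K \<in> C" using nontrivial_circle by blast
  obtain f g l m where fg: "l \<in> P" "m \<in> P" "f \<in> elations l" "g \<in> elations m"
    "(f \<circ> g) ` K = k ` K"
    using shift_transitive[OF K shiftD(4)[OF assms(2) K]] by metis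
  have "f \<circ> g \<in> shifts"
    by (rule shift_comp[OF elation_shift[OF fg(3,1)] elation_shift[OF fg(4,2)]])
  hence "k = f \<circ> g" using shift_eqI[OF assms(2) _ K] fg(5) by simp
  thus ?thesis using shiftD(5)[OF assms(1) fg(1,3)] shiftD(5)[OF assms(1) fg(2,4)]
    by (metis comp_assoc)
qed

lemma shift_inv:
  assumes "h \<in> shifts"
  obtains k where "k \<in> shifts" "k \<circ> h = id" "h \<circ> k = id"
proof -
  obtain K where K: "K \<in> C" using nontrivial_circle by blast
  obtain k where k: "k \<in> shifts" "k ` h ` K = K" using shift_ex[OF shiftD(4)[OF assms K] K] by metis
  have "(k \<circ> h) ` K = id ` K" using k by (simp add: image_comp)
  hence "k \<circ> h = id" using shift_eqI[OF shift_comp[OF k(1) assms] shift_id K] by blast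
  thus ?thesis using that k assms shift_commute by metis
qed

lemma shift_inj: "h \<in> shifts \<Longrightarrow> inj h"
  by (metis inj_on_id inj_on_imageI2 shift_inv)

lemma shift_touch:
  assumes h: "h \<in> shifts" and K: "K \<in> C" "L \<in> C"
  shows "touch m (h ` K) (h ` L) \<longleftrightarrow> touch m K L"
proof -
  have "h ` K = h ` L \<longleftrightarrow> K = L" using shift_inj[OF h] by (simp add: inj_image_eq_iff)
  moreover have "proj (h ` K) p = proj (h ` L) p \<longleftrightarrow> proj K p = proj L p" if "p \<in> P" for p
    using shift_proj[OF h] K that inj_eq[OF shift_inj[OF h]] by metis
  ultimately show ?thesis unfolding touch_def by metis
qed

end

subsection \<open>Values and coefficients\<close>

text \<open>\<open>B\<close> becomes the graph of the zero function, and \<open>w\<close>,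
  \<open>z\<close>, \<open>u\<close> its points over infinity, 0 and 1.\<close>

locale laguerre_frame = laguerre_CS P C par
  for P :: "'p set" and C :: "'p set set" and par :: "'p \<Rightarrow> 'p \<Rightarrow> bool" +
  fixes B :: "'p set" and w z u :: 'p
  assumes B: "B \<in> C" and wzu: "w \<in> B" "z \<in> B" "u \<in> B" and distinct: "w \<noteq> z" "w \<noteq> u" "z \<noteq> u"
begin

abbreviation org :: "'p \<Rightarrow> 'p" where "org \<equiv> proj B"

lemma frame_P: "w \<in> P" "z \<in> P" "u \<in> P"
  using B wzu circle_sub by blast+

lemma frame_npar: "\<not> par w z" "\<not> par z w" "\<not> par w u" "\<not> par u w" "\<not> par z u" "\<not> par u z"
  using B wzu distinct circle_par_eq by metis+

lemma org_frame [simp]: "org w = w" "org z = z" "org u = u"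
  using B wzu proj_id by blast+

lemma org_P: "x \<in> P \<Longrightarrow> org x \<in> P"
  using B proj_P by blast

lemma org_par: "x \<in> P \<Longrightarrow> par (org x) x" "x \<in> P \<Longrightarrow> par x (org x)"
  using B proj_par proj_P par_sym by blast+

lemma org_cong: "x \<in> P \<Longrightarrow> y \<in> P \<Longrightarrow> par x y \<Longrightarrow> org x = org y"
  using B proj_cong by blast

lemma org_npar: "x \<in> P \<Longrightarrow> y \<in> P \<Longrightarrow> \<not> par x y \<Longrightarrow> \<not> par (org x) y"
  using org_par org_P par_trans by meson

lemma shift_org:
  assumes "h \<in> shifts" "x \<in> P"
  shows "h (org x) \<in> P" "par (h (org x)) x" "proj (h ` B) x = h (org x)"
proof -
  show "h (org x) \<in> P" using shiftD(2)[OF assms(1)] org_P assms by blast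
  have "par (h (org x)) (org x)" using shiftD(3)[OF assms(1)] org_P assms by blast
  thus "par (h (org x)) x" using org_par org_P par_trans assms \<open>h (org x) \<in> P\<close> by blast
  show "proj (h ` B) x = h (org x)" using shift_proj[OF assms(1) B assms(2)] .
qed

lemma shift_app_commute: "h \<in> shifts \<Longrightarrow> k \<in> shifts \<Longrightarrow> h (k p) = k (h p)"
  using shift_commute by (metis comp_apply)

lemma shift_eqI3:
  assumes h: "h \<in> shifts" "k \<in> shifts" and P: "x \<in> P" "y \<in> P" "t \<in> P"
    and np: "\<not> par x y" "\<not> par x t" "\<not> par y t"
    and eq: "h (org x) = k (org x)" "h (org y) = k (org y)" "h (org t) = k (org t)"
  shows "h = k"
proof (rule shift_eqI[OF h B])
  show "h ` B = k ` B"
    by (rule circle_eqI3[of _ _ x y t]) (use shiftD(4) h B P np eq shift_org(3) in simp_all)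
qed

lemma shift_ex3:
  assumes P: "x \<in> P" "y \<in> P" "t \<in> P" and np: "\<not> par x y" "\<not> par x t" "\<not> par y t"
    and q: "p \<in> P" "par p x" "q \<in> P" "par q y" "r \<in> P" "par r t"
  obtains h where "h \<in> shifts" "h (org x) = p" "h (org y) = q" "h (org t) = r"
proof -
  have "\<not> par p q" "\<not> par q r" "\<not> par p r"
    using P np q par_sym par_trans by meson+
  then obtain K where K: "K \<in> C" "p \<in> K" "q \<in> K" "r \<in> K" using circle_ex q by metis
  obtain h where h: "h \<in> shifts" "h ` B = K" using shift_ex B K by metis
  show ?thesis using that[OF h(1)] shift_org(3)[OF h(1)] h K P q proj_eqI by metis
qed

text \<open>One circle decides: the elation that takes \<open>B\<close> to its image under
  \<open>h\<close> is \<open>h\<close> itself, by regularity.\<close>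

lemma elation_iff_touch:
  assumes "h \<in> shifts" "l \<in> P"
  shows "h \<in> elations l \<longleftrightarrow> touch l B (h ` B)"
proof
  assume "touch l B (h ` B)"
  then obtain f where f: "f \<in> elations l" "f ` B = h ` B"
    using touch_elation[OF B shiftD(4)[OF assms(1) B] assms(2)] by metis
  have "f = h" using shift_eqI[OF elation_shift[OF f(1) assms(2)] assms(1) B f(2)] .
  thus "h \<in> elations l" using f by simp
qed (use elationD(5) B in blast)

lemma elation_org: "f \<in> elations l \<Longrightarrow> l \<in> P \<Longrightarrow> f (org l) = org l"
  using elation_fixes org_P org_par by blast

section \<open>Ordinates and their addition\<close>

definition V :: "'p set" where "V = {p \<in> P. par p u}"

lemma u_V: "u \<in> V"
  unfolding V_def using frame_P par_refl by simp

lemma shift_V: "h \<in> shifts \<Longrightarrow> v \<in> V \<Longrightarrow> h v \<in> V"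
  unfolding V_def using shiftD(2,3) frame_P par_trans by blast

text \<open>In the classical model, adding the constant \<open>v\<close>, the quadratic \<open>v x\<^sup>2\<close> and the linear
  function \<open>v x\<close>, respectively.\<close>

definition cst :: "'p \<Rightarrow> 'p \<Rightarrow> 'p" where
  "cst v = (THE f. f \<in> elations w \<and> f u = v)"

definition sq :: "'p \<Rightarrow> 'p \<Rightarrow> 'p" where
  "sq v = (THE f. f \<in> elations z \<and> f u = v)"

definition lin :: "'p \<Rightarrow> 'p \<Rightarrow> 'p" where
  "lin v = (THE f. f \<in> shifts \<and> f u = v \<and> f w = w \<and> f z = z)"

lemma elation_ex1:
  assumes "l \<in> P" "\<not> par u l" "v \<in> V"
  shows "\<exists>!f. f \<in> elations l \<and> f u = v"
proof -
  obtain f where "f \<in> elations l" "f u = v"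
    using elation_ex[of l u v] assms frame_P V_def by auto
  thus ?thesis using elation_eqI[of _ l _ u] assms frame_P by metis
qed

lemma cst: assumes "v \<in> V" shows "cst v \<in> elations w" "cst v u = v"
  using theI'[OF elation_ex1[OF frame_P(1) frame_npar(4) assms]] unfolding cst_def by blast+

lemma cst_eqI: "f \<in> elations w \<Longrightarrow> cst (f u) = f"
  using elation_eqI[of _ w _ u] cst[of "f u"] frame_P frame_npar elation_shift shift_V u_V
  by blast

lemma sq: assumes "v \<in> V" shows "sq v \<in> elations z" "sq v u = v"
  using theI'[OF elation_ex1[OF frame_P(2) frame_npar(6) assms]] unfolding sq_def by blast+

lemma sq_eqI: "f \<in> elations z \<Longrightarrow> sq (f u) = f"
  using elation_eqI[of _ z _ u] sq[of "f u"] frame_P frame_npar elation_shift shift_V u_V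
  by blast

lemma shift_frame_eqI:
  "h \<in> shifts \<Longrightarrow> k \<in> shifts \<Longrightarrow> h u = k u \<Longrightarrow> h w = k w \<Longrightarrow> h z = k z \<Longrightarrow> h = k"
  using shift_eqI3[of h k u w z] frame_P frame_npar by simp

lemma lin:
  assumes "v \<in> V" shows "lin v \<in> shifts" "lin v u = v" "lin v w = w" "lin v z = z"
proof -
  obtain f where "f \<in> shifts" "f u = v" "f w = w" "f z = z"
    using shift_ex3[of u w z v w z] frame_P frame_npar par_refl assms V_def by auto
  hence "\<exists>!f. f \<in> shifts \<and> f u = v \<and> f w = w \<and> f z = z"
    using shift_frame_eqI by metis
  from theI'[OF this]
  show "lin v \<in> shifts" "lin v u = v" "lin v w = w" "lin v z = z"
    unfolding lin_def by blast+
qed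

lemma lin_eqI: "f \<in> shifts \<Longrightarrow> f w = w \<Longrightarrow> f z = z \<Longrightarrow> lin (f u) = f"
  using shift_frame_eqI lin[of "f u"] shift_V u_V by metis

lemma cst_shift: "v \<in> V \<Longrightarrow> cst v \<in> shifts" and sq_shift: "v \<in> V \<Longrightarrow> sq v \<in> shifts"
  using cst sq elation_shift frame_P by blast+

lemma cst_w: "v \<in> V \<Longrightarrow> cst v w = w" and sq_z: "v \<in> V \<Longrightarrow> sq v z = z"
  using cst elation_org[of _ w] sq elation_org[of _ z] frame_P by (metis org_frame)+

text \<open>The value of a point: points on \<open>w\<close> are compared with \<open>V\<close> by the elations \<open>sq v\<close>, all
  other points by the constants.\<close>

definition val :: "'p \<Rightarrow> 'p" where
  "val p = (THE v. v \<in> V \<and> (if par p w then sq v w = p else cst v (org p) = p))"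

lemma val_ex1:
  assumes "p \<in> P"
  shows "\<exists>!v. v \<in> V \<and> (if par p w then sq v w = p else cst v (org p) = p)"
proof (cases "par p w")
  case True
  obtain f where f: "f \<in> elations z" "f w = p"
    using elation_ex[of z w p] assms frame_P frame_npar True by metis
  have fu: "f u \<in> V" using f shift_V u_V elation_shift frame_P by blast
  show ?thesis
  proof (rule ex1I[of _ "f u"])
    show "f u \<in> V \<and> (if par p w then sq (f u) w = p else cst (f u) (org p) = p)"
      using True f fu sq_eqI by simp
    fix v assume "v \<in> V \<and> (if par p w then sq v w = p else cst v (org p) = p)"
    hence v: "v \<in> V" "sq v w = f w" using True f by auto
    have "sq v = f"
      using elation_eqI[OF sq(1)[OF v(1)] f(1) frame_P(2,1) frame_npar(1) v(2)] .
    thus "v = f u" using sq v by metis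
  qed
next
  case False
  have o: "org p \<in> P" "\<not> par (org p) w" "par p (org p)"
    using assms org_P org_npar org_par False frame_P by blast+
  obtain f where f: "f \<in> elations w" "f (org p) = p"
    using elation_ex[of w "org p" p] assms frame_P o by metis
  have fu: "f u \<in> V" using f shift_V u_V elation_shift frame_P by blast
  show ?thesis
  proof (rule ex1I[of _ "f u"])
    show "f u \<in> V \<and> (if par p w then sq (f u) w = p else cst (f u) (org p) = p)"
      using False f fu cst_eqI by simp
    fix v assume "v \<in> V \<and> (if par p w then sq v w = p else cst v (org p) = p)"
    hence v: "v \<in> V" "cst v (org p) = f (org p)" using False f by auto
    have "cst v = f"
      using elation_eqI[OF cst(1)[OF v(1)] f(1) frame_P(1) o(1,2) v(2)] .
    thus "v = f u" using cst v by metis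
  qed
qed

lemma val_V: "p \<in> P \<Longrightarrow> val p \<in> V"
  using theI'[OF val_ex1[of p]] unfolding val_def by blast

lemma val_w: "p \<in> P \<Longrightarrow> par p w \<Longrightarrow> sq (val p) w = p"
  using theI'[OF val_ex1[of p]] unfolding val_def by simp

lemma val_cst: "p \<in> P \<Longrightarrow> \<not> par p w \<Longrightarrow> cst (val p) (org p) = p"
  using theI'[OF val_ex1[of p]] unfolding val_def by simp

lemma val_w_eqI: "v \<in> V \<Longrightarrow> p \<in> P \<Longrightarrow> par p w \<Longrightarrow> sq v w = p \<Longrightarrow> val p = v"
  using val_ex1[of p] val_V[of p] val_w[of p] by auto

lemma val_cst_eqI: "v \<in> V \<Longrightarrow> p \<in> P \<Longrightarrow> \<not> par p w \<Longrightarrow> cst v (org p) = p \<Longrightarrow> val p = v"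
  using val_ex1[of p] val_V[of p] val_cst[of p] by auto

lemma val_inj:
  assumes "p \<in> P" "q \<in> P" "par p q" "val p = val q"
  shows "p = q"
proof (cases "par p w")
  case True
  hence "par q w" using assms frame_P par_sym par_trans by meson
  thus ?thesis using val_w True assms by metis
next
  case False
  hence "\<not> par q w" using assms frame_P par_trans by meson
  thus ?thesis using val_cst False assms org_cong by metis
qed

text \<open>A shift stands for the circle to which it takes \<open>B\<close>, viewed as a function
  on the generators; \<open>ev h x\<close> is the value of this function.\<close>

definition ev :: "('p \<Rightarrow> 'p) \<Rightarrow> 'p \<Rightarrow> 'p" where
  "ev h x = val (h (org x))"

lemma ev_V: "h \<in> shifts \<Longrightarrow> x \<in> P \<Longrightarrow> ev h x \<in> V"
  unfolding ev_def using val_V shift_org by blast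

lemma ev_cong: "x \<in> P \<Longrightarrow> y \<in> P \<Longrightarrow> par x y \<Longrightarrow> ev h x = ev h y"
  unfolding ev_def using org_cong by metis

lemma ev_w: "h \<in> shifts \<Longrightarrow> sq (ev h w) w = h w"
  unfolding ev_def using val_w shift_org frame_P by (metis org_frame(1))

lemma ev_cst_app:
  assumes "h \<in> shifts" "x \<in> P" "\<not> par x w"
  shows "cst (ev h x) (org x) = h (org x)"
proof -
  have "org (h (org x)) = org x" using org_cong shift_org assms by metis
  moreover have "\<not> par (h (org x)) w"
    using shift_org[OF assms(1,2)] assms frame_P par_sym par_trans by meson
  ultimately show ?thesis unfolding ev_def using val_cst shift_org[OF assms(1,2)] by metis
qed

lemma ev_eq_iff:
  assumes "h \<in> shifts" "k \<in> shifts" "x \<in> P"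
  shows "ev h x = ev k x \<longleftrightarrow> h (org x) = k (org x)"
proof -
  have "par (h (org x)) (k (org x))"
    using shift_org assms par_sym par_trans by meson
  thus ?thesis unfolding ev_def using val_inj shift_org assms by metis
qed

definition add :: "'p \<Rightarrow> 'p \<Rightarrow> 'p" where "add v v' = cst v v'"

text \<open>A shift commutes with the constants, and these are transitive on \<open>V\<close>, so on
  \<open>V\<close> it acts as the translation by its value at the zero \<open>u\<close>.\<close>

lemma shift_add: "h \<in> shifts \<Longrightarrow> v \<in> V \<Longrightarrow> h v = add (h u) v"
proof -
  assume h: "h \<in> shifts" and v: "v \<in> V"
  have hu: "h u \<in> V" using h shift_V u_V by blast
  have "h v = cst v (h u)" using cst(2)[OF v] shift_app_commute[OF h cst_shift[OF v]] by metis
  also have "\<dots> = cst v (cst (h u) u)" using cst(2)[OF hu] by simp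
  also have "\<dots> = cst (h u) (cst v u)"
    using shift_app_commute[OF cst_shift[OF v] cst_shift[OF hu]] .
  finally show ?thesis using cst(2)[OF v] add_def by simp
qed

lemma add_V: "v \<in> V \<Longrightarrow> v' \<in> V \<Longrightarrow> add v v' \<in> V"
  unfolding add_def using shift_V cst_shift by blast

lemma cst_add: "v \<in> V \<Longrightarrow> v' \<in> V \<Longrightarrow> cst (add v v') = cst v \<circ> cst v'"
  using cst_eqI[OF elation_comp[OF cst(1) cst(1) frame_P(1)], of v v'] cst(2)[of v']
  by (simp add: add_def)

lemma sq_add: "v \<in> V \<Longrightarrow> v' \<in> V \<Longrightarrow> sq (add v v') = sq v \<circ> sq v'"
  using sq_eqI[OF elation_comp[OF sq(1) sq(1) frame_P(2)], of v v'] sq(2)[of v'] sq(2)[of v]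
    shift_add[OF sq_shift, of v v'] by simp

lemma lin_add: "v \<in> V \<Longrightarrow> v' \<in> V \<Longrightarrow> lin (add v v') = lin v \<circ> lin v'"
  using lin_eqI[OF shift_comp[OF lin(1) lin(1)], of v v'] lin(2-)[of v'] lin(2-)[of v]
    shift_add[OF lin(1), of v v'] by simp

lemma add_assoc: "a \<in> V \<Longrightarrow> b \<in> V \<Longrightarrow> c \<in> V \<Longrightarrow> add (add a b) c = add a (add b c)"
  using cst_add by (simp add: add_def)

lemma add_commute: "a \<in> V \<Longrightarrow> b \<in> V \<Longrightarrow> add a b = add b a"
  using shift_app_commute[OF cst_shift cst_shift, of a b u] cst(2) by (simp add: add_def)

lemma cst_u: "cst u = id"
  using cst_eqI[OF elation_id] by simp

lemma add_u: "a \<in> V \<Longrightarrow> add u a = a"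
  by (simp add: add_def cst_u)

lemma add_inv:
  assumes "a \<in> V"
  shows "\<exists>b\<in>V. add b a = u"
proof -
  obtain k where k: "k \<in> shifts" "k \<circ> cst a = id" using shift_inv cst_shift assms by metis
  have "k a = u" using k(2) cst(2)[OF assms] by (metis comp_apply id_apply)
  hence "add (k u) a = u" using shift_add[OF k(1) assms] by simp
  thus ?thesis using k shift_V u_V by blast
qed

text \<open>On \<open>w\<close> the values are measured by \<open>sq\<close>, elsewhere by
  \<open>cst\<close>; both are homomorphisms from \<open>add\<close> to composition and commute with
  all shifts.\<close>

lemma ev_comp:
  assumes h: "h \<in> shifts" "k \<in> shifts" "x \<in> P"
  shows "ev (h \<circ> k) x = add (ev h x) (ev k x)"
proof -
  have V: "ev h x \<in> V" "ev k x \<in> V" using ev_V h by blast+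
  have hk: "h \<circ> k \<in> shifts" using shift_comp h by blast
  note p = shift_org[OF hk h(3)]
  show ?thesis
  proof (cases "par x w")
    case True
    hence o: "org x = w" using org_cong h frame_P org_frame by metis
    have "ev h x = ev h w" "ev k x = ev k w" using ev_cong True h frame_P by blast+
    hence s: "sq (ev h x) w = h w" "sq (ev k x) w = k w" using ev_w h by auto
    have "sq (add (ev h x) (ev k x)) w = sq (ev h x) (k w)"
      using sq_add[OF V] s by simp
    also have "\<dots> = k (h w)" using shift_app_commute[OF sq_shift[OF V(1)] h(2)] s by simp
    also have "\<dots> = (h \<circ> k) (org x)" using shift_app_commute h o by simp
    finally show ?thesis
      using val_w_eqI[OF add_V[OF V] p(1) par_trans[OF p(1) h(3) frame_P(1) p(2) True]] o
      unfolding ev_def[of "h \<circ> k"] by simp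
  next
    case False
    note s = ev_cst_app[OF h(1,3) False] ev_cst_app[OF h(2,3) False]
    have o: "org ((h \<circ> k) (org x)) = org x" using org_cong p h(3) by metis
    have np: "\<not> par ((h \<circ> k) (org x)) w"
      using p h(3) False frame_P par_sym par_trans by meson
    have "cst (add (ev h x) (ev k x)) (org x) = cst (ev h x) (k (org x))"
      using cst_add[OF V] s by simp
    also have "\<dots> = k (h (org x))" using shift_app_commute[OF cst_shift[OF V(1)] h(2)] s by simp
    also have "\<dots> = (h \<circ> k) (org x)" using shift_app_commute h by simp
    finally show ?thesis
      using val_cst_eqI[OF add_V[OF V] p(1) np] o unfolding ev_def[of "h \<circ> k"] by simp
  qed
qed

lemma ev_cst: "v \<in> V \<Longrightarrow> x \<in> P \<Longrightarrow> \<not> par x w \<Longrightarrow> ev (cst v) x = v"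
proof -
  assume v: "v \<in> V" and x: "x \<in> P" "\<not> par x w"
  note p = shift_org[OF cst_shift[OF v] x(1)]
  have "org (cst v (org x)) = org x" using org_cong p x by metis
  moreover have "\<not> par (cst v (org x)) w"
    using p x frame_P par_sym par_trans by meson
  ultimately show ?thesis unfolding ev_def using val_cst_eqI[OF v p(1)] by simp
qed

lemma ev_sq_w: "v \<in> V \<Longrightarrow> ev (sq v) w = v"
  using val_w_eqI[of v "sq v w"] shift_org(1,2)[OF sq_shift frame_P(1)] by (simp add: ev_def)

lemma ev_id: "x \<in> P \<Longrightarrow> ev id x = u"
proof (cases "par x w")
  case True
  assume x: "x \<in> P"
  have "sq u = id" using sq_eqI[OF elation_id] by simp
  hence "ev id w = u" using ev_sq_w u_V by metis
  thus ?thesis using ev_cong True x frame_P by metis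
qed (use ev_cst u_V cst_u in metis)

lemma ev_fix_iff: "h \<in> shifts \<Longrightarrow> x \<in> P \<Longrightarrow> ev h x = u \<longleftrightarrow> h (org x) = org x"
  using ev_eq_iff[OF _ shift_id, of h x] ev_id by simp

lemma ev_u: "h \<in> shifts \<Longrightarrow> ev h u = h u"
  using ev_cst_app[of h u] frame_P frame_npar ev_V cst(2) by simp


text \<open>In the classical model \<open>x t\<close> and, for \<open>Q\<close>,
  \<open>x^2 t\<close>. The abscissa is so far only a generator, so multiplication by it is an
  operator on values. That these operators commute is what the contact arguments have to
  provide.\<close>

definition M :: "'p \<Rightarrow> 'p \<Rightarrow> 'p" where "M x t = ev (lin t) x"

definition Q :: "'p \<Rightarrow> 'p \<Rightarrow> 'p" where "Q x t = ev (sq t) x"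

text \<open>The frame fixes the abscissa 1 but no unit of values, so any nonzero value will do;
  \<open>M x e\<close> then matches abscissae with values.\<close>

definition e :: 'p where "e = (SOME v. v \<in> V \<and> v \<noteq> u)"

definition gen :: "'p \<Rightarrow> 'p" where "gen s = (SOME x. x \<in> P \<and> \<not> par x w \<and> M x e = s)"

text \<open>The product is the value at the abscissa of \<open>s\<close> of the linear function with
  coefficient \<open>t\<close>. Additivity in \<open>t\<close> is thus built in, while the other
  ring laws wait for \<open>M_commute\<close>.\<close>

definition F :: "'p ring" where
  "F = \<lparr>carrier = V, mult = (\<lambda>s t. M (gen s) t), one = e, zero = u, add = add\<rparr>"

abbreviation F_zero ("\<zero>\<^sub>F") where "\<zero>\<^sub>F \<equiv> \<zero>\<^bsub>F\<^esub>"
abbreviation F_plus (infixl "\<oplus>\<^sub>F" 65) where "a \<oplus>\<^sub>F b \<equiv> a \<oplus>\<^bsub>F\<^esub> b"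
abbreviation F_uminus ("\<ominus>\<^sub>F _" [81] 80) where "\<ominus>\<^sub>F a \<equiv> \<ominus>\<^bsub>F\<^esub> a"
abbreviation F_minus (infixl "-\<^sub>F" 65) where "a -\<^sub>F b \<equiv> a \<ominus>\<^bsub>F\<^esub> b"
abbreviation F_times (infixl "\<otimes>\<^sub>F" 70) where "a \<otimes>\<^sub>F b \<equiv> a \<otimes>\<^bsub>F\<^esub> b"

lemma F_simps [simp]: "carrier F = V" "zero F = u" "one F = e" "a \<oplus>\<^sub>F b = add a b"
  "a \<otimes>\<^sub>F b = M (gen a) b"
  by (simp_all add: F_def)

lemma F_abelian_group: "abelian_group F"
  by (rule abelian_groupI)
    (use u_V add_V add_assoc add_commute add_u add_inv in auto)

end

sublocale laguerre_frame \<subseteq> F: abelian_group F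
  by (rule F_abelian_group)

context laguerre_frame begin

declare F_simps(2,4,5) [simp del]

lemma F_add: "add a b = a \<oplus>\<^sub>F b"
  by (simp add: F_simps)

lemmas V_closed = F.a_closed[unfolded F_simps(1)] F.minus_closed[unfolded F_simps(1)]
  F.a_inv_closed[unfolded F_simps(1)] F.zero_closed[unfolded F_simps(1)]

lemma F_minus_zero: "\<ominus>\<^sub>F \<zero>\<^sub>F = \<zero>\<^sub>F"
  using F.r_zero[OF F.a_inv_closed[OF F.zero_closed]] F.l_neg[OF F.zero_closed] by simp

lemmas group_simps = F.minus_eq F.minus_add F.a_ac F.r_neg F.l_neg F.r_neg1 F.r_neg2 F.minus_minus
  F.l_zero F.r_zero F_minus_zero V_closed

lemma diff_eq_iff: "a \<in> V \<Longrightarrow> b \<in> V \<Longrightarrow> c \<in> V \<Longrightarrow> a -\<^sub>F b = c \<longleftrightarrow> a = c \<oplus>\<^sub>F b"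
proof -
  assume V: "a \<in> V" "b \<in> V" "c \<in> V"
  have "a -\<^sub>F b = c \<longleftrightarrow> (a -\<^sub>F b) \<oplus>\<^sub>F b = c \<oplus>\<^sub>F b"
    using V F.add.right_cancel[of b "a -\<^sub>F b" c] by (simp add: V_closed)
  moreover have "(a -\<^sub>F b) \<oplus>\<^sub>F b = a" using V by (simp add: group_simps)
  ultimately show ?thesis by simp
qed

lemma diff_zero_iff: "a \<in> V \<Longrightarrow> b \<in> V \<Longrightarrow> a -\<^sub>F b = \<zero>\<^sub>F \<longleftrightarrow> a = b"
  using diff_eq_iff[of a b "\<zero>\<^sub>F"] by (simp add: V_closed)

section \<open>Circles as quadratic functions\<close>

lemmas ev_comp' = ev_comp[unfolded F_add]

lemma ev_fix_iff': "h \<in> shifts \<Longrightarrow> x \<in> P \<Longrightarrow> ev h x = \<zero>\<^sub>F \<longleftrightarrow> h (org x) = org x"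
  using ev_fix_iff by (simp add: F_simps)

lemma ev_id': "x \<in> P \<Longrightarrow> ev id x = \<zero>\<^sub>F"
  using ev_id by (simp add: F_simps)

lemma ev_cst_w: "v \<in> V \<Longrightarrow> ev (cst v) w = \<zero>\<^sub>F"
  using ev_fix_iff' cst_shift cst_w frame_P by simp

lemma ev_sq_z: "v \<in> V \<Longrightarrow> ev (sq v) z = \<zero>\<^sub>F"
  using ev_fix_iff' sq_shift sq_z frame_P by simp

lemma ev_lin: "v \<in> V \<Longrightarrow> ev (lin v) w = \<zero>\<^sub>F" "v \<in> V \<Longrightarrow> ev (lin v) z = \<zero>\<^sub>F" "v \<in> V \<Longrightarrow> ev (lin v) u = v"
  using ev_fix_iff' lin frame_P ev_u by simp_all

lemma ev_sq_u: "v \<in> V \<Longrightarrow> ev (sq v) u = v"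
  using sq sq_shift ev_u by simp

text \<open>The middle coefficient: \<open>a x^2 + b x + c\<close> has the values \<open>a\<close>,
  \<open>c\<close> and \<open>a + b + c\<close> over \<open>w\<close>, \<open>z\<close> and
  \<open>u\<close>.\<close>

definition md :: "('p \<Rightarrow> 'p) \<Rightarrow> 'p" where
  "md h = ev h u -\<^sub>F ev h w -\<^sub>F ev h z"

lemma md_V: "h \<in> shifts \<Longrightarrow> md h \<in> V"
  unfolding md_def using ev_V frame_P by (simp add: V_closed)

lemma md_comp: "h \<in> shifts \<Longrightarrow> k \<in> shifts \<Longrightarrow> md (h \<circ> k) = md h \<oplus>\<^sub>F md k"
  unfolding md_def using ev_V frame_P by (simp add: ev_comp' group_simps)

lemma shift_eqI_coeffs:
  assumes "h \<in> shifts" "k \<in> shifts" "ev h w = ev k w" "md h = md k" "ev h z = ev k z"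
  shows "h = k"
proof -
  have V: "ev h u \<in> V" "ev h w \<in> V" "ev h z \<in> V" "ev k u \<in> V"
    using ev_V assms frame_P by blast+
  have "ev h u -\<^sub>F ev h w -\<^sub>F ev h z = ev k u -\<^sub>F ev h w -\<^sub>F ev h z"
    using assms by (simp add: md_def)
  hence "ev h u = ev k u" using V by (simp add: F.minus_eq V_closed)
  thus ?thesis using shift_frame_eqI[of h k] ev_eq_iff[of h k] assms frame_P org_frame by metis
qed

lemma md_cst: "v \<in> V \<Longrightarrow> md (cst v) = \<zero>\<^sub>F"
  unfolding md_def using frame_P frame_npar by (simp add: ev_cst ev_cst_w group_simps)

lemma md_sq: "v \<in> V \<Longrightarrow> md (sq v) = \<zero>\<^sub>F"
  unfolding md_def by (simp add: ev_sq_u ev_sq_w ev_sq_z group_simps)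

lemma md_lin: "v \<in> V \<Longrightarrow> md (lin v) = v"
  unfolding md_def by (simp add: ev_lin group_simps)

lemma M_V: "x \<in> P \<Longrightarrow> t \<in> V \<Longrightarrow> M x t \<in> V" and Q_V: "x \<in> P \<Longrightarrow> t \<in> V \<Longrightarrow> Q x t \<in> V"
  unfolding M_def Q_def using ev_V lin(1) sq_shift by blast+

lemma M_add: "x \<in> P \<Longrightarrow> s \<in> V \<Longrightarrow> t \<in> V \<Longrightarrow> M x (s \<oplus>\<^sub>F t) = M x s \<oplus>\<^sub>F M x t"
  unfolding M_def by (simp add: F_add[symmetric] lin_add lin(1) ev_comp)

lemma Q_add: "x \<in> P \<Longrightarrow> s \<in> V \<Longrightarrow> t \<in> V \<Longrightarrow> Q x (s \<oplus>\<^sub>F t) = Q x s \<oplus>\<^sub>F Q x t"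
  unfolding Q_def by (simp add: F_add[symmetric] sq_add sq_shift ev_comp)

definition poly :: "'p \<Rightarrow> 'p \<Rightarrow> 'p \<Rightarrow> 'p \<Rightarrow> 'p" where
  "poly a b c = sq a \<circ> lin b \<circ> cst c"

lemma poly:
  assumes V: "a \<in> V" "b \<in> V" "c \<in> V"
  shows "poly a b c \<in> shifts" "ev (poly a b c) w = a" "md (poly a b c) = b" "ev (poly a b c) z = c"
    "x \<in> P \<Longrightarrow> \<not> par x w \<Longrightarrow> ev (poly a b c) x = Q x a \<oplus>\<^sub>F M x b \<oplus>\<^sub>F c"
proof -
  note s = sq_shift[OF V(1)] lin(1)[OF V(2)] cst_shift[OF V(3)] shift_comp
  show "poly a b c \<in> shifts" unfolding poly_def by (intro s)
  show "ev (poly a b c) w = a" "md (poly a b c) = b" "ev (poly a b c) z = c"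
    "x \<in> P \<Longrightarrow> \<not> par x w \<Longrightarrow> ev (poly a b c) x = Q x a \<oplus>\<^sub>F M x b \<oplus>\<^sub>F c"
    unfolding poly_def Q_def M_def using V s frame_P frame_npar
    by (simp_all add: ev_comp' md_comp ev_sq_w ev_lin ev_cst_w md_sq md_lin md_cst ev_sq_z ev_cst
      group_simps)
qed

lemma shift_poly: "h \<in> shifts \<Longrightarrow> h = poly (ev h w) (md h) (ev h z)"
  using shift_eqI_coeffs[of h "poly (ev h w) (md h) (ev h z)"] poly ev_V md_V frame_P by simp

text \<open>The three coefficients determine a shift, so every circle is a quadratic function,
  though with additive operators \<open>Q x\<close> and \<open>M x\<close> still in place of
  multiplications.\<close>

lemma ev_eq_poly:
  "h \<in> shifts \<Longrightarrow> x \<in> P \<Longrightarrow> \<not> par x w \<Longrightarrow> ev h x = Q x (ev h w) \<oplus>\<^sub>F M x (md h) \<oplus>\<^sub>F ev h z"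
  using shift_poly[of h] poly(5)[of "ev h w" "md h" "ev h z" x] ev_V md_V frame_P by metis

lemma M_zero: "x \<in> P \<Longrightarrow> M x \<zero>\<^sub>F = \<zero>\<^sub>F"
  using M_add[of x "\<zero>\<^sub>F" "\<zero>\<^sub>F"] M_V[of x "\<zero>\<^sub>F"] by (simp add: V_closed group_simps)

lemma Q_zero: "x \<in> P \<Longrightarrow> Q x \<zero>\<^sub>F = \<zero>\<^sub>F"
  using Q_add[of x "\<zero>\<^sub>F" "\<zero>\<^sub>F"] Q_V[of x "\<zero>\<^sub>F"] by (simp add: V_closed group_simps)

lemma constant_zero:
  assumes "h \<in> shifts" "ev h w = \<zero>\<^sub>F" "md h = \<zero>\<^sub>F" "l \<in> P" "\<not> par l w" "ev h l = \<zero>\<^sub>F"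
  shows "h = id"
proof -
  have "ev h z = \<zero>\<^sub>F"
    using ev_eq_poly[OF assms(1,4,5)] assms M_zero Q_zero ev_V[OF assms(1) frame_P(2)]
    by (simp add: V_closed)
  moreover have "md id = \<zero>\<^sub>F" using md_cst[OF u_V] cst_u by simp
  ultimately show ?thesis
    using shift_eqI_coeffs[OF assms(1) shift_id] assms ev_id' frame_P by simp
qed

section \<open>Derivatives at finite abscissae\<close>

lemma shift_div:
  assumes "h \<in> shifts" "k \<in> shifts"
  obtains d where "d \<in> shifts" "h = d \<circ> k"
proof -
  obtain k' where k': "k' \<in> shifts" "k' \<circ> k = id" using shift_inv[OF assms(2)] by metis
  show ?thesis
    by (rule that[of "h \<circ> k'"])
      (use k' assms shift_comp in \<open>simp_all add: comp_assoc\<close>)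
qed

text \<open>In the classical model \<open>a (x - l)^2\<close>, the counterpart of \<open>sq\<close>
  for any generator other than that of \<open>w\<close>.\<close>

definition tl :: "'p \<Rightarrow> 'p \<Rightarrow> 'p \<Rightarrow> 'p" where
  "tl l a = (THE f. f \<in> elations l \<and> ev f w = a)"

lemma tl_eqI:
  assumes "l \<in> P" "\<not> par l w" "f \<in> elations l" "g \<in> elations l" "ev f w = ev g w"
  shows "f = g"
proof -
  have "f w = g w" using ev_eq_iff[of f g w] assms elation_shift frame_P by simp
  thus ?thesis using elation_eqI[of f l g w] assms frame_P par_sym by blast
qed

lemma tl:
  assumes "l \<in> P" "\<not> par l w" "a \<in> V"
  shows "tl l a \<in> elations l" "ev (tl l a) w = a"
proof -
  have s: "sq a w \<in> P" "par (sq a w) w" using shift_org[OF sq_shift[OF assms(3)] frame_P(1)] by simp_all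
  obtain f where f: "f \<in> elations l" "f w = sq a w"
    using elation_ex[of l w "sq a w"] assms frame_P par_sym s by metis
  have "ev f w = a"
    using ev_eq_iff[of f "sq a" w] f elation_shift sq_shift assms frame_P ev_sq_w by simp
  hence "\<exists>!f. f \<in> elations l \<and> ev f w = a" using f tl_eqI assms by metis
  from theI'[OF this] show "tl l a \<in> elations l" "ev (tl l a) w = a" unfolding tl_def by blast+
qed

text \<open>In the classical model \<open>dc l a = - 2 l a\<close>, and \<open>slope\<close> is the derivative at \<open>l\<close>.\<close>

definition dc :: "'p \<Rightarrow> 'p \<Rightarrow> 'p" where "dc l a = md (tl l a)"

definition slope :: "'p \<Rightarrow> ('p \<Rightarrow> 'p) \<Rightarrow> 'p" where
  "slope l h = md h -\<^sub>F dc l (ev h w)"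

lemma dc_V: "l \<in> P \<Longrightarrow> \<not> par l w \<Longrightarrow> a \<in> V \<Longrightarrow> dc l a \<in> V"
  unfolding dc_def using md_V tl(1) elation_shift by blast

lemma dc_add:
  assumes l: "l \<in> P" "\<not> par l w" and V: "a \<in> V" "b \<in> V"
  shows "dc l (a \<oplus>\<^sub>F b) = dc l a \<oplus>\<^sub>F dc l b"
proof -
  note t = tl[OF l V(1)] tl[OF l V(2)]
  note s = elation_shift[OF t(1) l(1)] elation_shift[OF t(3) l(1)]
  have ab: "a \<oplus>\<^sub>F b \<in> V" using V V_closed by blast
  have "tl l (a \<oplus>\<^sub>F b) = tl l a \<circ> tl l b"
    by (rule tl_eqI[OF l]) (use t s tl[OF l ab] elation_comp l ev_comp' frame_P in auto)
  thus ?thesis unfolding dc_def using md_comp s by simp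
qed

lemma dc_zero: "l \<in> P \<Longrightarrow> \<not> par l w \<Longrightarrow> dc l \<zero>\<^sub>F = \<zero>\<^sub>F"
  using dc_add[of l "\<zero>\<^sub>F" "\<zero>\<^sub>F"] dc_V[of l "\<zero>\<^sub>F"] by (simp add: V_closed group_simps)

lemma dc_z: "a \<in> V \<Longrightarrow> dc z a = \<zero>\<^sub>F"
  unfolding dc_def
  using tl_eqI[of z "tl z a" "sq a"] tl[of z a] sq[of a] ev_sq_w[of a] md_sq[of a] frame_P frame_npar
  by simp

lemma slope_V: "l \<in> P \<Longrightarrow> \<not> par l w \<Longrightarrow> h \<in> shifts \<Longrightarrow> slope l h \<in> V"
  unfolding slope_def using dc_V md_V ev_V frame_P V_closed by simp

lemma slope_comp:
  "l \<in> P \<Longrightarrow> \<not> par l w \<Longrightarrow> h \<in> shifts \<Longrightarrow> k \<in> shifts \<Longrightarrow> slope l (h \<circ> k) = slope l h \<oplus>\<^sub>F slope l k"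
  unfolding slope_def using ev_V md_V frame_P dc_V
  by (simp add: ev_comp' md_comp dc_add group_simps)

text \<open>Dividing by the elation on \<open>l\<close> with the same leading coefficient leaves, if
  the slope is zero, a constant that vanishes at \<open>l\<close>.\<close>

lemma elation_iff_slope:
  assumes h: "h \<in> shifts" and l: "l \<in> P" "\<not> par l w" and van: "ev h l = \<zero>\<^sub>F"
  shows "h \<in> elations l \<longleftrightarrow> slope l h = \<zero>\<^sub>F"
proof
  assume hl: "h \<in> elations l"
  have V: "ev h w \<in> V" using ev_V h frame_P by blast
  have "tl l (ev h w) = h" using tl_eqI[OF l _ hl] tl[OF l V] by simp
  thus "slope l h = \<zero>\<^sub>F" unfolding slope_def dc_def using md_V[OF h] by (simp add: group_simps)
next
  assume s: "slope l h = \<zero>\<^sub>F"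
  have V: "ev h w \<in> V" using ev_V h frame_P by blast
  note t = tl[OF l V]
  note ts = elation_shift[OF t(1) l(1)]
  obtain d where d: "d \<in> shifts" "h = d \<circ> tl l (ev h w)" using shift_div[OF h ts] by metis
  have tv: "ev (tl l (ev h w)) l = \<zero>\<^sub>F" using ev_fix_iff' elation_org t ts l by simp
  have Vs: "ev d w \<in> V" "md d \<in> V" "ev d l \<in> V" "md h \<in> V" "dc l (ev h w) \<in> V"
    using ev_V md_V d h l frame_P dc_V V by blast+
  have "ev h w = ev d w \<oplus>\<^sub>F ev (tl l (ev h w)) w"
    using arg_cong[OF d(2), of "\<lambda>f. ev f w"] ev_comp'[OF d(1) ts frame_P(1)] by simp
  hence "ev h w = ev d w \<oplus>\<^sub>F ev h w" using t(2) by simp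
  hence 1: "ev d w = \<zero>\<^sub>F" using V Vs by (simp add: V_closed)
  have "md h = md d \<oplus>\<^sub>F dc l (ev h w)"
    using arg_cong[OF d(2), of md] md_comp[OF d(1) ts] unfolding dc_def by simp
  moreover have "md h = dc l (ev h w)" using s diff_zero_iff Vs unfolding slope_def by simp
  ultimately have 2: "md d = \<zero>\<^sub>F" using Vs by (simp add: V_closed)
  have "ev h l = ev d l \<oplus>\<^sub>F ev (tl l (ev h w)) l"
    using arg_cong[OF d(2), of "\<lambda>f. ev f l"] ev_comp'[OF d(1) ts l(1)] by simp
  hence 3: "ev d l = \<zero>\<^sub>F" using van tv Vs by (simp add: V_closed)
  have "d = id" using constant_zero[OF d(1) 1 2 l 3] .
  hence "h = tl l (ev h w)" using d(2) by simp
  thus "h \<in> elations l" using t(1) by simp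
qed

text \<open>Shifts are commuting automorphisms, so contact depends only on the difference of two
  functions.\<close>

lemma touch_iff_elation:
  assumes "d \<in> shifts" "k \<in> shifts" "l \<in> P"
  shows "touch l (k ` B) ((d \<circ> k) ` B) \<longleftrightarrow> d \<in> elations l"
proof -
  have "(d \<circ> k) ` B = k ` d ` B" using shift_commute[OF assms(1,2)] by (simp add: image_comp)
  thus ?thesis
    using shift_touch[OF assms(2) B shiftD(4)[OF assms(1) B]] elation_iff_touch[OF assms(1,3)] by simp
qed

lemma touch_iff_slope:
  assumes h: "h \<in> shifts" "k \<in> shifts" and l: "l \<in> P" "\<not> par l w" and eq: "ev h l = ev k l"
  shows "touch l (k ` B) (h ` B) \<longleftrightarrow> slope l h = slope l k"
proof -
  obtain d where d: "d \<in> shifts" "h = d \<circ> k" using shift_div h by metis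
  have V: "ev d l \<in> V" "ev k l \<in> V" "slope l d \<in> V" "slope l k \<in> V"
    using ev_V slope_V d h l by blast+
  have "ev k l = ev d l \<oplus>\<^sub>F ev k l" using eq d ev_comp' h l by simp
  hence van: "ev d l = \<zero>\<^sub>F" using V by (simp add: V_closed)
  have "slope l h = slope l k \<longleftrightarrow> slope l d = \<zero>\<^sub>F"
    using d slope_comp h l V by (simp add: V_closed)
  thus ?thesis using elation_iff_slope[OF d(1) l van] touch_iff_elation d h l by simp
qed

text \<open>Replaces the slope criterion on \<open>w\<close>: functions with equal leading and
  middle coefficients differ by a constant, and constants are the elations on
  \<open>w\<close>.\<close>

lemma touch_w:
  assumes h: "h \<in> shifts" "k \<in> shifts" and eq: "ev h w = ev k w" "md h = md k"
  shows "touch w (k ` B) (h ` B)"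
proof -
  obtain d where d: "d \<in> shifts" "h = d \<circ> k" using shift_div h by metis
  have V: "ev d w \<in> V" "ev k w \<in> V" "md d \<in> V" "md k \<in> V" "ev d z \<in> V"
    using ev_V md_V d h frame_P by blast+
  have "ev d w = \<zero>\<^sub>F" "md d = \<zero>\<^sub>F"
    using eq d ev_comp' md_comp h frame_P V by (simp_all add: V_closed)
  hence "d = cst (ev d z)"
    using shift_eqI_coeffs[OF d(1) cst_shift[OF V(5)]] V ev_cst_w md_cst ev_cst frame_P frame_npar
    by simp
  hence "d \<in> elations w" using cst(1) V by metis
  thus ?thesis using touch_iff_elation d h frame_P by simp
qed

subsection \<open>Slopes and multiplication\<close>


lemma no_common_zero:
  assumes h: "h \<in> shifts" and P: "x \<in> P" "y \<in> P" "t \<in> P"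
    and np: "\<not> par x y" "\<not> par x t" "\<not> par y t"
    and v: "ev h x = \<zero>\<^sub>F" "ev h y = \<zero>\<^sub>F" "ev h t = \<zero>\<^sub>F"
  shows "h = id"
  using shift_eqI3[OF h shift_id P np] v ev_fix_iff'[OF h] P by simp

lemma slope_lin: "l \<in> P \<Longrightarrow> \<not> par l w \<Longrightarrow> h \<in> shifts \<Longrightarrow> ev h w = \<zero>\<^sub>F \<Longrightarrow> slope l h = md h"
  unfolding slope_def using dc_zero md_V[of h] by (simp add: group_simps)

lemma line_ex:
  assumes "k \<in> P" "\<not> par k w" "s \<in> V"
  obtains h where "h \<in> shifts" "ev h w = \<zero>\<^sub>F" "ev h k = \<zero>\<^sub>F" "md h = s"
proof -
  have V: "M k s \<in> V" "\<ominus>\<^sub>F M k s \<in> V" using M_V assms by (simp_all add: V_closed)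
  have 0: "\<zero>\<^sub>F \<in> V" using V_closed(4) .
  note p = poly[OF 0 assms(3) V(2)]
  have "ev (poly \<zero>\<^sub>F s (\<ominus>\<^sub>F M k s)) k = \<zero>\<^sub>F"
    using p(5)[OF assms(1,2)] Q_zero[OF assms(1)] V by (simp add: group_simps)
  thus ?thesis using that p by blast
qed

text \<open>The line with zero at \<open>k\<close> and slope \<open>s\<close> fixes a pencil on
  \<open>k\<close>; the required function is the member of that pencil through the point of
  \<open>B\<close> on \<open>l\<close>.\<close>

lemma secant_ex:
  assumes P: "k \<in> P" "l \<in> P" and np: "\<not> par k w" "\<not> par l w" "\<not> par k l" and s: "s \<in> V"
  obtains h where "h \<in> shifts" "ev h k = \<zero>\<^sub>F" "ev h l = \<zero>\<^sub>F" "slope k h = s"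
proof -
  obtain g where g: "g \<in> shifts" "ev g w = \<zero>\<^sub>F" "ev g k = \<zero>\<^sub>F" "md g = s"
    using line_ex P np s by metis
  have "\<not> par (org l) k" using org_npar P np par_sym by blast
  then obtain L where L: "L \<in> C" "touch k (g ` B) L" "org l \<in> L"
    using touch_ex[OF shiftD(4)[OF g(1) B] P(1) org_P[OF P(2)]] by metis
  obtain h where h: "h \<in> shifts" "h ` B = L" using shift_ex[OF B L(1)] by metis
  have "h (org l) = org l"
    using shift_org(3)[OF h(1) P(2)] h L proj_eqI org_par P by metis
  hence hl: "ev h l = \<zero>\<^sub>F" using ev_fix_iff'[OF h(1) P(2)] by simp
  have "h (org k) = g (org k)"
    using touch_proj[OF L(2) P(1)] h shift_org(3)[OF h(1) P(1)] shift_org(3)[OF g(1) P(1)] by simp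
  hence "ev h k = ev g k" using ev_eq_iff h g P by blast
  hence "slope k h = slope k g" using touch_iff_slope[OF h(1) g(1) P(1) np(1)] L h by simp
  thus ?thesis using that[OF h(1) _ hl] slope_lin[OF P(1) np(1) g(1,2)] g \<open>ev h k = ev g k\<close> by simp
qed

lemma secant_eqI:
  assumes P: "k \<in> P" "l \<in> P" and np: "\<not> par k w" "\<not> par l w" "\<not> par k l"
    and f: "f \<in> shifts" "ev f k = \<zero>\<^sub>F" "ev f l = \<zero>\<^sub>F"
    and g: "g \<in> shifts" "ev g k = \<zero>\<^sub>F" "ev g l = \<zero>\<^sub>F" and eq: "slope k f = slope k g"
  shows "f = g"
proof (rule shift_eqI[OF f(1) g(1) B])
  have "touch k (g ` B) (f ` B)" using touch_iff_slope[OF f(1) g(1) P(1) np(1)] f g eq by simp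
  moreover have "proj (g ` B) l = proj (f ` B) l"
    using shift_org(3)[OF _ P(2)] f g ev_fix_iff'[OF _ P(2)] by simp
  ultimately show "f ` B = g ` B" using touch_eqI P np par_sym by blast
qed

lemma slope_id: "l \<in> P \<Longrightarrow> \<not> par l w \<Longrightarrow> slope l id = \<zero>\<^sub>F"
  using elation_iff_slope[OF shift_id] elation_id ev_id' by blast

text \<open>The contact quadrangle through \<open>w, k, l, i\<close>: two lines of equal slope and the circles
  \<open>f\<close> and \<open>r\<close>.\<close>

lemma slope_step:
  assumes P: "k \<in> P" "l \<in> P" "i \<in> P"
    and np: "\<not> par k w" "\<not> par l w" "\<not> par i w" "\<not> par k l" "\<not> par k i" "\<not> par l i"
    and f: "f \<in> shifts" "ev f k = \<zero>\<^sub>F" "ev f l = \<zero>\<^sub>F"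
    and r: "r \<in> shifts" "ev r l = \<zero>\<^sub>F" "ev r i = \<zero>\<^sub>F"
    and eq: "slope l f = slope l r"
  shows "slope i r = slope k f"
proof (cases "f = id")
  case True
  have "slope l r = \<zero>\<^sub>F" using eq True slope_id P np by simp
  hence "r = id"
    using secant_eqI[OF P(2,3) np(2,3,6) r shift_id] ev_id' P slope_id np by simp
  thus ?thesis using True slope_id P np by simp
next
  case False
  define s where "s = slope k f"
  have s: "s \<in> V" unfolding s_def using slope_V P np f by blast
  obtain X where X: "X \<in> shifts" "ev X w = \<zero>\<^sub>F" "ev X k = \<zero>\<^sub>F" "md X = s"
    using line_ex P np s by metis
  obtain Y where Y: "Y \<in> shifts" "ev Y w = \<zero>\<^sub>F" "ev Y i = \<zero>\<^sub>F" "md Y = s"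
    using line_ex P np s by metis
  have pr: "proj (h ` B) x = org x" if "h \<in> shifts" "x \<in> P" "ev h x = \<zero>\<^sub>F" for h x
    using that shift_org(3) ev_fix_iff' by simp
  have "touch i (r ` B) (Y ` B)"
  \<comment> \<open>\<open>B\<close> carries the four contact points, since the functions vanish
    there. The two lines touch on \<open>w\<close> because their middle coefficients agree.\<close>
  proof (rule S_closing[of B "Y ` B" "X ` B" "f ` B" "r ` B" w k l i])
    show "touch w (Y ` B) (X ` B)" using touch_w X Y by simp
    show "touch k (X ` B) (f ` B)"
      using touch_iff_slope[OF f(1) X(1) P(1) np(1)] f X slope_lin[OF P(1) np(1)] s_def by simp
    show "touch l (f ` B) (r ` B)"
      using touch_iff_slope[OF r(1) f(1) P(2) np(2)] f r eq by simp
    show "f ` B \<noteq> B"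
    proof
      assume "f ` B = B"
      hence "f = id" using shift_eqI[OF f(1) shift_id B] by simp
      thus False using False by simp
    qed
    show "\<not> par w k" "\<not> par w l" "\<not> par w i" using P np frame_P par_sym by blast+
  qed (use pr X Y f r P np frame_P B shiftD(4) in \<open>simp_all\<close>)
  hence "slope i Y = slope i r"
    using touch_iff_slope[OF Y(1) r(1) P(3) np(3)] Y r by simp
  thus ?thesis using slope_lin[OF P(3) np(3) Y(1,2)] Y s_def by simp
qed

text \<open>If the middle coefficients agreed, \<open>a (x - k)^2\<close> and
  \<open>a (x - l)^2\<close> would touch on \<open>w\<close> and form with \<open>B\<close> a
  triangle with contacts on \<open>k\<close>, \<open>w\<close> and \<open>l\<close>. In the
  classical model the claim is that \<open>2 (k - l)\<close> is not a zero divisor.\<close>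

lemma dc_inj:
  assumes P: "k \<in> P" "l \<in> P" and np: "\<not> par k w" "\<not> par l w" "\<not> par k l"
    and a: "a \<in> V" "dc k a = dc l a"
  shows "a = \<zero>\<^sub>F"
proof -
  note t = tl[OF P(1) np(1) a(1)] tl[OF P(2) np(2) a(1)]
  note s = elation_shift[OF t(1) P(1)] elation_shift[OF t(3) P(2)]
  have c: "tl k a ` B \<in> C" "tl l a ` B \<in> C" using shiftD(4) s B by blast+
  have "touch w (tl k a ` B) (tl l a ` B)"
    by (rule touch_w) (use s t a in \<open>simp_all add: dc_def\<close>)
  moreover have "touch k B (tl k a ` B)" "touch l (tl l a ` B) B"
    using elationD(5)[OF _ B] t touch_sym by blast+
  ultimately have "B = tl k a ` B"
    using no_triangle[of B "tl k a ` B" "tl l a ` B" k w l] c B P frame_P np par_sym by blast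
  hence "tl k a = id" using shift_eqI[OF s(1) shift_id B] by simp
  thus ?thesis using t ev_id' frame_P by simp
qed

text \<open>Equal slopes make \<open>dc k\<close> and \<open>dc l\<close> agree on the leading
  coefficient, which is then zero by \<open>dc_inj\<close>; so \<open>k\<close>, \<open>l\<close>
  and \<open>w\<close> are three zeros.\<close>

lemma secant_slope_eq_id:
  assumes P: "k \<in> P" "l \<in> P" and np: "\<not> par k w" "\<not> par l w" "\<not> par k l"
    and f: "f \<in> shifts" "ev f k = \<zero>\<^sub>F" "ev f l = \<zero>\<^sub>F" and eq: "slope k f = slope l f"
  shows "f = id"
proof -
  have V: "ev f w \<in> V" "md f \<in> V" "dc k (ev f w) \<in> V" "dc l (ev f w) \<in> V"
    using ev_V md_V dc_V P np f frame_P by blast+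
  have "dc k (ev f w) = dc l (ev f w)"
    using eq V unfolding slope_def F.minus_eq
    by (metis F.add.inv_closed F.add.right_cancel F.a_comm F.minus_minus F_simps(1))
  hence "ev f w = \<zero>\<^sub>F" using dc_inj P np V by blast
  thus ?thesis using no_common_zero[of f k l w] f P np frame_P by blast
qed

text \<open>Three applications of \<open>slope_step\<close> around a triangle show that the map from the slope at
  \<open>k\<close> to the slope at \<open>l\<close> is an involution; adding \<open>f\<close> to its mirror image then gives a circle
  with equal slopes at its two zeros.\<close>

lemma secant_slope:
  assumes P: "k \<in> P" "l \<in> P" and np: "\<not> par k w" "\<not> par l w" "\<not> par k l"
    and f: "f \<in> shifts" "ev f k = \<zero>\<^sub>F" "ev f l = \<zero>\<^sub>F"
  shows "slope l f = \<ominus>\<^sub>F slope k f"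
proof -
  obtain i where i: "i \<in> P" "\<not> par i w" "\<not> par i k" "\<not> par i l"
    using fourth_generator frame_P P by metis
  have np': "\<not> par l k" "\<not> par k i" "\<not> par l i" using P np i par_sym by blast+
  have V: "slope k f \<in> V" "slope l f \<in> V" using slope_V P np f by blast+
  \<comment> \<open>If \<open>f\<close> has the slopes \<open>p\<close> at \<open>k\<close> and
    \<open>q\<close> at \<open>l\<close>, then \<open>r\<close> has \<open>q\<close> at
    \<open>l\<close> and \<open>p\<close> at \<open>i\<close>, the next function has
    \<open>p\<close> at \<open>i\<close> and \<open>q\<close> at \<open>k\<close>, and
    \<open>g\<close> has \<open>q\<close> at \<open>k\<close> and \<open>p\<close> at
    \<open>l\<close>.\<close>
  obtain r where r: "r \<in> shifts" "ev r l = \<zero>\<^sub>F" "ev r i = \<zero>\<^sub>F" "slope l r = slope l f"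
    using secant_ex[OF P(2) i(1) np(2) i(2) np'(3) V(2)] by metis
  have 1: "slope i r = slope k f"
    using slope_step[OF P i(1) np(1,2) i(2) np(3) np'(2,3) f r(1-3)] r by simp
  obtain q where q: "q \<in> shifts" "ev q i = \<zero>\<^sub>F" "ev q k = \<zero>\<^sub>F" "slope i q = slope i r"
    using secant_ex[OF i(1) P(1) i(2) np(1) i(3), of "slope i r"] 1 V by metis
  have 2: "slope k q = slope l r"
    using slope_step[OF P(2) i(1) P(1) np(2) i(2) np(1) np'(3,1) i(3) r(1-3) q(1-3)] q by simp
  obtain g where g: "g \<in> shifts" "ev g k = \<zero>\<^sub>F" "ev g l = \<zero>\<^sub>F" "slope k g = slope k q"
    using secant_ex[OF P np, of "slope k q"] 2 r V by metis
  have 3: "slope l g = slope i q"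
    using slope_step[OF i(1) P i(2) np(1,2) i(3,4) np(3) q(1-3) g(1-3)] g by simp
  have h: "f \<circ> g \<in> shifts" "ev (f \<circ> g) k = \<zero>\<^sub>F" "ev (f \<circ> g) l = \<zero>\<^sub>F"
    using shift_comp f g ev_comp' P by (simp_all add: V_closed)
  have "slope k (f \<circ> g) = slope l (f \<circ> g)"
    using slope_comp[OF _ _ f(1) g(1)] P np 1 2 3 g q r V by (simp add: F.a_ac)
  hence "f \<circ> g = id" using secant_slope_eq_id[OF P np h] by blast
  hence "slope k f \<oplus>\<^sub>F slope l f = \<zero>\<^sub>F"
    using slope_comp[OF P(1) np(1) f(1) g(1)] slope_id P np g 2 r by simp
  thus ?thesis using F.add.inv_equality[of "slope l f" "slope k f"] V F.a_comm by simp
qed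

text \<open>A function with zeros at \<open>z\<close> and \<open>u\<close> and slope
  \<open>v\<close> at \<open>z\<close> has slope \<open>- v = v\<close> at \<open>u\<close>, so it
  is zero. Applied to \<open>e\<close>, this excludes characteristic 2.\<close>

lemma no_2_torsion:
  assumes "v \<in> V" "v \<oplus>\<^sub>F v = \<zero>\<^sub>F"
  shows "v = \<zero>\<^sub>F"
proof -
  obtain f where f: "f \<in> shifts" "ev f z = \<zero>\<^sub>F" "ev f u = \<zero>\<^sub>F" "slope z f = v"
    using secant_ex[OF frame_P(2,3) frame_npar(2,4,5) assms(1)] by metis
  have "slope u f = \<ominus>\<^sub>F v"
    using secant_slope[OF frame_P(2,3) frame_npar(2,4,5) f(1-3)] f by simp
  also have "\<ominus>\<^sub>F v = v" using F.add.inv_equality[of v v] assms by simp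
  finally have "f = id"
    using secant_slope_eq_id[OF frame_P(2,3) frame_npar(2,4,5) f(1-3)] f by simp
  thus ?thesis using f slope_id frame_P frame_npar by simp
qed

lemma secant_md:
  assumes P: "k \<in> P" "l \<in> P" and np: "\<not> par k w" "\<not> par l w" "\<not> par k l"
    and f: "f \<in> shifts" "ev f k = \<zero>\<^sub>F" "ev f l = \<zero>\<^sub>F"
  shows "md f \<oplus>\<^sub>F md f = dc k (ev f w) \<oplus>\<^sub>F dc l (ev f w)"
proof -
  have V: "ev f w \<in> V" "md f \<in> V" "dc k (ev f w) \<in> V" "dc l (ev f w) \<in> V"
    using ev_V md_V dc_V P np f frame_P by blast+
  have "md f -\<^sub>F dc l (ev f w) = \<ominus>\<^sub>F (md f -\<^sub>F dc k (ev f w))"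
    using secant_slope[OF P np f] unfolding slope_def by simp
  hence "md f = \<ominus>\<^sub>F (md f -\<^sub>F dc k (ev f w)) \<oplus>\<^sub>F dc l (ev f w)"
    using diff_eq_iff[OF V(2,4), of "\<ominus>\<^sub>F (md f -\<^sub>F dc k (ev f w))"] V by (simp add: V_closed)
  hence "md f \<oplus>\<^sub>F md f = md f \<oplus>\<^sub>F (\<ominus>\<^sub>F (md f -\<^sub>F dc k (ev f w)) \<oplus>\<^sub>F dc l (ev f w))" by simp
  also have "\<dots> = dc k (ev f w) \<oplus>\<^sub>F dc l (ev f w)" using V by (simp add: group_simps)
  finally show ?thesis .
qed

section \<open>Quadratics with given zeros and commuting multiplications\<close>

lemma parabola_ex:
  assumes P: "k \<in> P" "l \<in> P" and np: "\<not> par k w" "\<not> par l w" "\<not> par k l" and a: "a \<in> V"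
  obtains h where "h \<in> shifts" "ev h k = \<zero>\<^sub>F" "ev h l = \<zero>\<^sub>F" "ev h w = a"
proof -
  have s: "sq a w \<in> P" "par (sq a w) w" using shift_org[OF sq_shift[OF a] frame_P(1)] by simp_all
  obtain h where h: "h \<in> shifts" "h (org k) = org k" "h (org l) = org l" "h (org w) = sq a w"
    using shift_ex3[OF P frame_P(1) np(3,1,2) org_P[OF P(1)] org_par(1)[OF P(1)] org_P[OF P(2)]
        org_par(1)[OF P(2)] s] by metis
  have "ev h w = ev (sq a) w" using ev_eq_iff[OF h(1) sq_shift[OF a] frame_P(1)] h by simp
  thus ?thesis using that[OF h(1)] ev_fix_iff'[OF h(1)] P h ev_sq_w[OF a] by simp
qed

text \<open>\<open>secant_md\<close> gives the claim doubled: as \<open>dc z\<close> vanishes, twice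
  the coefficients of \<open>g\<close> and \<open>h\<close> are \<open>dc k\<close> and
  \<open>dc l\<close> of the common leading coefficient. \<open>no_2_torsion\<close> removes the
  factor.\<close>

lemma secant_zero_md:
  assumes P: "k \<in> P" "l \<in> P" and np: "\<not> par k w" "\<not> par l w" "\<not> par k l" "\<not> par k z" "\<not> par l z"
    and f: "f \<in> shifts" "ev f k = \<zero>\<^sub>F" "ev f l = \<zero>\<^sub>F"
    and g: "g \<in> shifts" "ev g z = \<zero>\<^sub>F" "ev g k = \<zero>\<^sub>F" "ev g w = ev f w"
    and h: "h \<in> shifts" "ev h z = \<zero>\<^sub>F" "ev h l = \<zero>\<^sub>F" "ev h w = ev f w"
  shows "md f = md g \<oplus>\<^sub>F md h"
proof -
  have V: "ev f w \<in> V" "md f \<in> V" "md g \<in> V" "md h \<in> V" "dc k (ev f w) \<in> V" "dc l (ev f w) \<in> V"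
    using ev_V md_V dc_V P np f g h frame_P by blast+
  have npz: "\<not> par z k" "\<not> par z l" using P np frame_P par_sym by blast+
  have gg: "md g \<oplus>\<^sub>F md g = dc k (ev f w)"
    using secant_md[OF frame_P(2) P(1) frame_npar(2) np(1) npz(1) g(1-3)] dc_z V g by (simp add: V_closed)
  have hh: "md h \<oplus>\<^sub>F md h = dc l (ev f w)"
    using secant_md[OF frame_P(2) P(2) frame_npar(2) np(2) npz(2) h(1-3)] dc_z V h by (simp add: V_closed)
  have "(md f -\<^sub>F (md g \<oplus>\<^sub>F md h)) \<oplus>\<^sub>F (md f -\<^sub>F (md g \<oplus>\<^sub>F md h)) =
      (md f \<oplus>\<^sub>F md f) -\<^sub>F ((md g \<oplus>\<^sub>F md g) \<oplus>\<^sub>F (md h \<oplus>\<^sub>F md h))"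
    using V by (simp add: group_simps)
  also have "\<dots> = \<zero>\<^sub>F" using gg hh secant_md[OF P np(1-3) f] V by (simp add: group_simps)
  finally have 0: "(md f -\<^sub>F (md g \<oplus>\<^sub>F md h)) \<oplus>\<^sub>F (md f -\<^sub>F (md g \<oplus>\<^sub>F md h)) = \<zero>\<^sub>F" .
  have "md f -\<^sub>F (md g \<oplus>\<^sub>F md h) = \<zero>\<^sub>F"
    by (rule no_2_torsion[OF _ 0]) (use V in \<open>simp add: V_closed\<close>)
  thus ?thesis using diff_zero_iff V by (simp add: V_closed)
qed

text \<open>The coefficient of \<open>x\<close> in \<open>a x (x - l)\<close> is \<open>nc l a\<close>.\<close>

definition nc :: "'p \<Rightarrow> 'p \<Rightarrow> 'p" where
  "nc l a = md (SOME h. h \<in> shifts \<and> ev h z = \<zero>\<^sub>F \<and> ev h l = \<zero>\<^sub>F \<and> ev h w = a)"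

lemma nc_ex:
  assumes l: "l \<in> P" "\<not> par l w" "\<not> par l z" and a: "a \<in> V"
  obtains h where "h \<in> shifts" "ev h z = \<zero>\<^sub>F" "ev h l = \<zero>\<^sub>F" "ev h w = a" "nc l a = md h"
proof -
  have "\<not> par z l" using l frame_P par_sym by blast
  hence "\<exists>h. h \<in> shifts \<and> ev h z = \<zero>\<^sub>F \<and> ev h l = \<zero>\<^sub>F \<and> ev h w = a"
    using parabola_ex[OF frame_P(2) l(1) frame_npar(2) l(2) _ a] by metis
  from someI_ex[OF this] show ?thesis using that unfolding nc_def by blast
qed

lemma Q_nc:
  assumes l: "l \<in> P" "\<not> par l w" "\<not> par l z" and a: "a \<in> V"
  shows "nc l a \<in> V" "Q l a \<oplus>\<^sub>F M l (nc l a) = \<zero>\<^sub>F"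
proof -
  obtain h where h: "h \<in> shifts" "ev h z = \<zero>\<^sub>F" "ev h l = \<zero>\<^sub>F" "ev h w = a" "nc l a = md h"
    using nc_ex[OF assms] by metis
  show "nc l a \<in> V" using h md_V by simp
  thus "Q l a \<oplus>\<^sub>F M l (nc l a) = \<zero>\<^sub>F"
    using ev_eq_poly[OF h(1) l(1,2)] h l a M_V Q_V by (simp add: V_closed)
qed

text \<open>Evaluate \<open>f = a (x - k) (x - l)\<close> at its zeros. At \<open>k\<close> the part
  \<open>a x (x - k)\<close> drops out, at \<open>l\<close> the part \<open>a x (x - l)\<close>; so
  both sides equal the negative of the constant term of \<open>f\<close>.\<close>

lemma M_nc_commute:
  assumes P: "k \<in> P" "l \<in> P" and np: "\<not> par k w" "\<not> par l w" "\<not> par k l" "\<not> par k z" "\<not> par l z"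
    and a: "a \<in> V"
  shows "M k (nc l a) = M l (nc k a)"
proof -
  obtain g where g: "g \<in> shifts" "ev g z = \<zero>\<^sub>F" "ev g k = \<zero>\<^sub>F" "ev g w = a" "nc k a = md g"
    using nc_ex[OF P(1) np(1,4) a] by metis
  obtain h where h: "h \<in> shifts" "ev h z = \<zero>\<^sub>F" "ev h l = \<zero>\<^sub>F" "ev h w = a" "nc l a = md h"
    using nc_ex[OF P(2) np(2,5) a] by metis
  obtain f where f: "f \<in> shifts" "ev f k = \<zero>\<^sub>F" "ev f l = \<zero>\<^sub>F" "ev f w = a"
    using parabola_ex[OF P np(1-3) a] by metis
  have md: "md f = nc k a \<oplus>\<^sub>F nc l a"
    using secant_zero_md[OF P np f(1-3) g(1-3) _ h(1-3)] f g h by simp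
  note q = Q_nc[OF P(1) np(1,4) a] Q_nc[OF P(2) np(2,5) a]
  have V: "Q k a \<in> V" "Q l a \<in> V" "M k (nc k a) \<in> V" "M k (nc l a) \<in> V" "M l (nc k a) \<in> V"
     "M l (nc l a) \<in> V" "ev f z \<in> V"
    using q P a M_V Q_V ev_V f frame_P by simp_all
  have "\<zero>\<^sub>F = Q k a \<oplus>\<^sub>F (M k (nc k a) \<oplus>\<^sub>F M k (nc l a)) \<oplus>\<^sub>F ev f z"
    using ev_eq_poly[OF f(1) P(1) np(1)] f md M_add P q by simp
  also have "\<dots> = (Q k a \<oplus>\<^sub>F M k (nc k a)) \<oplus>\<^sub>F (M k (nc l a) \<oplus>\<^sub>F ev f z)" using V by (simp add: F.a_ac V_closed)
  finally have 1: "M k (nc l a) \<oplus>\<^sub>F ev f z = \<zero>\<^sub>F" using q V by (simp add: V_closed)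
  have "\<zero>\<^sub>F = Q l a \<oplus>\<^sub>F (M l (nc k a) \<oplus>\<^sub>F M l (nc l a)) \<oplus>\<^sub>F ev f z"
    using ev_eq_poly[OF f(1) P(2) np(2)] f md M_add P q by simp
  also have "\<dots> = (Q l a \<oplus>\<^sub>F M l (nc l a)) \<oplus>\<^sub>F (M l (nc k a) \<oplus>\<^sub>F ev f z)" using V by (simp add: F.a_ac V_closed)
  finally have 2: "M l (nc k a) \<oplus>\<^sub>F ev f z = \<zero>\<^sub>F" using q V by (simp add: V_closed)
  show ?thesis using 1 2 V F.add.right_cancel[of "ev f z" "M k (nc l a)" "M l (nc k a)"] by simp
qed

lemma M_u: "t \<in> V \<Longrightarrow> M u t = t"
  by (simp add: M_def ev_lin)

lemma M_z: "t \<in> V \<Longrightarrow> M z t = \<zero>\<^sub>F"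
  by (simp add: M_def ev_lin)

lemma M_cong: "x \<in> P \<Longrightarrow> y \<in> P \<Longrightarrow> par x y \<Longrightarrow> M x t = M y t"
  unfolding M_def by (rule ev_cong)

lemma Q_cong: "x \<in> P \<Longrightarrow> y \<in> P \<Longrightarrow> par x y \<Longrightarrow> Q x t = Q y t"
  unfolding Q_def by (rule ev_cong)

lemma M_uminus:
  assumes "x \<in> P" "t \<in> V" shows "M x (\<ominus>\<^sub>F t) = \<ominus>\<^sub>F M x t"
proof -
  have V: "\<ominus>\<^sub>F t \<in> V" "M x t \<in> V" "M x (\<ominus>\<^sub>F t) \<in> V" using assms M_V by (simp_all add: V_closed)
  have "M x (\<ominus>\<^sub>F t) \<oplus>\<^sub>F M x t = M x (\<ominus>\<^sub>F t \<oplus>\<^sub>F t)" using M_add assms V by simp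
  also have "\<dots> = \<zero>\<^sub>F" using assms M_zero by (simp add: group_simps)
  finally show ?thesis using F.add.inv_equality V by simp
qed

text \<open>Take \<open>u\<close> as one of the zeros in \<open>M_nc_commute\<close>: its abscissa
  is 1, so \<open>M u\<close> is the identity and \<open>nc u a\<close> is
  \<open>- a\<close>.\<close>

lemma nc_eq:
  assumes l: "l \<in> P" "\<not> par l w" "\<not> par l z" and a: "a \<in> V"
  shows "nc l a = \<ominus>\<^sub>F M l a"
proof -
  have nu: "nc u a = \<ominus>\<^sub>F a"
    using Q_nc[OF frame_P(3) frame_npar(4,6) a] M_u a ev_sq_u F.add.inv_equality[of "nc u a" a] F.a_comm
    by (simp add: Q_def)
  show ?thesis
  proof (cases "par l u")
    case True
    obtain h where h: "h \<in> shifts" "ev h z = \<zero>\<^sub>F" "ev h l = \<zero>\<^sub>F" "ev h w = a" "nc l a = md h"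
      using nc_ex[OF assms] by metis
    have "Q l a \<oplus>\<^sub>F M l (nc l a) = \<zero>\<^sub>F" "nc l a \<in> V" using Q_nc[OF assms] by blast+
    hence "a \<oplus>\<^sub>F nc l a = \<zero>\<^sub>F"
      using M_cong[OF l(1) frame_P(3) True] Q_cong[OF l(1) frame_P(3) True] M_u ev_sq_u a
      by (simp add: Q_def)
    hence "nc l a = \<ominus>\<^sub>F a"
      using F.add.inv_equality[of "nc l a" a] \<open>nc l a \<in> V\<close> a F.a_comm by simp
    thus ?thesis using M_cong[OF l(1) frame_P(3) True] M_u a by simp
  next
    case False
    have "M l (nc u a) = M u (nc l a)"
      using M_nc_commute[OF l(1) frame_P(3) l(2) frame_npar(4) False l(3) frame_npar(6) a] .
    thus ?thesis using nu M_u Q_nc[OF assms] M_uminus l a by simp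
  qed
qed

lemma Q_eq:
  assumes "l \<in> P" "\<not> par l w" "a \<in> V"
  shows "Q l a = M l (M l a)"
proof (cases "par l z")
  case True
  have "Q l a = \<zero>\<^sub>F" using Q_cong[OF assms(1) frame_P(2) True] ev_sq_z assms by (simp add: Q_def)
  moreover have "M l a = \<zero>\<^sub>F" using M_cong[OF assms(1) frame_P(2) True] M_z assms by simp
  ultimately show ?thesis using M_zero assms by simp
next
  case False
  have V: "M l a \<in> V" "M l (M l a) \<in> V" "Q l a \<in> V" using M_V Q_V assms by blast+
  have "Q l a \<oplus>\<^sub>F \<ominus>\<^sub>F M l (M l a) = \<zero>\<^sub>F"
    using Q_nc(2)[OF assms(1,2) False assms(3)] nc_eq[OF assms(1,2) False assms(3)]
      M_uminus[OF assms(1) V(1)] by simp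
  thus ?thesis using diff_zero_iff[OF V(3,2)] by (simp add: F.minus_eq)
qed

lemma M_commute:
  assumes P: "k \<in> P" "l \<in> P" and np: "\<not> par k w" "\<not> par l w" and a: "a \<in> V"
  shows "M k (M l a) = M l (M k a)"
proof -
  have V: "M l a \<in> V" "M k a \<in> V" "M k (M l a) \<in> V" "M l (M k a) \<in> V" using M_V P a by blast+
  consider "par k l" | "par k z" | "par l z" | "\<not> par k l" "\<not> par k z" "\<not> par l z" by blast
  thus ?thesis
  proof cases
    case 1 thus ?thesis using M_cong P by simp
  next
    case 2
    thus ?thesis using M_cong[OF P(1) frame_P(2) 2] M_z V M_zero P a by simp
  next
    case 3
    thus ?thesis using M_cong[OF P(2) frame_P(2) 3] M_z V M_zero P a by simp
  next
    case 4
    have "\<ominus>\<^sub>F M k (M l a) = \<ominus>\<^sub>F M l (M k a)"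
      using M_nc_commute[OF P np 4 a]
      unfolding nc_eq[OF P(1) np(1) 4(2) a] nc_eq[OF P(2) np(2) 4(3) a]
        M_uminus[OF P(1) V(1)] M_uminus[OF P(2) V(2)] .
    thus ?thesis using F.minus_minus V unfolding F_simps(1) by metis
  qed
qed

subsection \<open>Coordinates\<close>


lemma e: "e \<in> V" "e \<noteq> \<zero>\<^sub>F"
proof -
  obtain q where "q \<in> P" "par q u" "q \<noteq> u" using generator_nontrivial[OF frame_P(3)] by metis
  hence "\<exists>v. v \<in> V \<and> v \<noteq> u" by (auto simp: V_def)
  from someI_ex[OF this] show "e \<in> V" "e \<noteq> \<zero>\<^sub>F" by (simp_all add: e_def F_simps)
qed

lemma md_id: "md id = \<zero>\<^sub>F"
  using md_cst[OF u_V] cst_u by simp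

text \<open>Otherwise the linear function with coefficient \<open>e\<close> and a zero at
  \<open>x\<close> would vanish at \<open>x\<close>, \<open>y\<close> and \<open>w\<close>.\<close>

lemma M_e_inj:
  assumes P: "x \<in> P" "y \<in> P" and np: "\<not> par x w" "\<not> par y w" and eq: "M x e = M y e"
  shows "par x y"
proof (rule ccontr)
  assume n: "\<not> par x y"
  have V: "M x e \<in> V" "\<ominus>\<^sub>F M x e \<in> V" "\<zero>\<^sub>F \<in> V" using M_V P e by (simp_all add: V_closed)
  note p = poly[OF V(3) e(1) V(2)]
  have "poly \<zero>\<^sub>F e (\<ominus>\<^sub>F M x e) = id"
    by (rule no_common_zero[OF p(1) P frame_P(1) n np])
      (use p P np eq V Q_zero in \<open>simp_all add: group_simps\<close>)
  hence "e = \<zero>\<^sub>F" using p(3) md_id by simp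
  thus False using e by simp
qed

text \<open>If \<open>e x - v\<close> had no zero off \<open>w\<close>, its circle would touch
  \<open>B\<close> on \<open>w\<close>. It would then be a constant, with middle coefficient zero
  instead of \<open>e\<close>.\<close>

lemma M_e_surj:
  assumes v: "v \<in> V"
  shows "\<exists>x. x \<in> P \<and> \<not> par x w \<and> M x e = v"
proof (rule ccontr)
  assume none: "\<not> ?thesis"
  have V: "\<ominus>\<^sub>F v \<in> V" "\<zero>\<^sub>F \<in> V" using v by (simp_all add: V_closed)
  note p = poly[OF V(2) e(1) V(1)]
  let ?h = "poly \<zero>\<^sub>F e (\<ominus>\<^sub>F v)"
  have nz: "ev ?h x \<noteq> \<zero>\<^sub>F" if x: "x \<in> P" "\<not> par x w" for x
  proof
    assume "ev ?h x = \<zero>\<^sub>F"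
    hence "M x e -\<^sub>F v = \<zero>\<^sub>F"
      using p(5)[OF x] Q_zero[OF x(1)] M_V[OF x(1) e(1)] v V by (simp add: F.minus_eq V_closed)
    thus False using none x diff_zero_iff[OF M_V[OF x(1) e(1)] v] by blast
  qed
  have "org x = ?h (org x) \<longleftrightarrow> par x w" if x: "x \<in> P" for x
    using nz[OF x] ev_fix_iff'[OF p(1) x] p(2) ev_cong[OF x frame_P(1)] by metis
  hence "touch w B (?h ` B)"
    unfolding touch_def using shift_org(3)[OF p(1)] by simp
  hence "?h \<in> elations w" using elation_iff_touch[OF p(1) frame_P(1)] by simp
  hence "cst (?h u) = ?h" by (rule cst_eqI)
  hence "md ?h = \<zero>\<^sub>F" using md_cst[OF shift_V[OF p(1) u_V]] by simp
  thus False using p(3) e by simp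
qed

lemma gen:
  assumes "s \<in> V" shows "gen s \<in> P" "\<not> par (gen s) w" "M (gen s) e = s"
  using someI_ex[OF M_e_surj[OF assms]] unfolding gen_def by blast+

lemma mult_eq_M:
  assumes "x \<in> P" "\<not> par x w" "t \<in> V"
  shows "t \<otimes>\<^sub>F M x e = M x t"
  using M_commute[OF gen(1)[OF assms(3)] assms(1) gen(2)[OF assms(3)] assms(2) e(1)] gen(3)[OF assms(3)]
  by (simp add: F_simps)

lemma F_mult: "s \<in> V \<Longrightarrow> s \<otimes>\<^sub>F t = M (gen s) t"
  by (simp add: F_simps)

lemma F_mult_commute: "s \<in> V \<Longrightarrow> t \<in> V \<Longrightarrow> s \<otimes>\<^sub>F t = t \<otimes>\<^sub>F s"
  using mult_eq_M[OF gen(1,2), of t s] gen(3)[of t] F_mult by simp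

lemma F_cring: "cring F"
proof (rule cringI[OF F_abelian_group])
  show "comm_monoid F"
  proof (rule comm_monoidI)
    show "x \<otimes>\<^sub>F y \<in> carrier F" if "x \<in> carrier F" "y \<in> carrier F" for x y
      using that F_mult M_V gen by simp
    show "\<one>\<^bsub>F\<^esub> \<in> carrier F" using e by simp
    show "x \<otimes>\<^sub>F y \<otimes>\<^sub>F t = x \<otimes>\<^sub>F (y \<otimes>\<^sub>F t)"
      if "x \<in> carrier F" "y \<in> carrier F" "t \<in> carrier F" for x y t
    proof -
      have V: "x \<in> V" "y \<in> V" "t \<in> V" using that by simp_all
      have c: "M (gen x) y \<in> V" using M_V gen V by blast
      have "x \<otimes>\<^sub>F y \<otimes>\<^sub>F t = t \<otimes>\<^sub>F (x \<otimes>\<^sub>F y)" using F_mult_commute[OF _ V(3)] F_mult V c by simp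
      also have "\<dots> = M (gen t) (M (gen x) y)" using F_mult V by simp
      also have "\<dots> = M (gen x) (M (gen t) y)"
        using M_commute[OF gen(1) gen(1) gen(2) gen(2)] V by blast
      also have "\<dots> = x \<otimes>\<^sub>F (t \<otimes>\<^sub>F y)" using F_mult V by simp
      finally show ?thesis using F_mult_commute V by simp
    qed
    show "\<one>\<^bsub>F\<^esub> \<otimes>\<^sub>F x = x" if "x \<in> carrier F" for x
      using that F_mult_commute[OF e(1), of x] F_mult[of x e] gen(3)[of x] by simp
    show "x \<otimes>\<^sub>F y = y \<otimes>\<^sub>F x" if "x \<in> carrier F" "y \<in> carrier F" for x y
      using that F_mult_commute by simp
  qed
  show "(x \<oplus>\<^sub>F y) \<otimes>\<^sub>F t = x \<otimes>\<^sub>F t \<oplus>\<^sub>F y \<otimes>\<^sub>F t"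
    if "x \<in> carrier F" "y \<in> carrier F" "t \<in> carrier F" for x y t
  proof -
    have V: "x \<in> V" "y \<in> V" "t \<in> V" "x \<oplus>\<^sub>F y \<in> V" using that by (simp_all add: V_closed)
    have "(x \<oplus>\<^sub>F y) \<otimes>\<^sub>F t = M (gen t) (x \<oplus>\<^sub>F y)" using F_mult_commute[OF V(4,3)] F_mult V by simp
    also have "\<dots> = t \<otimes>\<^sub>F x \<oplus>\<^sub>F t \<otimes>\<^sub>F y" using M_add gen V F_mult by simp
    finally show ?thesis using F_mult_commute V by simp
  qed
qed

text \<open>Inverses come by interpolation: the linear function with value \<open>e\<close> at
  \<open>gen a\<close> has the inverse of \<open>a\<close> as coefficient. It exists since
  \<open>gen a\<close> is parallel to neither \<open>w\<close> nor \<open>z\<close>.\<close>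

lemma F_field: "field F"
proof (rule cring.cring_fieldI2[OF F_cring])
  show "\<zero>\<^sub>F \<noteq> \<one>\<^bsub>F\<^esub>" using e by simp
  fix a assume "a \<in> carrier F" "a \<noteq> \<zero>\<^sub>F"
  hence a: "a \<in> V" "a \<noteq> \<zero>\<^sub>F" by simp_all
  note g = gen[OF a(1)]
  have gz: "\<not> par (gen a) z"
    using M_cong[OF g(1) frame_P(2)] M_z[OF e(1)] g a by metis
  note p = shift_org[OF cst_shift[OF e(1)] g(1)]
  obtain h where h: "h \<in> shifts" "h (org w) = w" "h (org z) = z" "h (org (gen a)) = cst e (org (gen a))"
    using shift_ex3[OF frame_P(1,2) g(1) frame_npar(1) _ _ frame_P(1) _ frame_P(2) _ p(1,2)]
      g gz par_refl par_sym frame_P by metis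
  have hu: "h u \<in> V" using shift_V h u_V by blast
  have "lin (h u) = h" using lin_eqI h by simp
  hence "M (gen a) (h u) = ev (cst e) (gen a)"
    using ev_eq_iff[OF h(1) cst_shift[OF e(1)] g(1)] h unfolding M_def by simp
  also have "\<dots> = e" using ev_cst e g by simp
  finally show "\<exists>b\<in>carrier F. a \<otimes>\<^sub>F b = \<one>\<^bsub>F\<^esub>" using F_mult a hu by auto
qed

definition coords :: "'p \<Rightarrow> 'p option \<times> 'p" where
  "coords p = (if par p w then None else Some (M p e), val p)"

lemma coords_shift:
  assumes h: "h \<in> shifts" and x: "x \<in> P"
  shows "coords (h (org x)) = (if par x w then (None, ev h w)
    else (Some (M x e), ev h w \<otimes>\<^sub>F M x e \<otimes>\<^sub>F M x e \<oplus>\<^sub>F md h \<otimes>\<^sub>F M x e \<oplus>\<^sub>F ev h z))"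
proof -
  note p = shift_org[OF h x]
  have w: "par (h (org x)) w \<longleftrightarrow> par x w"
    using p x frame_P par_sym par_trans by meson
  show ?thesis
  proof (cases "par x w")
    case True
    thus ?thesis using w ev_cong[OF x frame_P(1) True, of h] by (simp add: coords_def ev_def)
  next
    case False
    have V: "ev h w \<in> V" "md h \<in> V" "M x (ev h w) \<in> V" using ev_V md_V M_V h x frame_P by blast+
    have "M (h (org x)) e = M x e" using M_cong p x by blast
    moreover have "val (h (org x)) = Q x (ev h w) \<oplus>\<^sub>F M x (md h) \<oplus>\<^sub>F ev h z"
      using ev_eq_poly[OF h x False] by (simp add: ev_def)
    ultimately show ?thesis
      using w False mult_eq_M[OF x False] V Q_eq[OF x False] by (simp add: coords_def)
  qed
qed

lemma coords_circle:
  assumes h: "h \<in> shifts"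
  shows "coords ` h ` B = classical_circle F (ev h w) (md h) (ev h z)"
proof (intro equalityI subsetI)
  fix y assume "y \<in> coords ` h ` B"
  then obtain x where x: "x \<in> B" "y = coords (h x)" by blast
  hence xP: "x \<in> P" "org x = x" using B circle_sub proj_id by blast+
  thus "y \<in> classical_circle F (ev h w) (md h) (ev h z)"
    using coords_shift[OF h xP(1)] x M_V[OF xP(1) e(1)] unfolding classical_circle_def
    by (cases "par x w") auto
next
  fix y assume "y \<in> classical_circle F (ev h w) (md h) (ev h z)"
  then consider "y = (None, ev h w)" |
    s where "s \<in> V" "y = (Some s, ev h w \<otimes>\<^sub>F s \<otimes>\<^sub>F s \<oplus>\<^sub>F md h \<otimes>\<^sub>F s \<oplus>\<^sub>F ev h z)"
    unfolding classical_circle_def by auto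
  thus "y \<in> coords ` h ` B"
  proof cases
    case 1
    have "y = coords (h w)" using 1 coords_shift[OF h frame_P(1)] frame_P par_refl by simp
    thus ?thesis using wzu by blast
  next
    case 2
    note g = gen[OF 2(1)]
    have "y = coords (h (org (gen s)))" using 2 coords_shift[OF h g(1)] g by simp
    thus ?thesis using proj_in[OF B g(1)] by blast
  qed
qed

lemma coords_par:
  assumes "p \<in> P" "q \<in> P"
  shows "par p q \<longleftrightarrow> classical_par (coords p) (coords q)"
proof
  assume pq: "par p q"
  have "par p w \<longleftrightarrow> par q w"
    using par_trans[OF assms(1,2) frame_P(1) pq]
      par_trans[OF assms(2,1) frame_P(1) par_sym[OF assms pq]] by blast
  thus "classical_par (coords p) (coords q)"
    using M_cong[OF assms pq] by (simp add: classical_par_def coords_def)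
next
  assume "classical_par (coords p) (coords q)"
  hence "par p w \<and> par q w \<or> \<not> par p w \<and> \<not> par q w \<and> M p e = M q e"
    by (auto simp: classical_par_def coords_def split: if_splits)
  thus "par p q"
    using M_e_inj[OF assms] par_trans[OF assms(1) frame_P(1) assms(2)]
      par_sym[OF assms(2) frame_P(1)] by blast
qed

lemma coords_bij: "bij_betw coords P (classical_points F)"
proof (rule bij_betwI')
  fix p q assume P: "p \<in> P" "q \<in> P"
  show "coords p = coords q \<longleftrightarrow> p = q"
    using coords_par[OF P] val_inj[OF P] by (auto simp: classical_par_def coords_def)
next
  fix p assume "p \<in> P"
  thus "coords p \<in> classical_points F"
    using val_V M_V e by (simp add: coords_def classical_points_def)
next
  fix y assume "y \<in> classical_points F"
  then obtain x v where y: "y = (x, v)" "v \<in> V" "x = None \<or> (\<exists>s. x = Some s \<and> s \<in> V)"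
    unfolding classical_points_def by auto
  show "\<exists>p\<in>P. y = coords p"
  proof (cases x)
    case None
    note p = shift_org[OF sq_shift[OF y(2)] frame_P(1)]
    have "coords (sq v w) = (None, v)"
      using p ev_sq_w[OF y(2)] by (simp add: coords_def ev_def)
    thus ?thesis using p(1) y(1) None by (metis org_frame(1))
  next
    case (Some s)
    hence s: "s \<in> V" using y by simp
    note g = gen[OF s]
    note p = shift_org[OF cst_shift[OF y(2)] g(1)]
    have "\<not> par (cst v (org (gen s))) w" using p g frame_P par_sym par_trans by meson
    moreover have "M (cst v (org (gen s))) e = s" using M_cong[OF p(1) g(1) p(2)] g by simp
    ultimately have "coords (cst v (org (gen s))) = (Some s, v)"
      using ev_cst[OF y(2) g(1,2)] by (simp add: coords_def ev_def)
    thus ?thesis using p y Some by metis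
  qed
qed

lemma frame_iso: "iso_to_classical P C par F coords"
  unfolding iso_to_classical_def
proof (intro conjI ballI)
  show "(\<lambda>K. coords ` K) ` C = classical_circles F"
  proof (intro equalityI subsetI)
    fix Y assume "Y \<in> (\<lambda>K. coords ` K) ` C"
    then obtain K where K: "K \<in> C" "Y = coords ` K" by blast
    obtain h where h: "h \<in> shifts" "h ` B = K" using shift_ex B K by metis
    have "Y = classical_circle F (ev h w) (md h) (ev h z)" using coords_circle[OF h(1)] h K by simp
    moreover have "ev h w \<in> carrier F" "md h \<in> carrier F" "ev h z \<in> carrier F"
      using ev_V md_V h frame_P by simp_all
    ultimately show "Y \<in> classical_circles F" unfolding classical_circles_def by blast
  next
    fix Y assume "Y \<in> classical_circles F"
    then obtain a b c where "Y = classical_circle F a b c" and V: "a \<in> V" "b \<in> V" "c \<in> V"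
      unfolding classical_circles_def by auto
    hence "Y = coords ` poly a b c ` B" using coords_circle[OF poly(1)[OF V]] poly[OF V] by simp
    thus "Y \<in> (\<lambda>K. coords ` K) ` C" using shiftD(4)[OF poly(1)[OF V] B] by blast
  qed
qed (use coords_bij coords_par in blast)+

lemma frame_char_ne_2: "laguerre_char_ne_2 P C par"
proof -
  have "e \<oplus>\<^sub>F e \<noteq> \<zero>\<^sub>F" using no_2_torsion e by blast
  hence "\<one>\<^bsub>F\<^esub> \<oplus>\<^sub>F \<one>\<^bsub>F\<^esub> \<noteq> \<zero>\<^sub>F" by simp
  thus ?thesis unfolding laguerre_char_ne_2_def using F_field frame_iso by blast
qed

end

lemma (in laguerre_CS) char_ne_2: "laguerre_char_ne_2 P C par"
proof -
  obtain K a b c where "K \<in> C" "a \<in> K" "b \<in> K" "c \<in> K" "a \<noteq> b" "a \<noteq> c" "b \<noteq> c"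
    using nontrivial_circle by blast
  then interpret laguerre_frame P C par K a b c by unfold_locales
  show ?thesis by (rule frame_char_ne_2)
qed

subsection \<open>Classical planes of characteristic different from 2\<close>

context cring begin

lemmas ring_norm = a_minus_def l_distr r_distr l_minus r_minus minus_add a_ac m_ac
  r_neg1 r_neg2 r_neg l_neg

end

locale laguerre_coords = laguerre P C par + field F
  for P :: "'p set" and C :: "'p set set" and par :: "'p \<Rightarrow> 'p \<Rightarrow> bool"
    and F :: "('f, 'm) ring_scheme" (structure) +
  fixes \<phi> :: "'p \<Rightarrow> 'f option \<times> 'f"
  assumes iso: "iso_to_classical P C par F \<phi>" and char: "\<one> \<oplus> \<one> \<noteq> \<zero>"
begin

abbreviation X :: "'p \<Rightarrow> 'f option" where "X p \<equiv> fst (\<phi> p)"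

abbreviation Y :: "'p \<Rightarrow> 'f" where "Y p \<equiv> snd (\<phi> p)"

definition base :: "'f option set" where "base = insert None (Some ` carrier F)"

lemmas iso_parts = iso[unfolded iso_to_classical_def bij_betw_def, THEN conjunct1, THEN conjunct1]
  iso[unfolded iso_to_classical_def bij_betw_def, THEN conjunct1, THEN conjunct2]
  iso[unfolded iso_to_classical_def bij_betw_def, THEN conjunct2, THEN conjunct1]
  iso[unfolded iso_to_classical_def bij_betw_def, THEN conjunct2, THEN conjunct2]

lemma phi_eq_iff: "p \<in> P \<Longrightarrow> q \<in> P \<Longrightarrow> p = q \<longleftrightarrow> X p = X q \<and> Y p = Y q"
  using inj_on_eq_iff[OF iso_parts(1)] by (auto simp: prod_eq_iff)

lemma par_iff: "p \<in> P \<Longrightarrow> q \<in> P \<Longrightarrow> par p q \<longleftrightarrow> X p = X q"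
  using iso_parts(4) unfolding classical_par_def by simp

lemma X_base: "p \<in> P \<Longrightarrow> X p \<in> base" and Y_carrier [simp]: "p \<in> P \<Longrightarrow> Y p \<in> carrier F"
  using imageI[of p P \<phi>] unfolding iso_parts(2)
  by (auto simp: classical_points_def base_def split: prod.splits)

lemma point_ex:
  assumes "x \<in> base" "y \<in> carrier F"
  obtains p where "p \<in> P" "X p = x" "Y p = y"
proof -
  have "(x, y) \<in> \<phi> ` P" unfolding iso_parts(2) classical_points_def using assms by (auto simp: base_def)
  thus ?thesis using that by (metis fst_conv imageE snd_conv)
qed

text \<open>A quadratic form on the projective line \<open>base\<close>; at infinity its value is
  the leading coefficient, so contacts there are zeros like any others.\<close>

fun pv :: "'f \<Rightarrow> 'f \<Rightarrow> 'f \<Rightarrow> 'f option \<Rightarrow> 'f" where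
  "pv a b c None = a"
| "pv a b c (Some t) = a \<otimes> t \<otimes> t \<oplus> b \<otimes> t \<oplus> c"

text \<open>The derivative; its value at infinity is chosen such that \<open>secant\<close> holds without exception.\<close>

fun dv :: "'f \<Rightarrow> 'f \<Rightarrow> 'f \<Rightarrow> 'f option \<Rightarrow> 'f" where
  "dv a b c None = \<ominus> b"
| "dv a b c (Some t) = a \<otimes> t \<oplus> a \<otimes> t \<oplus> b"

lemma base_cases:
  assumes "x \<in> base" obtains "x = None" | t where "t \<in> carrier F" "x = Some t"
  using assms by (auto simp: base_def)

lemma pv_closed [simp]:
  "a \<in> carrier F \<Longrightarrow> b \<in> carrier F \<Longrightarrow> c \<in> carrier F \<Longrightarrow> x \<in> base \<Longrightarrow> pv a b c x \<in> carrier F"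
  by (auto elim: base_cases)

lemma dv_closed [simp]:
  "a \<in> carrier F \<Longrightarrow> b \<in> carrier F \<Longrightarrow> c \<in> carrier F \<Longrightarrow> x \<in> base \<Longrightarrow> dv a b c x \<in> carrier F"
  by (auto elim: base_cases)

lemma pv_diff:
  assumes "a \<in> carrier F" "b \<in> carrier F" "c \<in> carrier F" "a' \<in> carrier F" "b' \<in> carrier F" "c' \<in> carrier F"
    "x \<in> base"
  shows "pv (a \<ominus> a') (b \<ominus> b') (c \<ominus> c') x = pv a b c x \<ominus> pv a' b' c' x"
  using assms(7) by (rule base_cases) (use assms in \<open>simp_all add: ring_norm\<close>)

lemma dv_diff:
  assumes "a \<in> carrier F" "b \<in> carrier F" "c \<in> carrier F" "a' \<in> carrier F" "b' \<in> carrier F" "c' \<in> carrier F"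
    "x \<in> base"
  shows "dv (a \<ominus> a') (b \<ominus> b') (c \<ominus> c') x = dv a b c x \<ominus> dv a' b' c' x"
  using assms(7) by (rule base_cases) (use assms in \<open>simp_all add: ring_norm\<close>)

lemma diff_self [simp]: "x \<in> carrier F \<Longrightarrow> x \<ominus> x = \<zero>"
  by (simp add: a_minus_def r_neg)

lemma diff_zero_iff: "x \<in> carrier F \<Longrightarrow> y \<in> carrier F \<Longrightarrow> x \<ominus> y = \<zero> \<longleftrightarrow> x = y"
proof -
  assume V: "x \<in> carrier F" "y \<in> carrier F"
  hence "(x \<ominus> y) \<oplus> y = x" by (simp add: ring_norm)
  thus ?thesis using V by auto
qed

lemma double_cancel:
  assumes "x \<in> carrier F" "y \<in> carrier F" "x \<oplus> x = y \<oplus> y"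
  shows "x = y"
proof -
  have "(\<one> \<oplus> \<one>) \<otimes> (x \<ominus> y) = (x \<oplus> x) \<ominus> (y \<oplus> y)" using assms(1,2) by (simp add: ring_norm)
  also have "\<dots> = \<zero>" using assms by simp
  finally have "x \<ominus> y = \<zero>" using char integral_iff[of "\<one> \<oplus> \<one>" "x \<ominus> y"] assms(1,2) by simp
  thus ?thesis using diff_zero_iff assms by blast
qed

section \<open>Contact of classical circles\<close>

definition coef :: "'p set \<Rightarrow> 'f \<Rightarrow> 'f \<Rightarrow> 'f \<Rightarrow> bool" where
  "coef K a b c \<longleftrightarrow> K \<in> C \<and> a \<in> carrier F \<and> b \<in> carrier F \<and> c \<in> carrier F \<and>
     (\<forall>p\<in>P. p \<in> K \<longleftrightarrow> Y p = pv a b c (X p))"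

lemma coefI:
  assumes "K \<in> C" "a \<in> carrier F" "b \<in> carrier F" "c \<in> carrier F" "\<phi> ` K = classical_circle F a b c"
  shows "coef K a b c"
proof -
  have "p \<in> K \<longleftrightarrow> Y p = pv a b c (X p)" if p: "p \<in> P" for p
  proof -
    have "p \<in> K \<longleftrightarrow> \<phi> p \<in> \<phi> ` K"
      using inj_on_image_mem_iff[OF iso_parts(1) p] assms(1) circle_sub by blast
    also have "\<dots> \<longleftrightarrow> (X p, Y p) \<in> classical_circle F a b c" using assms by simp
    also have "\<dots> \<longleftrightarrow> Y p = pv a b c (X p)"
      using X_base[OF p] by (rule base_cases) (auto simp: classical_circle_def)
    finally show ?thesis .
  qed
  thus ?thesis using assms unfolding coef_def by blast
qed

lemma coef_ex:
  assumes "K \<in> C" obtains a b c where "coef K a b c"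
proof -
  have "\<phi> ` K \<in> classical_circles F" unfolding iso_parts(3)[symmetric] using assms by (rule imageI)
  then obtain a b c where "\<phi> ` K = classical_circle F a b c"
    "a \<in> carrier F" "b \<in> carrier F" "c \<in> carrier F"
    unfolding classical_circles_def by blast
  thus ?thesis using that coefI[OF assms] by metis
qed

lemma circle_of_coef:
  assumes "a \<in> carrier F" "b \<in> carrier F" "c \<in> carrier F" obtains K where "coef K a b c"
proof -
  have "classical_circle F a b c \<in> (\<lambda>K. \<phi> ` K) ` C"
    unfolding iso_parts(3) classical_circles_def using assms by blast
  then obtain K where "K \<in> C" "\<phi> ` K = classical_circle F a b c" by blast
  thus ?thesis using that coefI[OF _ assms] by metis
qed

text \<open>\<open>X\<close> maps \<open>K\<close> bijectively onto \<open>base\<close>, so the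
  common points are the zeros of the difference of the two forms.\<close>

lemma Int_single_iff:
  assumes K: "coef K a b c" and L: "coef L a' b' c'" and p: "p \<in> K"
  shows "K \<inter> L = {p} \<longleftrightarrow> {x \<in> base. pv (a \<ominus> a') (b \<ominus> b') (c \<ominus> c') x = \<zero>} = {X p}"
proof -
  have car: "a \<in> carrier F" "b \<in> carrier F" "c \<in> carrier F" "a' \<in> carrier F" "b' \<in> carrier F" "c' \<in> carrier F"
    using K L unfolding coef_def by blast+
  have KP: "q \<in> P" if "q \<in> K" for q using that K circle_sub unfolding coef_def by blast
  have L_iff: "q \<in> L \<longleftrightarrow> pv (a \<ominus> a') (b \<ominus> b') (c \<ominus> c') (X q) = \<zero>" if q: "q \<in> K" for q
    using q KP[OF q] K L pv_diff[OF car X_base[OF KP[OF q]]] car X_base[OF KP[OF q]]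
      diff_zero_iff[of "pv a b c (X q)" "pv a' b' c' (X q)"]
    unfolding coef_def by auto
  have eq: "q = r" if "q \<in> K" "r \<in> K" "X q = X r" for q r
    using that K phi_eq_iff[OF KP KP, of q r] KP unfolding coef_def by metis
  have ex: "\<exists>q\<in>K. X q = x" if x: "x \<in> base" for x
  proof -
    obtain q where "q \<in> P" "X q = x" "Y q = pv a b c x"
      using point_ex[OF x, of "pv a b c x"] x car by auto
    thus ?thesis using K unfolding coef_def by metis
  qed
  show ?thesis
  proof
    assume I: "K \<inter> L = {p}"
    show "{x \<in> base. pv (a \<ominus> a') (b \<ominus> b') (c \<ominus> c') x = \<zero>} = {X p}"
    proof (intro equalityI subsetI)
      fix x assume x: "x \<in> {x \<in> base. pv (a \<ominus> a') (b \<ominus> b') (c \<ominus> c') x = \<zero>}"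
      then obtain q where q: "q \<in> K" "X q = x" using ex by blast
      hence "q \<in> K \<inter> L" using L_iff[of q] x by simp
      thus "x \<in> {X p}" using I q by simp
    next
      fix x assume "x \<in> {X p}"
      moreover have "p \<in> L" using I by blast
      ultimately show "x \<in> {x \<in> base. pv (a \<ominus> a') (b \<ominus> b') (c \<ominus> c') x = \<zero>}"
        using L_iff[OF p] X_base[OF KP[OF p]] by simp
    qed
  next
    assume Z: "{x \<in> base. pv (a \<ominus> a') (b \<ominus> b') (c \<ominus> c') x = \<zero>} = {X p}"
    have "q = p" if "q \<in> K" "q \<in> L" for q
    proof -
      have "X q \<in> {x \<in> base. pv (a \<ominus> a') (b \<ominus> b') (c \<ominus> c') x = \<zero>}"
        using L_iff[OF that(1)] that X_base[OF KP[OF that(1)]] by simp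
      hence "X q = X p" unfolding Z by simp
      thus ?thesis using eq[OF that(1) p] by simp
    qed
    moreover have "p \<in> L"
    proof -
      have "X p \<in> {x \<in> base. pv (a \<ominus> a') (b \<ominus> b') (c \<ominus> c') x = \<zero>}" unfolding Z by simp
      thus ?thesis using L_iff[OF p] by simp
    qed
    ultimately show "K \<inter> L = {p}" using p by blast
  qed
qed

lemma inverse_ex:
  assumes "a \<in> carrier F" "a \<noteq> \<zero>" obtains b where "b \<in> carrier F" "a \<otimes> b = \<one>"
  using assms field_Units Units_inv_closed Units_r_inv by (metis DiffI empty_iff insert_iff)

definition disc :: "'f \<Rightarrow> 'f \<Rightarrow> 'f \<Rightarrow> 'f" where
  "disc a b c = b \<otimes> b \<ominus> (\<one> \<oplus> \<one>) \<otimes> (\<one> \<oplus> \<one>) \<otimes> a \<otimes> c"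

lemma disc_closed [simp]:
  "a \<in> carrier F \<Longrightarrow> b \<in> carrier F \<Longrightarrow> c \<in> carrier F \<Longrightarrow> disc a b c \<in> carrier F"
  by (simp add: disc_def)

text \<open>\<open>f'^2 - 4 a f\<close> is independent of \<open>t\<close>. When it vanishes and
  \<open>a\<close> is nonzero, \<open>f\<close> and \<open>f'\<close> have the same finite
  zeros.\<close>

lemma disc_eq:
  assumes "a \<in> carrier F" "b \<in> carrier F" "c \<in> carrier F" "t \<in> carrier F"
  shows "disc a b c = dv a b c (Some t) \<otimes> dv a b c (Some t) \<ominus>
    (\<one> \<oplus> \<one>) \<otimes> (\<one> \<oplus> \<one>) \<otimes> a \<otimes> pv a b c (Some t)"
  using assms by (simp add: disc_def ring_norm)

text \<open>A second zero is exhibited: if the only zero is infinity but \<open>b\<close> is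
  nonzero, the root of \<open>b x + c\<close>; if it is finite, the other root of the quadratic,
  which must then coincide with it.\<close>

lemma single_zero_dv:
  assumes car: "a \<in> carrier F" "b \<in> carrier F" "c \<in> carrier F"
    and Z: "{x \<in> base. pv a b c x = \<zero>} = {x}"
  shows "dv a b c x = \<zero>"
proof -
  have x: "x \<in> base" "pv a b c x = \<zero>" using Z by blast+
  have un: "y = x" if "y \<in> base" "pv a b c y = \<zero>" for y using Z that by blast
  from x(1) show ?thesis
  proof (rule base_cases)
    assume n: "x = None"
    have a: "a = \<zero>" using x n by simp
    have "b = \<zero>"
    proof (rule ccontr)
      assume "b \<noteq> \<zero>"
      then obtain i where i: "i \<in> carrier F" "b \<otimes> i = \<one>" using inverse_ex car by metis
      have "pv a b c (Some (\<ominus> (i \<otimes> c))) = \<ominus> (b \<otimes> i \<otimes> c) \<oplus> c"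
        using a car i(1) by (simp add: ring_norm)
      also have "\<dots> = \<zero>" using i car by (simp add: l_neg)
      finally have "Some (\<ominus> (i \<otimes> c)) = x" using un i car by (simp add: base_def)
      thus False using n by simp
    qed
    thus ?thesis using n by simp
  next
    fix t assume t: "t \<in> carrier F" "x = Some t"
    have "a \<noteq> \<zero>"
    proof
      assume "a = \<zero>"
      hence "None = x" using un[of None] by (simp add: base_def)
      thus False using t by simp
    qed
    then obtain i where i: "i \<in> carrier F" "a \<otimes> i = \<one>" using inverse_ex car by metis
    \<comment> \<open>The roots add up to \<open>- b / a\<close>, and \<open>i\<close> is the
      inverse of \<open>a\<close>.\<close>
    define s where "s = \<ominus> (t \<oplus> i \<otimes> b)"
    have s: "s \<in> carrier F" using i t car by (simp add: s_def)
    have as: "a \<otimes> s = \<ominus> (a \<otimes> t \<oplus> b)"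
    proof -
      have "a \<otimes> s = \<ominus> (a \<otimes> t \<oplus> (a \<otimes> i) \<otimes> b)" using i(1) t car by (simp add: s_def ring_norm)
      thus ?thesis using i car by simp
    qed
    have "pv a b c (Some s) = (a \<otimes> s) \<otimes> s \<oplus> b \<otimes> s \<oplus> c" by simp
    also have "\<dots> = \<ominus> ((a \<otimes> s) \<otimes> t) \<oplus> c"
    proof -
      have "(a \<otimes> s) \<otimes> s = \<ominus> (a \<otimes> t \<oplus> b) \<otimes> s" by (simp only: as)
      thus ?thesis using s t car by (simp add: ring_norm)
    qed
    also have "\<dots> = pv a b c (Some t)" unfolding as using t car by (simp add: ring_norm)
    finally have "Some s = x" using un[of "Some s"] s x t by (simp add: base_def)
    hence "t = s" using t by simp
    hence "a \<otimes> t = \<ominus> (a \<otimes> t \<oplus> b)" using as by simp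
    hence "a \<otimes> t \<oplus> (a \<otimes> t \<oplus> b) = \<ominus> (a \<otimes> t \<oplus> b) \<oplus> (a \<otimes> t \<oplus> b)" by simp
    also have "\<dots> = \<zero>" using t car by (simp add: l_neg)
    finally show ?thesis using t car by (simp add: a_assoc)
  qed
qed

lemma four_cancel:
  assumes "a \<in> carrier F" "y \<in> carrier F" "a \<noteq> \<zero>" "(\<one> \<oplus> \<one>) \<otimes> (\<one> \<oplus> \<one>) \<otimes> a \<otimes> y = \<zero>"
  shows "y = \<zero>"
  using assms char integral_iff by (metis a_closed m_closed one_closed)

lemma single_zero_iff:
  assumes car: "a \<in> carrier F" "b \<in> carrier F" "c \<in> carrier F"
  shows "(\<exists>x. {x \<in> base. pv a b c x = \<zero>} = {x}) \<longleftrightarrow> disc a b c = \<zero> \<and> \<not> (a = \<zero> \<and> b = \<zero> \<and> c = \<zero>)"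
proof
  assume "\<exists>x. {x \<in> base. pv a b c x = \<zero>} = {x}"
  then obtain x where Z: "{x \<in> base. pv a b c x = \<zero>} = {x}" by blast
  have x: "x \<in> base" "pv a b c x = \<zero>" "dv a b c x = \<zero>" using Z single_zero_dv[OF car Z] by blast+
  have "disc a b c = \<zero>"
    using x(1)
  proof (rule base_cases)
    assume n: "x = None"
    have "b = \<ominus> (\<ominus> b)" using car by simp
    also have "\<dots> = \<zero>" using x n by simp
    finally show ?thesis using n x car by (simp add: disc_def)
  next
    fix t assume t: "t \<in> carrier F" "x = Some t"
    show ?thesis
      unfolding disc_eq[OF car t(1)] using x(2,3) unfolding t(2) using car by (simp del: pv.simps dv.simps)
  qed
  moreover have "\<not> (a = \<zero> \<and> b = \<zero> \<and> c = \<zero>)"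
  proof
    assume "a = \<zero> \<and> b = \<zero> \<and> c = \<zero>"
    hence "None \<in> {x \<in> base. pv a b c x = \<zero>}" "Some \<zero> \<in> {x \<in> base. pv a b c x = \<zero>}"
      by (auto simp: base_def)
    hence "None = x" "Some \<zero> = x" unfolding Z by blast+
    thus False by simp
  qed
  ultimately show "disc a b c = \<zero> \<and> \<not> (a = \<zero> \<and> b = \<zero> \<and> c = \<zero>)" by blast
next
  assume d: "disc a b c = \<zero> \<and> \<not> (a = \<zero> \<and> b = \<zero> \<and> c = \<zero>)"
  show "\<exists>x. {x \<in> base. pv a b c x = \<zero>} = {x}"
  proof (cases "a = \<zero>")
    case True
    hence "b \<otimes> b = \<zero>" using d car by (simp add: disc_def ring_norm)
    hence b: "b = \<zero>" using integral_iff car by simp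
    hence "{x \<in> base. pv a b c x = \<zero>} = {None}"
      using True d car by (auto simp: base_def)
    thus ?thesis by blast
  next
    case False
    have "(\<one> \<oplus> \<one>) \<otimes> a \<noteq> \<zero>" using False char integral_iff car by simp
    then obtain i where i: "i \<in> carrier F" "(\<one> \<oplus> \<one>) \<otimes> a \<otimes> i = \<one>"
      using inverse_ex[of "(\<one> \<oplus> \<one>) \<otimes> a"] car by auto
    \<comment> \<open>This is \<open>- b / (2 a)\<close>, the zero of the derivative.\<close>
    define t where "t = \<ominus> (i \<otimes> b)"
    have t: "t \<in> carrier F" using i car t_def by simp
    have "dv a b c (Some t) = \<ominus> ((\<one> \<oplus> \<one>) \<otimes> a \<otimes> i \<otimes> b) \<oplus> b"
      unfolding t_def using i(1) car by (simp add: ring_norm)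
    hence dt: "dv a b c (Some t) = \<zero>" using i car by (simp add: l_neg)
    have root: "pv a b c (Some s) = \<zero> \<longleftrightarrow> dv a b c (Some s) = \<zero>" if s: "s \<in> carrier F" for s
    proof -
      have V: "dv a b c (Some s) \<in> carrier F" "pv a b c (Some s) \<in> carrier F" using s car by simp_all
      have "dv a b c (Some s) \<otimes> dv a b c (Some s) = (\<one> \<oplus> \<one>) \<otimes> (\<one> \<oplus> \<one>) \<otimes> a \<otimes> pv a b c (Some s)"
        using d disc_eq[OF car s] V car
          diff_zero_iff[of "dv a b c (Some s) \<otimes> dv a b c (Some s)"
            "(\<one> \<oplus> \<one>) \<otimes> (\<one> \<oplus> \<one>) \<otimes> a \<otimes> pv a b c (Some s)"]
        by (simp del: pv.simps dv.simps)
      thus ?thesis using four_cancel[OF car(1) V(2) False] integral_iff[OF V(1) V(1)] V car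
        by (auto simp del: pv.simps dv.simps)
    qed
    have un: "s = t" if s: "s \<in> carrier F" "dv a b c (Some s) = \<zero>" for s
    proof -
      have "(\<one> \<oplus> \<one>) \<otimes> a \<otimes> (s \<ominus> t) = dv a b c (Some s) \<ominus> dv a b c (Some t)"
        using s(1) t car by (simp add: ring_norm)
      also have "\<dots> = \<zero>" using s dt by simp
      finally have "s \<ominus> t = \<zero>"
        using \<open>(\<one> \<oplus> \<one>) \<otimes> a \<noteq> \<zero>\<close> integral_iff[of "(\<one> \<oplus> \<one>) \<otimes> a" "s \<ominus> t"] s t car by simp
      thus ?thesis using diff_zero_iff s t by blast
    qed
    have "x = Some t" if "x \<in> base" "pv a b c x = \<zero>" for x
      using that(1)
    proof (rule base_cases)
      assume "x = None" thus ?thesis using that False by simp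
    next
      fix s assume "s \<in> carrier F" "x = Some s"
      thus ?thesis using that root un by blast
    qed
    moreover have "Some t \<in> base" "pv a b c (Some t) = \<zero>"
      using t dt root by (auto simp: base_def simp del: pv.simps dv.simps)
    ultimately have "{x \<in> base. pv a b c x = \<zero>} = {Some t}" by blast
    thus ?thesis by blast
  qed
qed


lemma coefD:
  assumes "coef K a b c"
  shows "K \<in> C" "a \<in> carrier F" "b \<in> carrier F" "c \<in> carrier F"
    "p \<in> P \<Longrightarrow> p \<in> K \<longleftrightarrow> Y p = pv a b c (X p)" "p \<in> K \<Longrightarrow> p \<in> P" "p \<in> K \<Longrightarrow> Y p = pv a b c (X p)"
  using assms circle_sub unfolding coef_def by blast+

lemma coef_point_ex:
  assumes "coef K a b c" "x \<in> base"
  obtains p where "p \<in> K" "X p = x"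
proof -
  obtain p where "p \<in> P" "X p = x" "Y p = pv a b c x"
    using point_ex[OF assms(2), of "pv a b c x"] coefD(2-4)[OF assms(1)] assms(2) by auto
  thus ?thesis using that coefD(5)[OF assms(1)] by metis
qed

lemma touching_iff:
  assumes "coef K a b c" "coef L a' b' c'"
  shows "(\<exists>p. K \<inter> L = {p}) \<longleftrightarrow> disc (a \<ominus> a') (b \<ominus> b') (c \<ominus> c') = \<zero> \<and>
    \<not> (a \<ominus> a' = \<zero> \<and> b \<ominus> b' = \<zero> \<and> c \<ominus> c' = \<zero>)"
proof -
  let ?Z = "{x \<in> base. pv (a \<ominus> a') (b \<ominus> b') (c \<ominus> c') x = \<zero>}"
  have "(\<exists>p. K \<inter> L = {p}) \<longleftrightarrow> (\<exists>x. ?Z = {x})"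
  proof
    assume "\<exists>p. K \<inter> L = {p}"
    then obtain p where p: "K \<inter> L = {p}" by blast
    hence "p \<in> K" by blast
    thus "\<exists>x. ?Z = {x}" using Int_single_iff[OF assms] p by blast
  next
    assume "\<exists>x. ?Z = {x}"
    then obtain x where x: "?Z = {x}" by blast
    hence "x \<in> ?Z" by simp
    hence "x \<in> base" by simp
    then obtain p where p: "p \<in> K" "X p = x" using coef_point_ex[OF assms(1)] by metis
    thus "\<exists>p. K \<inter> L = {p}" using Int_single_iff[OF assms p(1)] x by blast
  qed
  thus ?thesis using single_zero_iff[of "a \<ominus> a'" "b \<ominus> b'" "c \<ominus> c'"]
      coefD(2-4)[OF assms(1)] coefD(2-4)[OF assms(2)] by simp
qed

text \<open>The coefficients of the square of the linear form vanishing at a point of the base.\<close>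

fun l1 :: "'f option \<Rightarrow> 'f" where "l1 None = \<zero>" | "l1 (Some t) = \<one>"

fun l2 :: "'f option \<Rightarrow> 'f" where "l2 None = \<zero>" | "l2 (Some t) = \<ominus> (t \<oplus> t)"

fun l3 :: "'f option \<Rightarrow> 'f" where "l3 None = \<one>" | "l3 (Some t) = t \<otimes> t"

lemma l_closed [simp]:
  "x \<in> base \<Longrightarrow> l1 x \<in> carrier F" "x \<in> base \<Longrightarrow> l2 x \<in> carrier F" "x \<in> base \<Longrightarrow> l3 x \<in> carrier F"
  by (auto elim: base_cases)

text \<open>The scalar is the coefficient left free by a double zero: \<open>c\<close> at infinity,
  where \<open>a\<close> and \<open>b\<close> vanish, and \<open>a\<close> at a finite
  point.\<close>

lemma double_zero:
  assumes car: "a \<in> carrier F" "b \<in> carrier F" "c \<in> carrier F" and x: "x \<in> base"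
    and z: "pv a b c x = \<zero>" "dv a b c x = \<zero>"
  shows "\<exists>r\<in>carrier F. a = r \<otimes> l1 x \<and> b = r \<otimes> l2 x \<and> c = r \<otimes> l3 x"
  using x
proof (rule base_cases)
  assume n: "x = None"
  have "b = \<ominus> (\<ominus> b)" using car by simp
  also have "\<dots> = \<zero>" using z n by simp
  finally show ?thesis using z n car by (intro bexI[of _ c]) auto
next
  fix t assume t: "t \<in> carrier F" "x = Some t"
  have "b = dv a b c x \<oplus> a \<otimes> \<ominus> (t \<oplus> t)" unfolding t(2) using t(1) car by (simp add: ring_norm)
  hence b: "b = a \<otimes> \<ominus> (t \<oplus> t)" using z t car by simp
  have "c = pv a b c x \<ominus> dv a b c x \<otimes> t \<oplus> a \<otimes> (t \<otimes> t)"
    unfolding t(2) using t(1) car by (simp add: ring_norm)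
  hence c: "c = a \<otimes> (t \<otimes> t)" using z t car by simp
  show ?thesis by (rule bexI[of _ a]) (use b c car t in auto)
qed

text \<open>The discriminant is a quadratic form in the coefficients that vanishes on squares of
  linear forms, so no \<open>r^2\<close> appears; its polar form against the square at
  \<open>x\<close> is evaluation at \<open>x\<close> times -4.\<close>

lemma disc_add_square:
  assumes car: "a \<in> carrier F" "b \<in> carrier F" "c \<in> carrier F" "r \<in> carrier F" and x: "x \<in> base"
  shows "disc (a \<oplus> r \<otimes> l1 x) (b \<oplus> r \<otimes> l2 x) (c \<oplus> r \<otimes> l3 x) =
    disc a b c \<ominus> (\<one> \<oplus> \<one>) \<otimes> (\<one> \<oplus> \<one>) \<otimes> pv a b c x \<otimes> r"
  using x by (rule base_cases) (use car in \<open>simp_all add: disc_def ring_norm\<close>)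

lemma pv_add_square:
  assumes car: "a \<in> carrier F" "b \<in> carrier F" "c \<in> carrier F" "r \<in> carrier F" and x: "x \<in> base"
  shows "pv (a \<oplus> r \<otimes> l1 x) (b \<oplus> r \<otimes> l2 x) (c \<oplus> r \<otimes> l3 x) x = pv a b c x"
  using x by (rule base_cases) (use car in \<open>simp_all add: ring_norm\<close>)

lemma square_nonzero:
  assumes "x \<in> base" "r \<in> carrier F" "r \<otimes> l1 x = \<zero>" "r \<otimes> l3 x = \<zero>"
  shows "r = \<zero>"
  using assms(1) by (rule base_cases) (use assms in auto)

lemma coef_eqI: "coef K a b c \<Longrightarrow> coef L a b c \<Longrightarrow> K = L"
  using coefD(5,6) by blast

lemma cancel_diff:
  "u \<in> carrier F \<Longrightarrow> v \<in> carrier F \<Longrightarrow> v \<oplus> (u \<ominus> v) = u"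
  "u \<in> carrier F \<Longrightarrow> v \<in> carrier F \<Longrightarrow> (v \<oplus> u) \<ominus> v = u"
  by (simp_all add: ring_norm)

lemma pencil_iff:
  assumes K: "coef K a b c" and p: "p \<in> K"
  shows "M \<in> tangent_pencil C p K \<longleftrightarrow>
    (\<exists>r\<in>carrier F. coef M (a \<oplus> r \<otimes> l1 (X p)) (b \<oplus> r \<otimes> l2 (X p)) (c \<oplus> r \<otimes> l3 (X p)))"
proof
  note car = coefD(2-4)[OF K]
  have pP: "p \<in> P" and x: "X p \<in> base" using coefD(6)[OF K p] X_base by blast+
  {
    assume "M \<in> tangent_pencil C p K"
    hence M: "M \<in> C" "M = K \<or> M \<inter> K = {p}" unfolding tangent_pencil_def tangent_at_def by blast+
    show "\<exists>r\<in>carrier F. coef M (a \<oplus> r \<otimes> l1 (X p)) (b \<oplus> r \<otimes> l2 (X p)) (c \<oplus> r \<otimes> l3 (X p))"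
    proof (cases "M = K")
      case True
      thus ?thesis using K car x by (intro bexI[of _ "\<zero>"]) auto
    next
      case False
      obtain a' b' c' where M': "coef M a' b' c'" using coef_ex M(1) by metis
      note car' = coefD(2-4)[OF M']
      have I: "M \<inter> K = {p}" using M False by blast
      hence "p \<in> M" by blast
      hence Z: "{x \<in> base. pv (a' \<ominus> a) (b' \<ominus> b) (c' \<ominus> c) x = \<zero>} = {X p}"
        using Int_single_iff[OF M' K] I by blast
      hence "X p \<in> {x \<in> base. pv (a' \<ominus> a) (b' \<ominus> b) (c' \<ominus> c) x = \<zero>}" by simp
      moreover have "dv (a' \<ominus> a) (b' \<ominus> b) (c' \<ominus> c) (X p) = \<zero>"
        using single_zero_dv[OF _ _ _ Z] car car' by simp
      ultimately obtain r where r: "r \<in> carrier F" "a' \<ominus> a = r \<otimes> l1 (X p)"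
        "b' \<ominus> b = r \<otimes> l2 (X p)" "c' \<ominus> c = r \<otimes> l3 (X p)"
        using double_zero[of "a' \<ominus> a" "b' \<ominus> b" "c' \<ominus> c" "X p"] car car' x by auto
      have "a \<oplus> r \<otimes> l1 (X p) = a'" "b \<oplus> r \<otimes> l2 (X p) = b'" "c \<oplus> r \<otimes> l3 (X p) = c'"
        unfolding r(2-4)[symmetric] using car car' by (simp_all add: cancel_diff)
      thus ?thesis using M' r(1) by (intro bexI[of _ r]) auto
    qed
  next
    assume "\<exists>r\<in>carrier F. coef M (a \<oplus> r \<otimes> l1 (X p)) (b \<oplus> r \<otimes> l2 (X p)) (c \<oplus> r \<otimes> l3 (X p))"
    then obtain r where r: "r \<in> carrier F"
      and M: "coef M (a \<oplus> r \<otimes> l1 (X p)) (b \<oplus> r \<otimes> l2 (X p)) (c \<oplus> r \<otimes> l3 (X p))" by blast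
    have pM: "p \<in> M"
      using coefD(5)[OF M pP] coefD(7)[OF K p] pv_add_square[OF car r x] by simp
    show "M \<in> tangent_pencil C p K"
    proof (cases "r = \<zero>")
      case True
      hence "coef M a b c" using M car x by simp
      hence "M = K" using coef_eqI K by blast
      thus ?thesis using pM coefD(1)[OF K] unfolding tangent_pencil_def tangent_at_def by blast
    next
      case False
      have d: "(a \<oplus> r \<otimes> l1 (X p)) \<ominus> a = r \<otimes> l1 (X p)" "(b \<oplus> r \<otimes> l2 (X p)) \<ominus> b = r \<otimes> l2 (X p)"
        "(c \<oplus> r \<otimes> l3 (X p)) \<ominus> c = r \<otimes> l3 (X p)"
        using car r x by (simp_all add: cancel_diff)
      have "disc (r \<otimes> l1 (X p)) (r \<otimes> l2 (X p)) (r \<otimes> l3 (X p)) = \<zero>"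
        using disc_add_square[of "\<zero>" "\<zero>" "\<zero>" r "X p"] r x
        by (auto simp: disc_def elim: base_cases)
      hence "\<exists>q. M \<inter> K = {q}"
        using touching_iff[OF M K] square_nonzero[OF x r] False unfolding d by blast
      then obtain q where "M \<inter> K = {q}" by blast
      moreover have "p \<in> M \<inter> K" using p pM by blast
      ultimately have "M \<inter> K = {p}" by simp
      thus ?thesis using coefD(1)[OF M] unfolding tangent_pencil_def tangent_at_def by blast
    qed
  }
qed

lemma classical_C: "axiom_C P C par"
  unfolding axiom_C_def
proof (intro ballI)
  fix K L p assume KL: "K \<in> C" "L \<in> C" and p: "p \<in> K - L"
  obtain a b c where K: "coef K a b c" using coef_ex KL by metis
  obtain a' b' c' where L: "coef L a' b' c'" using coef_ex KL by metis
  note car = coefD(2-4)[OF K] coefD(2-4)[OF L]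
  have pK: "p \<in> K" using p by blast
  have pP: "p \<in> P" and x: "X p \<in> base" using coefD(6)[OF K pK] X_base by blast+
  let ?x = "X p" and ?v = "pv (a \<ominus> a') (b \<ominus> b') (c \<ominus> c') (X p)"
    and ?d = "disc (a \<ominus> a') (b \<ominus> b') (c \<ominus> c')"
  have dcar: "a \<ominus> a' \<in> carrier F" "b \<ominus> b' \<in> carrier F" "c \<ominus> c' \<in> carrier F" using car by simp_all
  have v: "?v \<in> carrier F" "?v \<noteq> \<zero>"
    using coefD(5)[OF L pP] coefD(7)[OF K pK] p pv_diff[OF car x] car x
      diff_zero_iff[of "pv a b c ?x" "pv a' b' c' ?x"] by auto
  have shift: "(u \<oplus> y) \<ominus> u' = (u \<ominus> u') \<oplus> y"
    if "u \<in> carrier F" "u' \<in> carrier F" "y \<in> carrier F" for u u' y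
    using that by (simp add: ring_norm)
  have touch: "(\<exists>q. M \<inter> L = {q}) \<longleftrightarrow> ?d \<ominus> (\<one> \<oplus> \<one>) \<otimes> (\<one> \<oplus> \<one>) \<otimes> ?v \<otimes> r = \<zero>"
    if r: "r \<in> carrier F" and M: "coef M (a \<oplus> r \<otimes> l1 ?x) (b \<oplus> r \<otimes> l2 ?x) (c \<oplus> r \<otimes> l3 ?x)" for M r
  proof -
    note sh = shift[OF car(1,4), of "r \<otimes> l1 ?x"] shift[OF car(2,5), of "r \<otimes> l2 ?x"]
      shift[OF car(3,6), of "r \<otimes> l3 ?x"]
    \<comment> \<open>The added square vanishes at \<open>X p\<close>, so the difference with
      \<open>L\<close> keeps its nonzero value \<open>?v\<close> there.\<close>
    have nz: "\<not> ((a \<ominus> a') \<oplus> r \<otimes> l1 ?x = \<zero> \<and> (b \<ominus> b') \<oplus> r \<otimes> l2 ?x = \<zero> \<and> (c \<ominus> c') \<oplus> r \<otimes> l3 ?x = \<zero>)"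
    proof
      assume "(a \<ominus> a') \<oplus> r \<otimes> l1 ?x = \<zero> \<and> (b \<ominus> b') \<oplus> r \<otimes> l2 ?x = \<zero> \<and> (c \<ominus> c') \<oplus> r \<otimes> l3 ?x = \<zero>"
      hence "?v = pv \<zero> \<zero> \<zero> ?x" using pv_add_square[OF dcar r x] by simp
      also have "\<dots> = \<zero>" using x by (auto elim: base_cases)
      finally show False using v by simp
    qed
    thus ?thesis using touching_iff[OF M L] sh r x disc_add_square[OF dcar r x] by simp
  qed
  have four: "(\<one> \<oplus> \<one>) \<otimes> (\<one> \<oplus> \<one>) \<otimes> ?v \<noteq> \<zero>" using char v integral_iff by simp
  then obtain i where i: "i \<in> carrier F" "(\<one> \<oplus> \<one>) \<otimes> (\<one> \<oplus> \<one>) \<otimes> ?v \<otimes> i = \<one>"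
    using inverse_ex[of "(\<one> \<oplus> \<one>) \<otimes> (\<one> \<oplus> \<one>) \<otimes> ?v"] v by auto
  have D: "?d \<in> carrier F" using dcar by simp
  show "\<exists>!M. M \<in> tangent_pencil C p K \<and> (\<exists>x. M \<inter> L = {x})"
  proof (rule ex_ex1I)
    \<comment> \<open>The contact condition is affine in \<open>r\<close> with factor
      \<open>4 ?v\<close>, which \<open>i\<close> inverts; this is its solution.\<close>
    have r: "i \<otimes> ?d \<in> carrier F" using i D by simp
    obtain M where M: "coef M (a \<oplus> (i \<otimes> ?d) \<otimes> l1 ?x) (b \<oplus> (i \<otimes> ?d) \<otimes> l2 ?x) (c \<oplus> (i \<otimes> ?d) \<otimes> l3 ?x)"
      using circle_of_coef[of "a \<oplus> (i \<otimes> ?d) \<otimes> l1 ?x" "b \<oplus> (i \<otimes> ?d) \<otimes> l2 ?x" "c \<oplus> (i \<otimes> ?d) \<otimes> l3 ?x"]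
        car r x by auto
    have "(\<one> \<oplus> \<one>) \<otimes> (\<one> \<oplus> \<one>) \<otimes> ?v \<otimes> (i \<otimes> ?d) = ((\<one> \<oplus> \<one>) \<otimes> (\<one> \<oplus> \<one>) \<otimes> ?v \<otimes> i) \<otimes> ?d"
      using i(1) D v(1) by (simp add: m_ac)
    hence "?d \<ominus> (\<one> \<oplus> \<one>) \<otimes> (\<one> \<oplus> \<one>) \<otimes> ?v \<otimes> (i \<otimes> ?d) = \<zero>" using i(2) D by simp
    thus "\<exists>M. M \<in> tangent_pencil C p K \<and> (\<exists>x. M \<inter> L = {x})"
      using touch[OF r M] pencil_iff[OF K pK] M r by blast
  next
    fix M N
    assume "M \<in> tangent_pencil C p K \<and> (\<exists>x. M \<inter> L = {x})"
      and "N \<in> tangent_pencil C p K \<and> (\<exists>x. N \<inter> L = {x})"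
    then obtain r s where r: "r \<in> carrier F" and M: "coef M (a \<oplus> r \<otimes> l1 ?x) (b \<oplus> r \<otimes> l2 ?x) (c \<oplus> r \<otimes> l3 ?x)"
      and s: "s \<in> carrier F" and N: "coef N (a \<oplus> s \<otimes> l1 ?x) (b \<oplus> s \<otimes> l2 ?x) (c \<oplus> s \<otimes> l3 ?x)"
      and t: "\<exists>x. M \<inter> L = {x}" "\<exists>x. N \<inter> L = {x}"
      using pencil_iff[OF K pK] by auto
    have "?d = (\<one> \<oplus> \<one>) \<otimes> (\<one> \<oplus> \<one>) \<otimes> ?v \<otimes> r" "?d = (\<one> \<oplus> \<one>) \<otimes> (\<one> \<oplus> \<one>) \<otimes> ?v \<otimes> s"
      using touch[OF r M] touch[OF s N] t D v(1) r s diff_zero_iff by simp_all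
    hence "(\<one> \<oplus> \<one>) \<otimes> (\<one> \<oplus> \<one>) \<otimes> ?v \<otimes> r = (\<one> \<oplus> \<one>) \<otimes> (\<one> \<oplus> \<one>) \<otimes> ?v \<otimes> s" by simp
    hence "r = s" using m_lcancel[OF four _ r s] v(1) by simp
    thus "M = N" using M N coef_eqI by blast
  qed
qed


text \<open>The quotient \<open>(y - y') / (x - x')\<close>, that is, the nilpotent part of the logarithm of a
  difference of dual numbers; concyclicity is the reality of the cross ratio of dual numbers.\<close>

fun quot :: "'f option \<Rightarrow> 'f option \<Rightarrow> 'f \<Rightarrow> 'f \<Rightarrow> 'f" where
  "quot (Some s) (Some t) y y' = inv (s \<ominus> t) \<otimes> (y \<ominus> y')"
| "quot None (Some t) y y' = t \<otimes> y"
| "quot (Some s) None y y' = s \<otimes> y'"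
| "quot None None y y' = \<zero>"

definition lam :: "'p \<Rightarrow> 'p \<Rightarrow> 'f" where
  "lam p q = quot (X p) (X q) (Y p) (Y q)"

lemma inv_diff:
  assumes "s \<in> carrier F" "t \<in> carrier F" "s \<noteq> t"
  shows "inv (s \<ominus> t) \<in> carrier F" "inv (s \<ominus> t) \<otimes> (s \<ominus> t) = \<one>"
proof -
  have "s \<ominus> t \<in> carrier F - {\<zero>}" using assms diff_zero_iff by simp
  hence "s \<ominus> t \<in> Units F" unfolding field_Units .
  thus "inv (s \<ominus> t) \<in> carrier F" "inv (s \<ominus> t) \<otimes> (s \<ominus> t) = \<one>"
    using Units_inv_closed Units_l_inv by blast+
qed

lemma inv_diff_swap:
  assumes "s \<in> carrier F" "t \<in> carrier F" "s \<noteq> t"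
  shows "inv (t \<ominus> s) = \<ominus> (inv (s \<ominus> t))"
proof -
  note i = inv_diff[OF assms] and j = inv_diff[OF assms(2,1)] and n = assms(3)
  have "inv (t \<ominus> s) = inv (t \<ominus> s) \<otimes> (inv (s \<ominus> t) \<otimes> (s \<ominus> t))" using i j n by simp
  also have "\<dots> = \<ominus> (inv (s \<ominus> t) \<otimes> (inv (t \<ominus> s) \<otimes> (t \<ominus> s)))"
    using i(1) j(1) n assms(1,2) by (simp add: ring_norm)
  finally show ?thesis using i j n by simp
qed

lemma lam_closed:
  assumes "p \<in> P" "q \<in> P" "X p \<noteq> X q"
  shows "lam p q \<in> carrier F"
  using X_base[OF assms(1)] X_base[OF assms(2)]
  by (elim base_cases) (use assms inv_diff(1) in \<open>auto simp: lam_def\<close>)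

lemma lam_sym:
  assumes "p \<in> P" "q \<in> P" "X p \<noteq> X q"
  shows "lam p q = lam q p"
  using X_base[OF assms(1)]
proof (rule base_cases)
  assume "X p = None"
  thus ?thesis using X_base[OF assms(2)] assms by (auto elim: base_cases simp: lam_def)
next
  fix s assume s: "s \<in> carrier F" "X p = Some s"
  show ?thesis using X_base[OF assms(2)]
  proof (rule base_cases)
    fix t assume t: "t \<in> carrier F" "X q = Some t"
    hence n: "s \<noteq> t" using s assms by auto
    show ?thesis
      using inv_diff_swap[OF s(1) t(1) n] inv_diff(1)[OF s(1) t(1) n] s t assms
      by (simp add: lam_def ring_norm)
  qed (use s in \<open>simp add: lam_def\<close>)
qed

lemma secant:
  assumes K: "coef K a b c" and p: "p \<in> K" "q \<in> K" and n: "X p \<noteq> X q"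
  shows "lam p q \<oplus> lam p q = dv a b c (X p) \<oplus> dv a b c (X q)"
proof -
  note car = coefD(2-4)[OF K]
  have P: "p \<in> P" "q \<in> P" using coefD(6)[OF K] p by blast+
  have Y: "Y p = pv a b c (X p)" "Y q = pv a b c (X q)" using coefD(7)[OF K] p by blast+
  show ?thesis using X_base[OF P(1)]
  proof (rule base_cases)
    assume p': "X p = None"
    show ?thesis using X_base[OF P(2)]
      by (rule base_cases) (use p' n Y car in \<open>auto simp: lam_def ring_norm\<close>)
  next
    fix s assume s: "s \<in> carrier F" "X p = Some s"
    show ?thesis using X_base[OF P(2)]
    proof (rule base_cases)
      assume "X q = None"
      thus ?thesis using s Y car by (simp add: lam_def ring_norm)
    next
      fix t assume t: "t \<in> carrier F" "X q = Some t"
      hence st: "s \<noteq> t" using s n by auto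
      note i = inv_diff[OF s(1) t(1) st]
      have f: "Y p \<ominus> Y q = (s \<ominus> t) \<otimes> (a \<otimes> s \<oplus> a \<otimes> t \<oplus> b)"
        using Y s t car by (simp add: ring_norm)
      have "lam p q = inv (s \<ominus> t) \<otimes> ((s \<ominus> t) \<otimes> (a \<otimes> s \<oplus> a \<otimes> t \<oplus> b))"
        using s t f by (simp add: lam_def)
      also have "\<dots> = (inv (s \<ominus> t) \<otimes> (s \<ominus> t)) \<otimes> (a \<otimes> s \<oplus> a \<otimes> t \<oplus> b)"
        using i(1) s(1) t(1) car by (simp add: m_assoc)
      finally have "lam p q = a \<otimes> s \<oplus> a \<otimes> t \<oplus> b" using i s t car by simp
      thus ?thesis using s t car by (simp add: ring_norm)
    qed
  qed
qed

text \<open>The factor by which \<open>lam p r\<close> changes with the ordinate of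
  \<open>p\<close>, see \<open>lam_diff\<close>. It determines the second abscissa
  (\<open>kap_inj\<close>), which makes \<open>lam_rigid\<close> possible.\<close>

fun kap :: "'f option \<Rightarrow> 'f option \<Rightarrow> 'f" where
  "kap (Some s) (Some t) = inv (s \<ominus> t)"
| "kap None (Some t) = t"
| "kap (Some s) None = \<zero>"
| "kap None None = \<zero>"

lemma kap_closed: "x \<in> base \<Longrightarrow> y \<in> base \<Longrightarrow> x \<noteq> y \<Longrightarrow> kap x y \<in> carrier F"
  by (elim base_cases) (auto simp: inv_diff)

lemma kap_inj:
  assumes "x \<in> base" "y \<in> base" "y' \<in> base" "x \<noteq> y" "x \<noteq> y'" "kap x y = kap x y'"
  shows "y = y'"
  using assms(1)
proof (rule base_cases)
  assume "x = None"
  thus ?thesis using assms by (auto elim!: base_cases)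
next
  fix s assume s: "s \<in> carrier F" "x = Some s"
  have nz: "inv (s \<ominus> t) \<noteq> \<zero>" if "t \<in> carrier F" "s \<noteq> t" for t
    using inv_diff[OF s(1) that] s(1) that(1) by auto
  have eq: "t = t'" if t: "t \<in> carrier F" "s \<noteq> t" and t': "t' \<in> carrier F" "s \<noteq> t'"
    and i: "inv (s \<ominus> t) = inv (s \<ominus> t')" for t t'
  proof -
    have "inv (s \<ominus> t) \<otimes> (s \<ominus> t) = inv (s \<ominus> t) \<otimes> (s \<ominus> t')"
      using inv_diff[OF s(1) t] inv_diff[OF s(1) t'] i by simp
    hence "s \<ominus> t = s \<ominus> t'"
      using m_lcancel[OF nz[OF t] inv_diff(1)[OF s(1) t]] s(1) t(1) t'(1) by simp
    hence "s \<ominus> (s \<ominus> t) = s \<ominus> (s \<ominus> t')" by simp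
    thus ?thesis using s(1) t(1) t'(1) by (simp add: ring_norm)
  qed
  show ?thesis
    using assms(2)
  proof (rule base_cases)
    assume y: "y = None"
    show ?thesis
      using assms(3)
    proof (rule base_cases)
      fix t assume "t \<in> carrier F" "y' = Some t"
      thus ?thesis using nz[of t] s y assms(5,6) by simp
    qed (simp add: y)
  next
    fix t assume t: "t \<in> carrier F" "y = Some t"
    show ?thesis
      using assms(3)
    proof (rule base_cases)
      assume "y' = None"
      thus ?thesis using nz[of t] s t assms(4,6) by simp
    next
      fix t' assume "t' \<in> carrier F" "y' = Some t'"
      thus ?thesis using eq[of t t'] s t assms(4-6) by simp
    qed
  qed
qed

lemma lam_diff:
  assumes P: "p \<in> P" "q \<in> P" "r \<in> P" and x: "X p = X q" "X r \<noteq> X p"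
  shows "lam p r \<ominus> lam q r = kap (X p) (X r) \<otimes> (Y p \<ominus> Y q)"
proof -
  have i: "i \<otimes> (Y p \<ominus> Y r) \<ominus> i \<otimes> (Y q \<ominus> Y r) = i \<otimes> (Y p \<ominus> Y q)" if "i \<in> carrier F" for i
  proof -
    have "(a \<ominus> b) \<ominus> (c \<ominus> b) = a \<ominus> c" if "a \<in> carrier F" "b \<in> carrier F" "c \<in> carrier F" for a b c
      using that by (simp add: ring_norm)
    hence "(Y p \<ominus> Y r) \<ominus> (Y q \<ominus> Y r) = Y p \<ominus> Y q" using P by simp
    moreover have "i \<otimes> (Y p \<ominus> Y r) \<ominus> i \<otimes> (Y q \<ominus> Y r) = i \<otimes> ((Y p \<ominus> Y r) \<ominus> (Y q \<ominus> Y r))"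
      using that P by (simp add: ring_norm)
    ultimately show ?thesis by simp
  qed
  show ?thesis
    using X_base[OF P(1)]
  proof (rule base_cases)
    assume "X p = None"
    thus ?thesis using X_base[OF P(3)] P x by (auto elim!: base_cases simp: lam_def ring_norm)
  next
    fix s assume s: "s \<in> carrier F" "X p = Some s"
    show ?thesis
      using X_base[OF P(3)]
    proof (rule base_cases)
      assume "X r = None"
      thus ?thesis using s x P by (simp add: lam_def)
    next
      fix t assume t: "t \<in> carrier F" "X r = Some t"
      hence "inv (s \<ominus> t) \<in> carrier F" using inv_diff(1)[OF s(1) t(1)] s x by auto
      from i[OF this] show ?thesis using s t x by (simp add: lam_def)
    qed
  qed
qed

lemma diff_eq_swap:
  assumes "a \<in> carrier F" "b \<in> carrier F" "c \<in> carrier F" "d \<in> carrier F"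
  shows "a \<ominus> b = c \<ominus> d \<longleftrightarrow> a \<oplus> d = c \<oplus> b"
proof -
  have "(a \<ominus> b) \<oplus> b = a" "(c \<ominus> d) \<oplus> d = c" using assms by (simp_all add: ring_norm)
  hence 1: "(a \<ominus> b) \<oplus> (b \<oplus> d) = a \<oplus> d" "(c \<ominus> d) \<oplus> (b \<oplus> d) = c \<oplus> b"
    using assms a_assoc[of "a \<ominus> b" b d] a_assoc[of "c \<ominus> d" d b] a_comm[of b d] by simp_all
  have "a \<ominus> b = c \<ominus> d \<longleftrightarrow> (a \<ominus> b) \<oplus> (b \<oplus> d) = (c \<ominus> d) \<oplus> (b \<oplus> d)"
    using add.right_cancel[of "b \<oplus> d" "a \<ominus> b" "c \<ominus> d"] assms by simp
  thus ?thesis unfolding 1 .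
qed

text \<open>Subtracting along the generator of \<open>p\<close> and \<open>q\<close> reduces the
  equation to one between two values of \<open>kap\<close>. In \<open>concyclic_iff\<close> it
  handles the clause with parallel pairs and also shows that three points determine the
  fourth.\<close>

lemma lam_rigid:
  assumes P: "p \<in> P" "q \<in> P" "r \<in> P" "s \<in> P" and x: "X p = X q" "X r \<noteq> X p" "X s \<noteq> X p" "p \<noteq> q"
  shows "lam p r \<oplus> lam q s = lam p s \<oplus> lam q r \<longleftrightarrow> X r = X s"
proof -
  have c: "lam p r \<in> carrier F" "lam q r \<in> carrier F" "lam p s \<in> carrier F" "lam q s \<in> carrier F"
    using lam_closed P x by metis+
  have y: "Y p \<ominus> Y q \<in> carrier F" "Y p \<ominus> Y q \<noteq> \<zero>"
    using P x phi_eq_iff diff_zero_iff by auto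
  have k: "kap (X p) (X r) \<in> carrier F" "kap (X p) (X s) \<in> carrier F"
    using kap_closed X_base P x by metis+
  have "lam p r \<oplus> lam q s = lam p s \<oplus> lam q r \<longleftrightarrow> lam p r \<ominus> lam q r = lam p s \<ominus> lam q s"
    using diff_eq_swap[OF c] by simp
  also have "\<dots> \<longleftrightarrow> kap (X p) (X r) \<otimes> (Y p \<ominus> Y q) = kap (X p) (X s) \<otimes> (Y p \<ominus> Y q)"
    using lam_diff P x by simp
  also have "\<dots> \<longleftrightarrow> kap (X p) (X r) = kap (X p) (X s)"
    using m_rcancel[OF y(2,1) k] .
  also have "\<dots> \<longleftrightarrow> X r = X s" using kap_inj[of "X p" "X r" "X s"] X_base P x by metis
  finally show ?thesis .
qed

lemma concyclic_iff:
  assumes P: "p \<in> P" "q \<in> P" "r \<in> P" "s \<in> P" and n: "p \<noteq> q" "r \<noteq> s"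
    and x: "X p \<noteq> X r" "X q \<noteq> X s" "X p \<noteq> X s" "X q \<noteq> X r"
  shows "concyclic C par p q r s \<longleftrightarrow> lam p r \<oplus> lam q s = lam p s \<oplus> lam q r"
proof -
  have c: "lam p r \<in> carrier F" "lam q r \<in> carrier F" "lam p s \<in> carrier F" "lam q s \<in> carrier F"
    using lam_closed P x by blast+
  \<comment> \<open>By \<open>secant\<close>, twice either side is the sum of the derivatives at all
    four points. The point \<open>t\<close> is variable because the converse uses the point of the
    circle on the generator of \<open>s\<close>.\<close>
  have on_circle: "lam p r \<oplus> lam q t = lam p t \<oplus> lam q r"
    if K: "K \<in> C" "p \<in> K" "q \<in> K" "r \<in> K" "t \<in> K" and t: "X p \<noteq> X t" "X q \<noteq> X t" for K t
  proof -
    obtain a b d where k: "coef K a b d" using coef_ex K by metis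
    have tP: "t \<in> P" using K circle_sub by blast
    let ?d = "\<lambda>y. dv a b d (X y)"
    have D: "?d p \<in> carrier F" "?d q \<in> carrier F" "?d r \<in> carrier F" "?d t \<in> carrier F"
      using coefD(2-4)[OF k] X_base P tP by simp_all
    have ct: "lam p t \<in> carrier F" "lam q t \<in> carrier F" using lam_closed P tP t by blast+
    note s = secant[OF k K(2,4) x(1)] secant[OF k K(3,5) t(2)] secant[OF k K(2,5) t(1)]
      secant[OF k K(3,4) x(4)]
    have "(lam p r \<oplus> lam q t) \<oplus> (lam p r \<oplus> lam q t) = (lam p r \<oplus> lam p r) \<oplus> (lam q t \<oplus> lam q t)"
      using c ct by (simp add: a_ac)
    also have "\<dots> = (lam p t \<oplus> lam p t) \<oplus> (lam q r \<oplus> lam q r)"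
      unfolding s using D by (simp add: a_ac)
    also have "\<dots> = (lam p t \<oplus> lam q r) \<oplus> (lam p t \<oplus> lam q r)"
      using c ct by (simp add: a_ac)
    finally show ?thesis using double_cancel[of "lam p r \<oplus> lam q t" "lam p t \<oplus> lam q r"] c ct by simp
  qed
  show ?thesis
  proof
    assume "concyclic C par p q r s"
    then consider K where "K \<in> C" "p \<in> K" "q \<in> K" "r \<in> K" "s \<in> K" | "par p q" "par r s"
      unfolding concyclic_def by blast
    thus "lam p r \<oplus> lam q s = lam p s \<oplus> lam q r"
    proof cases
      case 1 thus ?thesis using on_circle x by blast
    next
      case 2 thus ?thesis using lam_rigid[OF P] par_iff P n x by simp
    qed
  next
    assume eq: "lam p r \<oplus> lam q s = lam p s \<oplus> lam q r"
    show "concyclic C par p q r s"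
    proof (cases "X p = X q")
      case True
      hence "X r = X s" using lam_rigid[OF P True] eq n x by metis
      thus ?thesis using True par_iff P x unfolding concyclic_def by simp
    next
      case False
      \<comment> \<open>As \<open>lam\<close> is symmetric the two pairs can be exchanged, and
        rigidity for \<open>r\<close>, \<open>s\<close> would give \<open>X p = X q\<close>.\<close>
      have rs: "X r \<noteq> X s"
      proof
        assume rs: "X r = X s"
        have "lam r p \<oplus> lam s q = lam r q \<oplus> lam s p"
          using eq lam_sym P x c by (simp add: a_comm)
        thus False using lam_rigid[of r s p q] P rs x n False by simp
      qed
      obtain K where K: "K \<in> C" "p \<in> K" "q \<in> K" "r \<in> K"
        using circle_ex[of p q r] par_iff P False x by metis
      \<comment> \<open>\<open>?t\<close> satisfies the same equation as \<open>s\<close>.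
        Subtracting leaves a rigid equation for these parallel points, so they coincide.\<close>
      let ?t = "proj K s"
      have t: "?t \<in> K" "?t \<in> P" "X ?t = X s"
        using proj_in proj_P proj_par par_iff K P by auto
      have "lam p r \<oplus> lam q ?t = lam p ?t \<oplus> lam q r" using on_circle K t x by simp
      have ct: "lam p ?t \<in> carrier F" "lam q ?t \<in> carrier F" using lam_closed P t x by metis+
      have 1: "lam p r \<ominus> lam q r = lam p s \<ominus> lam q s" using diff_eq_swap c eq by simp
      have 2: "lam p r \<ominus> lam q r = lam p ?t \<ominus> lam q ?t"
        using diff_eq_swap[of "lam p r" "lam q r" "lam p ?t" "lam q ?t"] c ct
          \<open>lam p r \<oplus> lam q ?t = lam p ?t \<oplus> lam q r\<close> by simp
      have "lam p s \<oplus> lam q ?t = lam p ?t \<oplus> lam q s"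
        using diff_eq_swap[of "lam p s" "lam q s" "lam p ?t" "lam q ?t"] c ct 1 2 by simp
      hence "lam ?t p \<oplus> lam s q = lam ?t q \<oplus> lam s p"
        using lam_sym P x t c ct by (simp add: a_comm)
      hence "?t = s" using lam_rigid[of ?t s p q] P t x False by metis
      thus ?thesis using K t unfolding concyclic_def by metis
    qed
  qed
qed

lemma concyclic_npar:
  assumes P: "p \<in> P" "q \<in> P" "r \<in> P" "s \<in> P" and n: "distinct [p, q, r, s]"
    and c: "concyclic C par p q r s"
  shows "X p \<noteq> X r" "X q \<noteq> X s" "X p \<noteq> X s" "X q \<noteq> X r"
proof -
  have "X p \<noteq> X r \<and> X q \<noteq> X s \<and> X p \<noteq> X s \<and> X q \<noteq> X r"
  proof -
    consider K where "K \<in> C" "p \<in> K" "q \<in> K" "r \<in> K" "s \<in> K" | "par p q" "par r s" "\<not> par p r"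
      using c unfolding concyclic_def by blast
    thus ?thesis
    proof cases
      case 1
      thus ?thesis using circle_par_eq[of K] par_iff P n by auto
    next
      case 2
      thus ?thesis using par_iff P by auto
    qed
  qed
  thus "X p \<noteq> X r" "X q \<noteq> X s" "X p \<noteq> X s" "X q \<noteq> X r" by blast+
qed

lemma classical_miquelian: "miquelian P C par"
  unfolding miquelian_def
proof (intro ballI impI)
  fix a b c d e f g h
  assume P: "a \<in> P" "b \<in> P" "c \<in> P" "d \<in> P" "e \<in> P" "f \<in> P" "g \<in> P" "h \<in> P"
    and n: "distinct [a, b, c, d, e, f, g, h]"
    and c: "concyclic C par a c b d" "concyclic C par a e b h" "concyclic C par a g d h"
      "concyclic C par b f c e" "concyclic C par c g d f"
  have x1: "X a \<noteq> X b" "X c \<noteq> X d" "X a \<noteq> X d" "X c \<noteq> X b" using concyclic_npar[OF _ _ _ _ _ c(1)] P n by auto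
  have x2: "X a \<noteq> X b" "X e \<noteq> X h" "X a \<noteq> X h" "X e \<noteq> X b" using concyclic_npar[OF _ _ _ _ _ c(2)] P n by auto
  have x3: "X a \<noteq> X d" "X g \<noteq> X h" "X a \<noteq> X h" "X g \<noteq> X d" using concyclic_npar[OF _ _ _ _ _ c(3)] P n by auto
  have x4: "X b \<noteq> X c" "X f \<noteq> X e" "X b \<noteq> X e" "X f \<noteq> X c" using concyclic_npar[OF _ _ _ _ _ c(4)] P n by auto
  have x5: "X c \<noteq> X d" "X g \<noteq> X f" "X c \<noteq> X f" "X g \<noteq> X d" using concyclic_npar[OF _ _ _ _ _ c(5)] P n by auto
  have y: "X e \<noteq> X f" "X g \<noteq> X h" "X e \<noteq> X h" "X g \<noteq> X f" using x2 x3 x4 x5 by auto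
  have e1: "lam a b \<oplus> lam c d = lam a d \<oplus> lam c b" using concyclic_iff[of a c b d] P n x1 c by simp
  have e2: "lam a b \<oplus> lam e h = lam a h \<oplus> lam e b" using concyclic_iff[of a e b h] P n x2 c by simp
  have e3: "lam a d \<oplus> lam g h = lam a h \<oplus> lam g d" using concyclic_iff[of a g d h] P n x3 c by simp
  have e4: "lam c b \<oplus> lam e f = lam e b \<oplus> lam c f"
    using concyclic_iff[of b f c e] P n x4 c lam_sym[of b c] lam_sym[of f e] lam_sym[of b e] lam_sym[of f c]
    by simp
  have e5: "lam c d \<oplus> lam g f = lam c f \<oplus> lam g d" using concyclic_iff[of c g d f] P n x5 c by simp
  have l: "lam a b \<in> carrier F" "lam c d \<in> carrier F" "lam a d \<in> carrier F" "lam c b \<in> carrier F"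
    "lam e h \<in> carrier F" "lam a h \<in> carrier F" "lam e b \<in> carrier F" "lam g h \<in> carrier F"
    "lam g d \<in> carrier F" "lam e f \<in> carrier F" "lam c f \<in> carrier F" "lam g f \<in> carrier F"
    using lam_closed P x1 x2 x3 x4 x5 y by simp_all
  \<comment> \<open>The sum of \<open>e3\<close> and \<open>e4\<close> is rewritten by
    \<open>e2\<close> and \<open>e5\<close>, and \<open>e1\<close> lets the added term
    cancel.\<close>
  have "(lam e f \<oplus> lam g h) \<oplus> (lam a d \<oplus> lam c b) = (lam c b \<oplus> lam e f) \<oplus> (lam a d \<oplus> lam g h)"
    using l by (simp add: a_ac)
  also have "\<dots> = (lam a h \<oplus> lam e b) \<oplus> (lam c f \<oplus> lam g d)" unfolding e3 e4 using l by (simp add: a_ac)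
  also have "\<dots> = (lam e h \<oplus> lam g f) \<oplus> (lam a b \<oplus> lam c d)"
    unfolding e2[symmetric] e5[symmetric] using l by (simp add: a_ac)
  finally have "lam e f \<oplus> lam g h = lam e h \<oplus> lam g f"
    unfolding e1 using add.right_cancel[of "lam a d \<oplus> lam c b"] l by simp
  thus "concyclic C par e g f h" using concyclic_iff[of e g f h] P n y by simp
qed

text \<open>Serves the degenerate cases of (S), where contact points coincide and at most three
  points have to be joined.\<close>

lemma circle_ex_weak:
  assumes P: "p \<in> P" "q \<in> P" "r \<in> P" and n: "p = q \<or> \<not> par p q" "q = r \<or> \<not> par q r" "p = r \<or> \<not> par p r"
  obtains K where "K \<in> C" "p \<in> K" "q \<in> K" "r \<in> K"
proof -
  have two: "\<exists>K\<in>C. x \<in> K \<and> y \<in> K" if "x \<in> P" "y \<in> P" "x = y \<or> \<not> par x y" for x y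
  proof -
    obtain t where t: "t \<in> P" "\<not> par t x" "\<not> par t y" using third_generator \<open>x \<in> P\<close> \<open>y \<in> P\<close> by metis
    show ?thesis
    proof (cases "par x y")
      case False
      thus ?thesis using circle_ex[of x y t] t that par_sym by metis
    next
      case True
      obtain v where v: "v \<in> P" "\<not> par v x" "\<not> par v t" using third_generator t \<open>x \<in> P\<close> by metis
      thus ?thesis using circle_ex[of x t v] t that True par_sym by metis
    qed
  qed
  consider "p = q" | "q = r" | "p = r" | "\<not> par p q" "\<not> par q r" "\<not> par p r" using n by blast
  thus ?thesis
  proof cases
    case 1 thus ?thesis using two[OF P(1,3) n(3)] that by blast
  next
    case 2 thus ?thesis using two[OF P(1,2) n(1)] that by blast
  next
    case 3 thus ?thesis using two[OF P(1,2) n(1)] that by blast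
  next
    case 4 thus ?thesis using circle_ex[OF P] that by metis
  qed
qed

lemma tangent_dv:
  assumes K: "coef K a b c" "coef L a' b' c'" and p: "K \<inter> L = {p}"
  shows "dv a b c (X p) = dv a' b' c' (X p)"
proof -
  note car = coefD(2-4)[OF K(1)] coefD(2-4)[OF K(2)]
  have pK: "p \<in> K" using p by blast
  hence x: "X p \<in> base" using coefD(6)[OF K(1)] X_base by blast
  have "{x \<in> base. pv (a \<ominus> a') (b \<ominus> b') (c \<ominus> c') x = \<zero>} = {X p}"
    using Int_single_iff[OF K pK] p by blast
  hence "dv (a \<ominus> a') (b \<ominus> b') (c \<ominus> c') (X p) = \<zero>" using single_zero_dv car by simp
  thus ?thesis using dv_diff[OF car x] diff_zero_iff car x by simp
qed

lemma classical_S: "axiom_S P C par"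
  unfolding axiom_S_def
proof (intro ballI impI)
  fix K L M N a b c d
  assume cir: "K \<in> C" "L \<in> C" "M \<in> C" "N \<in> C" and P: "a \<in> P" "b \<in> P" "c \<in> P" "d \<in> P"
    and I: "K \<inter> L = {a}" "L \<inter> M = {b}" "M \<inter> N = {c}" "N \<inter> K = {d}" and ac: "\<not> par a c"
  have i: "a \<in> K" "a \<in> L" "b \<in> L" "b \<in> M" "c \<in> M" "c \<in> N" "d \<in> N" "d \<in> K" using I by blast+
  have np: "a = b \<or> \<not> par a b" "b = c \<or> \<not> par b c" "c = d \<or> \<not> par c d" "a = d \<or> \<not> par a d"
    using circle_par_eq cir i by metis+
  show "\<exists>Z\<in>C. a \<in> Z \<and> b \<in> Z \<and> c \<in> Z \<and> d \<in> Z"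
  proof (cases "a = b \<or> b = c \<or> c = d \<or> a = d \<or> b = d")
    case True
    thus ?thesis
    proof (elim disjE)
      assume "a = b" thus ?thesis using circle_ex_weak[of a c d] P np ac by metis
    next
      assume "b = c" thus ?thesis using circle_ex_weak[of a c d] P np ac by metis
    next
      assume "c = d" thus ?thesis using circle_ex_weak[of a b c] P np ac by metis
    next
      assume "a = d" thus ?thesis using circle_ex_weak[of a b c] P np ac by metis
    next
      assume "b = d" thus ?thesis using circle_ex_weak[of a b c] P np ac by metis
    qed
  next
    case False
    obtain k1 k2 k3 where K: "coef K k1 k2 k3" using coef_ex cir by metis
    obtain a1 a2 a3 where L: "coef L a1 a2 a3" using coef_ex cir by metis
    obtain m1 m2 m3 where M: "coef M m1 m2 m3" using coef_ex cir by metis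
    obtain n1 n2 n3 where N: "coef N n1 n2 n3" using coef_ex cir by metis
    have x: "X a \<noteq> X b" "X c \<noteq> X d" "X a \<noteq> X d" "X c \<noteq> X b" using np False par_iff P by auto
    have ne: "a \<noteq> c" "b \<noteq> d" using False ac par_refl P by auto
    note t = tangent_dv[OF K L I(1)] tangent_dv[OF L M I(2)] tangent_dv[OF M N I(3)] tangent_dv[OF N K I(4)]
    have s: "lam a b \<oplus> lam a b = dv a1 a2 a3 (X a) \<oplus> dv a1 a2 a3 (X b)"
      "lam c d \<oplus> lam c d = dv n1 n2 n3 (X c) \<oplus> dv n1 n2 n3 (X d)"
      "lam a d \<oplus> lam a d = dv k1 k2 k3 (X a) \<oplus> dv k1 k2 k3 (X d)"
      "lam c b \<oplus> lam c b = dv m1 m2 m3 (X c) \<oplus> dv m1 m2 m3 (X b)"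
      using secant[OF L i(2,3) x(1)] secant[OF N i(6,7) x(2)] secant[OF K i(1,8) x(3)]
        secant[OF M i(5,4) x(4)] by blast+
    have l: "lam a b \<in> carrier F" "lam c d \<in> carrier F" "lam a d \<in> carrier F" "lam c b \<in> carrier F"
      using lam_closed P x by blast+
    have D: "dv a1 a2 a3 (X a) \<in> carrier F" "dv a1 a2 a3 (X b) \<in> carrier F"
      "dv n1 n2 n3 (X c) \<in> carrier F" "dv n1 n2 n3 (X d) \<in> carrier F"
      using coefD(2-4)[OF L] coefD(2-4)[OF N] X_base P by simp_all
    have "(lam a b \<oplus> lam c d) \<oplus> (lam a b \<oplus> lam c d) = (lam a b \<oplus> lam a b) \<oplus> (lam c d \<oplus> lam c d)"
      using l by (simp add: a_ac)
    also have "\<dots> = (lam a d \<oplus> lam a d) \<oplus> (lam c b \<oplus> lam c b)"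
      unfolding s t(1) t(2)[symmetric] t(3) t(4)[symmetric] using D t(1) by (simp add: a_ac)
    also have "\<dots> = (lam a d \<oplus> lam c b) \<oplus> (lam a d \<oplus> lam c b)" using l by (simp add: a_ac)
    finally have "lam a b \<oplus> lam c d = lam a d \<oplus> lam c b"
      using double_cancel[of "lam a b \<oplus> lam c d" "lam a d \<oplus> lam c b"] l by simp
    \<comment> \<open>The order puts the non-parallel points \<open>a\<close> and \<open>c\<close>
      into the first pair, so only the circle clause of \<open>concyclic\<close> can hold.\<close>
    hence "concyclic C par a c b d" using concyclic_iff[of a c b d] P ne x by simp
    thus ?thesis using ac unfolding concyclic_def by blast
  qed
qed

end

theorem theorem2p2:
  fixes P :: "'p set" and C :: "'p set set" and par :: "'p \<Rightarrow> 'p \<Rightarrow> bool"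
  assumes "laguerre_plane P C par"
  shows "(axiom_C P C par \<and> axiom_S P C par) \<longleftrightarrow>
         (miquelian P C par \<and> laguerre_char_ne_2 P C par)"
proof -
  have coords: "laguerre_coords P C par F \<phi>"
    if "field F" "iso_to_classical P C par F \<phi>" "\<one>\<^bsub>F\<^esub> \<oplus>\<^bsub>F\<^esub> \<one>\<^bsub>F\<^esub> \<noteq> \<zero>\<^bsub>F\<^esub>"
    for F :: "'p ring" and \<phi>
    using that assms
    by (simp add: laguerre_coords_def laguerre_def laguerre_coords_axioms_def)
  have "axiom_C P C par \<and> axiom_S P C par \<and> miquelian P C par" if "laguerre_char_ne_2 P C par"
  proof -
    obtain F :: "'p ring" and \<phi> where "laguerre_coords P C par F \<phi>"
      using \<open>laguerre_char_ne_2 P C par\<close> coords unfolding laguerre_char_ne_2_def by blast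
    thus ?thesis
      using laguerre_coords.classical_C laguerre_coords.classical_S
        laguerre_coords.classical_miquelian by blast
  qed
  moreover have "laguerre_char_ne_2 P C par" if "axiom_C P C par" "axiom_S P C par"
  proof -
    interpret laguerre_CS P C par by unfold_locales (use assms that in auto)
    show ?thesis by (rule char_ne_2)
  qed
  ultimately show ?thesis by blast
qed

end
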